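(* If $k'$ is odd and $\gcd(k',p-1)=1$, then $\vartheta_p(\chi_{P'},\chi_P)=1$, i.e. $G_{f'}(\chi_{P'})=p^{(f'-f)/2}G_f(\chi_P)$.
   Context: Let $h=2^tp_1p_2\cdots p_\ell$ with $t\ge0$ and $p_1,\dots,p_\ell$ distinct odd primes, and let $p$ be a prime, $p\nmid h$, such that for every divisor $d=2^sp_{i_1}\cdots p_{i_m}$ of $h$, if $\langle p\rangle$ has index $u$ in $(\mathbb{Z}/d\mathbb{Z})^\ast$ then it has index $u$ in $(\mathbb{Z}/d'\mathbb{Z})^\ast$ for every $d'=2^sp_{i_1}^{x_1}\cdots p_{i_m}^{x_m}$ with all $x_i\ge1$. Let $e=[(\mathbb{Z}/h\mathbb{Z})^\ast:\langle p\rangle]$. Let $k=2^tp_1^{e_1}\cdots p_\ell^{e_\ell}$ with all $e_i\ge1$, $k'=kp_1$, $f=\phi(k)/e$, $f'=\phi(k')/e$ ($\phi$ Euler's function; these are the orders of $p$ modulo $k$ and $k'$), $q=p^f$, $q'=p^{f'}$. Write $\zeta_n=e^{2\pi i/n}$. Let $P'$ be a prime ideal of $\mathbb{Z}[\zeta_{k'}]$ lying over $p$ and $P=P'\cap\mathbb{Z}[\zeta_k]$; identify $\mathbb{F}_q=\mathbb{Z}[\zeta_k]/P$ and $\mathbb{F}_{q'}=\mathbb{Z}[\zeta_{k'}]/P'$. The Teichmüller character $\chi_P$ is defined by letting $\chi_P(\alpha+P)$ be the unique power of $\zeta_k$ congruent to $\alpha^{(q-1)/k}$ modulo $P$ for $\alpha\notin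 P$ (and $0$ for $\alpha\in P$); $\chi_{P'}$ is defined analogously with $k',q',P'$. For a finite field $\mathbb{F}_{p^r}$ with canonical additive character $\psi(x)=\zeta_p^{\mathrm{Tr}_{\mathbb{F}_{p^r}/\mathbb{F}_p}(x)}$ and a multiplicative character $\chi$, $G_r(\chi)=\sum_{x\in\mathbb{F}_{p^r}^\ast}\chi(x)\psi(x)$. For nontrivial multiplicative characters $\chi$ of $\mathbb{F}_{p^r}$ and $\chi'$ of $\mathbb{F}_{p^{r'}}$ with $r\mid r'$, $\vartheta_p(\chi',\chi)=G_{r'}(\chi')/(p^{(r'-r)/2}G_r(\chi))$. *)

theory Defs
  imports
    Complex_Main
    "HOL-Algebra.Algebraic_Closure_Type"
    "HOL-Algebra.Generated_Rings"
    "HOL-Number_Theory.Number_Theory"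
begin

text \<open>
  The index of the subgroup generated by \<open>a\<close> in the unit group of the integers modulo \<open>n\<close>.
  It is meaningful for \<open>n \<ge> 2\<close> and \<open>a\<close> coprime to \<open>n\<close>; for \<open>n = 1\<close> the library's
  residue ring is not a ring, since its unit 1 is not in its carrier.
\<close>

definition unit_index :: "nat \<Rightarrow> nat \<Rightarrow> nat" where
  "unit_index n a =
     (let G = units_of (residue_ring (int n))
      in card (rcosets\<^bsub>G\<^esub> (generate G {int a mod int n})))"

definition zeta :: "nat \<Rightarrow> complex" where
  "zeta n = exp (2 * of_real pi * \<i> / of_nat n)"

definition cyclotomic_ring :: "nat \<Rightarrow> complex ring" where
  "cyclotomic_ring n =
     (ring_of_type_algebra :: complex ring)\<lparr>carrier := generate_ring ring_of_type_algebra {zeta n}\<rparr>"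

definition prime_over :: "nat \<Rightarrow> nat \<Rightarrow> complex set \<Rightarrow> bool" where
  "prime_over n p P \<longleftrightarrow>
     primeideal P (cyclotomic_ring n) \<and> P \<inter> \<int> = (\<lambda>a::int. of_int (int p * a)) ` UNIV"

text \<open>
  In the following definitions the residue field is an arbitrary finite field \<open>F\<close>
  of order \<open>p ^ r\<close>. The trace to the prime field is the sum of the conjugates under the
  Frobenius map; it is an element of \<open>F\<close>, so the additive character uses its representative
  among the integers \<open>0, \<dots>, p - 1\<close>.
\<close>

definition ff_trace :: "nat \<Rightarrow> nat \<Rightarrow> ('a, 'b) ring_scheme \<Rightarrow> 'a \<Rightarrow> 'a" where
  "ff_trace p r F x = (\<Oplus>\<^bsub>F\<^esub>i\<in>{..<r}. x [^]\<^bsub>F\<^esub> (p ^ i))"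

definition additive_char :: "nat \<Rightarrow> nat \<Rightarrow> ('a, 'b) ring_scheme \<Rightarrow> 'a \<Rightarrow> complex" where
  "additive_char p r F x =
     zeta p ^ (THE j::nat. j < p \<and> [j] \<cdot>\<^bsub>F\<^esub> \<one>\<^bsub>F\<^esub> = ff_trace p r F x)"

definition gauss_sum :: "nat \<Rightarrow> nat \<Rightarrow> ('a, 'b) ring_scheme \<Rightarrow> ('a \<Rightarrow> complex) \<Rightarrow> complex" where
  "gauss_sum p r F \<chi> = (\<Sum>x\<in>carrier F - {\<zero>\<^bsub>F\<^esub>}. \<chi> x * additive_char p r F x)"

definition vartheta ::
  "nat \<Rightarrow> nat \<Rightarrow> ('a, 'b) ring_scheme \<Rightarrow> ('a \<Rightarrow> complex) \<Rightarrow>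
   nat \<Rightarrow> ('c, 'd) ring_scheme \<Rightarrow> ('c \<Rightarrow> complex) \<Rightarrow> complex" where
  "vartheta p r' F' \<chi>' r F \<chi> =
     gauss_sum p r' F' \<chi>' / (of_real (real p powr ((real r' - real r) / 2)) * gauss_sum p r F \<chi>)"

text \<open>
  The Teichmueller character, as a function on the residue classes modulo \<open>P\<close>. The defining
  congruence does not depend on the representative \<open>\<alpha>\<close>, so it is required for all of them.
\<close>

definition teichmueller :: "nat \<Rightarrow> nat \<Rightarrow> complex set \<Rightarrow> complex set \<Rightarrow> complex" where
  "teichmueller k q P C =
     (if C = P then 0
      else (THE z. (\<exists>j::nat. z = zeta k ^ j) \<and> (\<forall>\<alpha>\<in>C. \<alpha> ^ ((q - 1) div k) - z \<in> P)))"

end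

theory Submission
  imports Defs
begin

text \<open>
  Write \<open>r = p\<^sub>1\<close>. The residue field of \<open>P'\<close> is the extension of degree \<open>r\<close> of that of \<open>P\<close>. Splitting the
  Gauss sum of \<open>\<chi>'\<close> along the relative trace gives \<open>G(\<chi>') = E * G(\<chi>)\<close>, where \<open>E\<close> is the sum of
  \<open>\<chi>'\<close> over the elements of relative trace 1, and \<open>\<bar>E\<bar> = p ^ n\<close> with \<open>n = (f' - f) / 2\<close>. Three facts,
  valid for all conjugates \<open>E\<^sub>j\<close> (\<open>\<chi>'\<close> replaced by \<open>\<chi>' ^ j\<close>), force \<open>E = p ^ n\<close>: the absolute value;
  the divisibility by \<open>p ^ n\<close> at one prime over \<open>p\<close>, from the lower bound in Stickelberger's theorem and
  a computation of digit sums; and the congruence \<open>E \<equiv> 1 \<equiv> p ^ n\<close> modulo \<open>r\<close>, since Frobenius acts on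
  the elements of relative trace 1 with the single fixed point \<open>1 / r\<close>, on which \<open>\<chi>'\<close> is trivial because
  its order is prime to \<open>p - 1\<close>. Indeed \<open>\<Sum>\<^sub>j \<bar>E\<^sub>j - p ^ n\<bar> ^ (2 * m)\<close> is then an integer divisible by
  \<open>(r * p ^ n) ^ (2 * m)\<close> and at most a constant times \<open>(2 * p ^ n) ^ (2 * m)\<close>, so it vanishes for large \<open>m\<close>.

  Finite fields are modelled inside the complex numbers: modulo a prime ideal \<open>M\<close> over \<open>p\<close> of a cyclotomic
  ring, the set \<open>T\<close> of the roots of \<open>t ^ q = t\<close> is a system of representatives of a field with \<open>q\<close>
  elements, on which the multiplicative characters are the power maps.
\<close>

section \<open>Roots of unity\<close>

text \<open>The conjugates \<open>E j\<close> take the place of Galois theory: instead of moving the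
  prime \<open>M\<close> to the other primes over \<open>p\<close>, the exponent \<open>j\<close> of
  the character varies and \<open>M\<close> stays fixed. An even power sum over \<open>j\<close> is
  preferred to a norm because it is the trace of a polynomial value, and traces are integers as soon
  as Ramanujan sums are; a rational integer divisible by a power of \<open>p\<close> locally at
  \<open>M\<close> is divisible by it outright. The factor 2 in the bound is the triangle inequality
  for two numbers of absolute value \<open>p ^ n\<close>; it is beaten because the odd prime
  \<open>r\<close> is at least 3. The quotients \<open>(E j - p ^ n) / r\<close> must be the values
  at \<open>zeta k ^ j\<close> of a single integer polynomial, which is why the terms of
  \<open>E j\<close> whose character value is not a \<open>k\<close>-th root of unity have to
  cancel. The digit sums belong to the product of \<open>G(chi')\<close> with the conjugate of
  \<open>G(chi)\<close>, which is \<open>q * E\<close>, so that lower bounds for valuations are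
  enough. The given \<open>P'\<close> lies in a ring that need not contain \<open>zeta p\<close>,
  hence the passage to a prime \<open>M\<close> above it in a larger cyclotomic ring.\<close>

lemma zeta_eq_cis: "zeta n = cis (2 * pi / n)"
  by (simp add: zeta_def cis_conv_exp mult_ac)

lemma zeta_power: "zeta n ^ i = cis (2 * pi * real i / n)"
  by (simp add: zeta_eq_cis Complex.DeMoivre mult_ac)

lemma zeta_power_self [simp]: "n > 0 \<Longrightarrow> zeta n ^ n = 1"
  by (simp add: zeta_power cis_multiple_2pi)

lemma zeta_neq_0 [simp]: "zeta n \<noteq> 0"
  by (simp add: zeta_def)

lemma norm_zeta [simp]: "norm (zeta n) = 1"
  by (simp add: zeta_eq_cis)

lemma root_of_unity_zeta:
  assumes "n > 0" "z ^ n = 1"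
  obtains i where "i < n" "z = zeta n ^ i"
proof -
  have "z \<in> {z. z ^ n = 1}" using assms by simp
  with bij_betw_roots_unity[OF assms(1)] obtain i where "i < n" "z = cis (2 * pi * real i / n)"
    unfolding bij_betw_def by blast
  thus ?thesis using that by (simp add: zeta_power)
qed

lemma zeta_power_eq_1_iff:
  assumes "n > 0"
  shows "zeta n ^ i = 1 \<longleftrightarrow> n dvd i"
proof
  assume 1: "zeta n ^ i = 1"
  have "zeta n ^ (i mod n) = 1"
    using 1 by (metis assms mod_mult_div_eq mult.right_neutral power_add power_mult power_one zeta_power_self)
  moreover have "inj_on (\<lambda>j. cis (2 * pi * real j / n)) {..<n}"
    using bij_betw_roots_unity[OF assms] by (simp add: bij_betw_def)
  ultimately have "i mod n = 0"
    using assms unfolding inj_on_def zeta_power by (metis lessThan_iff mod_less_divisor mult_zero_right cis_zero div_0 of_nat_0)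
  thus "n dvd i" by auto
next
  assume "n dvd i"
  thus "zeta n ^ i = 1" using assms by (auto simp: power_mult)
qed

lemma power_mod_root:
  assumes "(z::complex) ^ n = 1"
  shows "z ^ (i mod n) = z ^ i"
  by (metis assms mod_mult_div_eq mult.right_neutral power_add power_mult power_one)

lemma power_cong_root:
  assumes "(z::complex) ^ n = 1" "[i = j] (mod n)"
  shows "z ^ i = z ^ j"
  using assms power_mod_root unfolding cong_def by metis

lemma zeta_mult_power: "m > 0 \<Longrightarrow> zeta (m * n) ^ m = zeta n"
  by (simp only: zeta_power) (simp add: zeta_eq_cis)

lemma norm_root_of_unity: "n > 0 \<Longrightarrow> (z::complex) ^ n = 1 \<Longrightarrow> norm z = 1"
  by (metis norm_one norm_power power_eq_1_iff norm_ge_zero less_irrefl)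

lemma cnj_root_of_unity:
  assumes "n > 0" "(z::complex) ^ n = 1"
  shows "cnj z = z ^ (n - 1)"
proof -
  have "z * cnj z = 1" using norm_root_of_unity[OF assms] by (simp add: complex_norm_square[symmetric])
  moreover have "z * z ^ (n - 1) = 1" using assms by (metis power_minus_mult mult.commute)
  ultimately show ?thesis by (metis mult_left_cancel mult_zero_left zero_neq_one)
qed

lemma sum_powers_roots_of_unity:
  assumes "n > 0"
  shows "(\<Sum>t | t ^ n = (1::complex). t ^ a) = (if n dvd a then of_nat n else 0)"
proof -
  have bij: "bij_betw (\<lambda>i. zeta n ^ i) {..<n} {z. z ^ n = 1}"
    using bij_betw_roots_unity[OF assms] by (simp add: zeta_power)
  have "(\<Sum>t | t ^ n = (1::complex). t ^ a) = (\<Sum>i<n. (zeta n ^ i) ^ a)"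
    by (rule sum.reindex_bij_betw[OF bij, symmetric])
  also have "\<dots> = (\<Sum>i<n. (zeta n ^ a) ^ i)"
    by (simp add: power_mult[symmetric] mult.commute)
  also have "\<dots> = (if n dvd a then of_nat n else 0)"
  proof (cases "n dvd a")
    case True
    thus ?thesis using zeta_power_eq_1_iff[OF assms, of a] by simp
  next
    case False
    hence "zeta n ^ a \<noteq> 1" using zeta_power_eq_1_iff[OF assms] by simp
    moreover have "(zeta n ^ a) ^ n = 1"
      by (metis assms power_mult power_mult_distrib mult.commute power_one zeta_power_self)
    ultimately show ?thesis using False by (simp add: geometric_sum)
  qed
  finally show ?thesis .
qed

text \<open>Group \<open>1, ..., n\<close> by \<open>gcd j n = d\<close>: the class of
  \<open>d > 1\<close> is a sum of the same kind for \<open>n div d\<close> and the root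
  \<open>z ^ d\<close>, hence an integer by induction, and the full sum is \<open>n\<close> or
  0.\<close>

lemma ramanujan_sum_int:
  assumes "n > 0" "(z::complex) ^ n = 1"
  shows "(\<Sum>j | j \<in> {1..n} \<and> coprime j n. z ^ j) \<in> \<int>"
  using assms
proof (induction n arbitrary: z rule: less_induct)
  case (less n)
  define c where "c d = (\<Sum>j | j \<in> {1..n} \<and> gcd j n = d. z ^ j)" for d
  have fin: "finite {d. d dvd n}" using less.prems(1) by simp
  have total: "(\<Sum>j\<in>{1..n}. z ^ j) \<in> \<int>"
  proof (cases "z = 1")
    case False
    have "(\<Sum>j\<in>{1..n}. z ^ j) = (\<Sum>j<n. z ^ Suc j)"
      by (rule sum.reindex_bij_witness[of _ Suc "\<lambda>j. j - 1"]) auto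
    also have "\<dots> = z * (\<Sum>j<n. z ^ j)" by (simp add: sum_distrib_left)
    also have "\<dots> = 0" using False less.prems(2) by (simp add: geometric_sum)
    finally show ?thesis by simp
  qed auto
  have "(\<Sum>d | d dvd n. c d) = (\<Sum>j\<in>{1..n}. z ^ j)"
    unfolding c_def by (rule sum.group) (use fin in auto)
  hence c1: "c 1 = (\<Sum>j\<in>{1..n}. z ^ j) - (\<Sum>d\<in>{d. d dvd n} - {1}. c d)"
    using fin by (simp add: sum_diff1)
  have "c d \<in> \<int>" if d: "d dvd n" "d \<noteq> 1" for d
  proof -
    obtain m where m: "n = d * m" using d(1) by blast
    have pos: "m > 0" "d > 0" using m less.prems(1) by auto
    have gcd_eq: "gcd (d * i) n = d * gcd i m" for i
      unfolding m by (rule gcd_mult_distrib_nat[symmetric])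
    have "{j. j \<in> {1..n} \<and> gcd j n = d} = (\<lambda>i. d * i) ` {i. i \<in> {1..m} \<and> coprime i m}"
    proof (intro equalityI subsetI)
      fix j assume j: "j \<in> {j. j \<in> {1..n} \<and> gcd j n = d}"
      hence "d = gcd j n" by simp
      hence "d dvd j" by (simp only: gcd_dvd1)
      then obtain i where i: "j = d * i" by blast
      have "d * gcd i m = d" using j unfolding i gcd_eq[symmetric] by blast
      hence "gcd i m = 1" using pos by simp
      hence "coprime i m" by (simp only: coprime_iff_gcd_eq_1)
      thus "j \<in> (\<lambda>i. d * i) ` {i. i \<in> {1..m} \<and> coprime i m}"
        using i j m pos by (intro image_eqI[of _ _ i]) (auto simp: Suc_le_eq)
    next
      fix j assume "j \<in> (\<lambda>i. d * i) ` {i. i \<in> {1..m} \<and> coprime i m}"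
      then obtain i where i: "j = d * i" "i \<in> {1..m}" "coprime i m" by blast
      have "gcd j n = d * gcd i m" unfolding i gcd_eq ..
      thus "j \<in> {j. j \<in> {1..n} \<and> gcd j n = d}"
        using i pos m by (auto simp: Suc_le_eq)
    qed
    hence "c d = (\<Sum>i | i \<in> {1..m} \<and> coprime i m. z ^ (d * i))"
      unfolding c_def using pos by (simp add: sum.reindex inj_on_def)
    also have "\<dots> = (\<Sum>i | i \<in> {1..m} \<and> coprime i m. (z ^ d) ^ i)"
      by (simp add: power_mult)
    also have "\<dots> \<in> \<int>"
    proof (rule less.IH)
      show "m < n" using m d pos by (cases d) auto
      show "(z ^ d) ^ m = 1" using less.prems m by (simp add: power_mult)
    qed (use pos in auto)
    finally show ?thesis .
  qed
  hence "c 1 \<in> \<int>" unfolding c1 by (intro Ints_diff total Ints_sum) auto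
  thus ?case unfolding c_def by (simp only: coprime_iff_gcd_eq_1)
qed

section \<open>Digit sums\<close>

text \<open>Only the lowest \<open>f\<close> digits are counted; for \<open>a < p ^ f\<close> this
  is the full base \<open>p\<close> digit sum.\<close>

definition digit_sum :: "nat \<Rightarrow> nat \<Rightarrow> nat \<Rightarrow> nat" where
  "digit_sum p f a = (\<Sum>i<f. (a div p ^ i) mod p)"

lemma digit_sum_mult:
  assumes "p > 1" "p * a < p ^ f"
  shows "digit_sum p f (p * a) = digit_sum p f a"
proof (cases f)
  case (Suc g)
  have "a < p ^ g" using assms Suc by simp
  hence 0: "a div p ^ g = 0" by simp
  have "digit_sum p f (p * a) = (\<Sum>i<g. (p * a div p ^ Suc i) mod p)"
    unfolding digit_sum_def Suc by (subst sum.lessThan_Suc_shift) simp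
  also have "\<dots> = (\<Sum>i<g. (a div p ^ i) mod p)"
    using assms(1) by (intro sum.cong) auto
  also have "\<dots> = digit_sum p f a"
    unfolding digit_sum_def Suc using 0 by simp
  finally show ?thesis .
qed (simp add: digit_sum_def)

text \<open>The last digit of \<open>a\<close> is not \<open>p - 1\<close>, so there is no
  carry.\<close>

lemma digit_sum_Suc:
  assumes "p > 1" "f > 0" "\<not> p dvd Suc a"
  shows "digit_sum p f (Suc a) = Suc (digit_sum p f a)"
proof -
  obtain g where f: "f = Suc g" using assms(2) by (cases f) auto
  have nz: "Suc a mod p \<noteq> 0" using assms(3) by (simp add: dvd_eq_mod_eq_0)
  hence m: "Suc a mod p = Suc (a mod p)" by (metis mod_Suc)
  have d: "Suc a div p = a div p" using nz by (metis div_Suc)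
  have "Suc a div p ^ Suc i = a div p ^ Suc i" for i
    by (simp only: power_Suc div_mult2_eq d)
  thus ?thesis
    unfolding digit_sum_def f by (subst (1 2) sum.lessThan_Suc_shift) (simp add: m)
qed

lemma digit_sum_0 [simp]: "digit_sum p f 0 = 0"
  by (simp add: digit_sum_def)

text \<open>Since \<open>p ^ f\<close> is 1 modulo \<open>p ^ f - 1\<close>, multiplication by
  \<open>p ^ i\<close> rotates the \<open>f\<close> digits: the upper part
  \<open>h = a div p ^ (f - i)\<close> moves to the bottom.\<close>

lemma mult_power_mod_pred:
  fixes p a :: nat
  assumes "p > 1" "i \<le> f" "a < p ^ f - 1"
  shows "(p ^ i * a) mod (p ^ f - 1) + (p ^ f - 1) * (a div p ^ (f - i)) = p ^ i * a"
proof -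
  define h where "h = a div p ^ (f - i)"
  define l where "l = a mod p ^ (f - i)"
  have "h * p ^ (f - i) + l = a" unfolding h_def l_def by (rule div_mult_mod_eq)
  note a = this[symmetric]
  have pf: "p ^ i * p ^ (f - i) = p ^ f" using assms(2) by (simp add: power_add[symmetric])
  have p0: "p ^ j > 0" for j using assms by simp
  have "p ^ i * a = h * (p ^ i * p ^ (f - i)) + p ^ i * l" by (simp add: a algebra_simps)
  also have "\<dots> = h * p ^ f + p ^ i * l" by (simp add: pf)
  also have "\<dots> = (p ^ f - 1) * h + (h + p ^ i * l)" using p0[of f] by (cases "p ^ f") (auto simp: algebra_simps)
  finally have eq: "p ^ i * a = (p ^ f - 1) * h + (h + p ^ i * l)" .
  have "h < p ^ i" unfolding h_def using assms pf p0[of f]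
    by (subst div_less_iff_less_mult) auto
  moreover have l: "l < p ^ (f - i)" unfolding l_def by (rule mod_less_divisor[OF p0])
  have "h + p ^ i * l < p ^ f - 1"
  proof -
    have "l + 1 \<le> p ^ (f - i)" using l by simp
    hence 1: "p ^ i * l + p ^ i \<le> p ^ f"
      using pf by (metis add_mult_distrib2 mult_le_mono2 nat_mult_1_right)
    \<comment> \<open>Equality would force all \<open>f\<close> digits to be \<open>p - 1\<close>,
      that is \<open>a = p ^ f - 1\<close>.\<close>
    have "h + p ^ i * l \<noteq> p ^ f - 1"
    proof
      assume eq2: "h + p ^ i * l = p ^ f - 1"
      have h: "h = p ^ i - 1" using eq2 1 \<open>h < p ^ i\<close> p0[of f] by linarith
      have "p ^ i * l + p ^ i = p ^ f"
        using eq2 p0[of f] p0[of i] unfolding h by linarith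
      hence "p ^ i * (l + 1) = p ^ i * p ^ (f - i)" by (simp add: pf)
      hence "l + 1 = p ^ (f - i)" using p0[of i] by (metis mult_left_cancel less_irrefl)
      hence "a + 1 = p ^ i * p ^ (f - i)"
        using a h p0[of i] by (cases "p ^ i") (auto simp: algebra_simps)
      thus False using assms pf by simp
    qed
    thus ?thesis using 1 \<open>h < p ^ i\<close> by linarith
  qed
  hence "(p ^ i * a) mod (p ^ f - 1) = h + p ^ i * l"
    unfolding eq by simp
  thus ?thesis using eq h_def by simp
qed

text \<open>The rotations bring each digit to each position once, so the residues add up to the
  digit sum times \<open>(p ^ f - 1) / (p - 1)\<close>. As in Legendre's formula, both sides are
  expressed through the sum \<open>D\<close> of the quotients of \<open>a\<close>.\<close>

lemma digit_sum_eq_sum_residues: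
  assumes "p > 1" "a < p ^ f - 1"
  shows "(p ^ f - 1) * digit_sum p f a = (p - 1) * (\<Sum>i<f. (p ^ i * a) mod (p ^ f - 1))"
proof -
  define Q where "Q = int (p ^ f - 1)"
  define D where "D = (\<Sum>i<f. int (a div p ^ Suc i))"
  have Q: "Q = int p ^ f - 1" unfolding Q_def using assms(1)
    by (simp add: of_nat_diff)
  have top: "a div p ^ f = 0" using assms by simp
  have ds: "int (digit_sum p f a) = int a - (int p - 1) * D"
  proof -
    have "int (digit_sum p f a) = (\<Sum>i<f. int (a div p ^ i) - int p * int (a div p ^ Suc i))"
      unfolding digit_sum_def of_nat_sum
    proof (rule sum.cong)
      fix i
      have "a div p ^ Suc i = a div p ^ i div p" by (metis div_mult2_eq power_Suc2)
      thus "int (a div p ^ i mod p) = int (a div p ^ i) - int p * int (a div p ^ Suc i)"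
        by (metis add_diff_cancel_right' int_ops(7) mod_mult_div_eq of_nat_add add.commute)
    qed simp
    also have "\<dots> = (\<Sum>i<f. int (a div p ^ i)) - int p * D"
      by (simp add: sum_subtractf sum_distrib_left D_def)
    also have "(\<Sum>i<f. int (a div p ^ i)) = int a + D"
    proof -
      have "(\<Sum>i<Suc f. int (a div p ^ i)) = int a + D"
        by (subst sum.lessThan_Suc_shift) (simp add: D_def)
      thus ?thesis using top by simp
    qed
    finally show ?thesis by (simp add: algebra_simps)
  qed
  have "int (\<Sum>i<f. (p ^ i * a) mod (p ^ f - 1)) = (\<Sum>i<f. int p ^ i * int a - Q * int (a div p ^ (f - i)))"
    unfolding of_nat_sum
  proof (rule sum.cong)
    fix i assume "i \<in> {..<f}"
    hence "(p ^ i * a) mod (p ^ f - 1) + (p ^ f - 1) * (a div p ^ (f - i)) = p ^ i * a"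
      by (intro mult_power_mod_pred assms) auto
    hence "int ((p ^ i * a) mod (p ^ f - 1)) + Q * int (a div p ^ (f - i)) = int p ^ i * int a"
      unfolding Q_def by (metis of_nat_add of_nat_mult of_nat_power)
    thus "int ((p ^ i * a) mod (p ^ f - 1)) = int p ^ i * int a - Q * int (a div p ^ (f - i))" by simp
  qed simp
  also have "\<dots> = (\<Sum>i<f. int p ^ i) * int a - Q * (\<Sum>i<f. int (a div p ^ (f - i)))"
    by (simp add: sum_subtractf sum_distrib_left sum_distrib_right)
  also have "(\<Sum>i<f. int (a div p ^ (f - i))) = D"
    unfolding D_def by (rule sum.reindex_bij_witness[of _ "\<lambda>i. f - 1 - i" "\<lambda>i. f - 1 - i"])
      (auto simp: Suc_diff_Suc)
  finally have S: "int (\<Sum>i<f. (p ^ i * a) mod (p ^ f - 1)) = (\<Sum>i<f. int p ^ i) * int a - Q * D" .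
  have geo: "(int p - 1) * (\<Sum>i<f. int p ^ i) = Q"
    using power_diff_1_eq[of "int p" f] by (simp add: Q)
  have "int ((p - 1) * (\<Sum>i<f. (p ^ i * a) mod (p ^ f - 1)))
      = (int p - 1) * ((\<Sum>i<f. int p ^ i) * int a - Q * D)"
    using assms(1) S by (simp add: of_nat_diff)
  also have "\<dots> = ((int p - 1) * (\<Sum>i<f. int p ^ i)) * int a - (int p - 1) * Q * D"
    by (simp add: algebra_simps)
  also have "\<dots> = Q * int (digit_sum p f a)" unfolding geo ds by (simp add: algebra_simps)
  also have "\<dots> = int ((p ^ f - 1) * digit_sum p f a)" by (simp add: Q_def)
  finally show ?thesis by linarith
qed

text \<open>For \<open>a = w * b\<close> and modulus \<open>k * w\<close> a factor \<open>w\<close>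
  comes out of every residue. Exponents of characters of order dividing \<open>k\<close> have this
  shape.\<close>

lemma digit_sum_eq_sum_residues_multiple:
  assumes "p > 1" "k > 0" "p ^ f - 1 = k * w" "b < k" "p ^ f > 1"
  shows "k * digit_sum p f (w * b) = (p - 1) * (\<Sum>i<f. (p ^ i * b) mod k)"
proof -
  have w: "w > 0" using assms by (cases w) auto
  have "w * b < p ^ f - 1" using assms w by simp
  from digit_sum_eq_sum_residues[OF assms(1) this]
  have "k * w * digit_sum p f (w * b) = (p - 1) * (\<Sum>i<f. (p ^ i * (w * b)) mod (k * w))"
    unfolding assms(3) .
  also have "(\<Sum>i<f. (p ^ i * (w * b)) mod (k * w)) = w * (\<Sum>i<f. (p ^ i * b) mod k)"
    unfolding sum_distrib_left by (intro sum.cong refl) (simp only: mult_mod_right mult_ac)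
  finally have "w * (k * digit_sum p f (w * b)) = w * ((p - 1) * (\<Sum>i<f. (p ^ i * b) mod k))"
    by (simp only: mult_ac)
  thus ?thesis using w by (metis mult_left_cancel less_irrefl)
qed

text \<open>The residues of \<open>p ^ (i + f * m) * j\<close> modulo \<open>k * r\<close> for \<open>m < r\<close> fill a residue class modulo \<open>k\<close>.\<close>

lemma sum_residues_tower:
  assumes "k > 0" "r > 0" "ord k p = f" "ord (k * r) p = r * f" "coprime j (k * r)" "coprime p (k * r)"
  shows "(\<Sum>i<r * f. (p ^ i * j) mod (k * r)) = r * (\<Sum>i<f. (p ^ i * j) mod k) + f * (k * (\<Sum>c<r. c))"
proof -
  have "coprime k p" using assms(6) by (simp add: coprime_commute)
  hence f0: "f > 0" using assms(3) ord_gt_0_iff[of k p] by simp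
  have q1: "[(p ^ f) = 1] (mod k)" using assms(3) ord_divides[of p f k] by simp
  have inner: "(\<Sum>m<r. (p ^ (m * f + i) * j) mod (k * r)) = r * ((p ^ i * j) mod k) + k * (\<Sum>c<r. c)" for i
  proof -
    define y where "y = p ^ i * j"
    define F where "F m = (p ^ (m * f) * y) mod (k * r)" for m
    define S where "S = (\<lambda>c. y mod k + k * c) ` {..<r}"
    have y: "coprime y (k * r)" unfolding y_def using assms by auto
    have inj: "inj_on F {..<r}"
    proof (rule linorder_inj_onI)
      fix a b assume ab: "a < b" "a \<in> {..<r}" "b \<in> {..<r}"
      show "F a \<noteq> F b"
      proof
        assume "F a = F b"
        hence "[p ^ (a * f) * y = p ^ (b * f) * y] (mod (k * r))" by (simp add: F_def cong_def)
        hence "[p ^ (a * f) = p ^ (b * f)] (mod (k * r))"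
          using y by (simp add: cong_mult_rcancel_nat)
        hence "[p ^ (a * f) * 1 = p ^ (a * f) * p ^ ((b - a) * f)] (mod (k * r))"
          using ab by (simp add: power_add[symmetric] add_mult_distrib[symmetric])
        hence "[1 = p ^ ((b - a) * f)] (mod (k * r))"
          using assms(6) by (subst (asm) cong_mult_lcancel_nat) auto
        hence "r * f dvd (b - a) * f"
          using assms(4) ord_divides[of p "(b - a) * f" "k * r"] cong_sym[of 1 "p ^ ((b - a) * f)" "k * r"] by simp
        hence "r dvd b - a" using f0 by simp
        thus False using ab by (auto dest: dvd_imp_le)
      qed
    qed auto
    have sub: "F ` {..<r} \<subseteq> S"
    proof safe
      fix m
      have "F m mod k = (p ^ (m * f) * y) mod k" by (simp add: F_def mod_mult2_eq)
      also have "[p ^ (m * f) * y = 1 ^ m * y] (mod k)"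
        unfolding mult.commute[of m f] power_mult by (intro cong_mult cong_pow q1) auto
      hence "(p ^ (m * f) * y) mod k = y mod k" by (simp add: cong_def)
      finally have 1: "F m = y mod k + k * (F m div k)" by (metis mod_mult_div_eq)
      have "F m < k * r" unfolding F_def using assms by simp
      hence "F m div k < r" using assms(1) by (simp add: div_less_iff_less_mult mult.commute)
      thus "F m \<in> S" unfolding S_def using 1 by blast
    qed
    have injS: "inj_on (\<lambda>c. y mod k + k * c) {..<r}" using assms(1) by (auto simp: inj_on_def)
    have "card S = r" unfolding S_def using injS by (simp add: card_image)
    hence FS: "F ` {..<r} = S"
      using sub inj by (intro card_subset_eq) (auto simp: S_def card_image)
    have "(\<Sum>m<r. (p ^ (m * f + i) * j) mod (k * r)) = (\<Sum>m<r. F m)"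
      by (simp add: F_def y_def power_add mult_ac)
    also have "\<dots> = sum id (F ` {..<r})" using inj by (simp add: sum.reindex)
    also have "\<dots> = (\<Sum>c<r. y mod k + k * c)" unfolding FS S_def using injS by (simp add: sum.reindex)
    also have "\<dots> = r * (y mod k) + k * (\<Sum>c<r. c)"
      by (simp add: sum.distrib sum_distrib_left)
    finally show ?thesis by (simp add: y_def)
  qed
  have "(\<Sum>i<r * f. (p ^ i * j) mod (k * r)) = (\<Sum>m<r. \<Sum>i\<in>{m*f..<m*f+f}. (p ^ i * j) mod (k * r))"
    by (rule sum.nat_group[symmetric])
  also have "\<dots> = (\<Sum>m<r. \<Sum>i<f. (p ^ (m * f + i) * j) mod (k * r))"
  proof (rule sum.cong)
    fix m
    show "(\<Sum>i\<in>{m*f..<m*f+f}. (p ^ i * j) mod (k * r)) = (\<Sum>i<f. (p ^ (m * f + i) * j) mod (k * r))"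
      by (rule sum.reindex_bij_witness[of _ "\<lambda>i. m * f + i" "\<lambda>i. i - m * f"]) auto
  qed simp
  also have "\<dots> = (\<Sum>i<f. \<Sum>m<r. (p ^ (m * f + i) * j) mod (k * r))" by (rule sum.swap)
  also have "\<dots> = (\<Sum>i<f. r * ((p ^ i * j) mod k) + k * (\<Sum>c<r. c))" by (simp only: inner)
  also have "\<dots> = r * (\<Sum>i<f. (p ^ i * j) mod k) + f * (k * (\<Sum>c<r. c))"
    by (simp add: sum.distrib sum_distrib_left)
  finally show ?thesis .
qed

section \<open>Actions of a cyclic group of prime order\<close>

text \<open>As \<open>r\<close> is prime, an orbit without fixed points has exactly \<open>r\<close>
  elements; removing it leaves a smaller stable set.\<close>

lemma prime_dvd_card_no_fixpoints:
  fixes g :: "'a \<Rightarrow> 'a" and r :: nat and S :: "'a set"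
  assumes "finite S" "prime r" "\<And>x. x \<in> S \<Longrightarrow> g x \<in> S" "\<And>x. x \<in> S \<Longrightarrow> (g ^^ r) x = x"
    "\<And>x. x \<in> S \<Longrightarrow> g x \<noteq> x"
  shows "r dvd card S"
  using assms(1,3,4,5)
proof (induction S rule: finite_psubset_induct)
  case (psubset S)
  show ?case
  proof (cases "S = {}")
    case False
    then obtain x where x: "x \<in> S" by blast
    have closed: "(g ^^ i) x \<in> S" for i by (induction i) (use x psubset.prems in auto)
    define O' where "O' = (\<lambda>i. (g ^^ i) x) ` {..<r}"
    have r0: "r > 1" using assms(2) prime_gt_1_nat by blast
    have period: "(g ^^ (i mod r)) x = (g ^^ i) x" for i
      using funpow_mod_eq[where f = g and n = r and x = x and m = i] psubset.prems(2)[OF x] by simp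
    have inj: "inj_on (\<lambda>i. (g ^^ i) x) {..<r}"
    proof (rule linorder_inj_onI)
      fix a b assume ab: "a < b" "a \<in> {..<r}" "b \<in> {..<r}"
      show "(g ^^ a) x \<noteq> (g ^^ b) x"
      proof
        assume eq: "(g ^^ a) x = (g ^^ b) x"
        have "(g ^^ (r - a)) ((g ^^ a) x) = (g ^^ (r - a)) ((g ^^ b) x)" using eq by simp
        hence "(g ^^ r) x = (g ^^ (r - a + b)) x"
          using ab by (metis add.commute add_diff_cancel_left' comp_apply funpow_add lessThan_iff less_imp_add_positive)
        moreover have "r - a + b = r + (b - a)" using ab by auto
        ultimately have 1: "(g ^^ (b - a)) x = x"
          using psubset.prems(2)[OF x] by (metis funpow_add comp_apply add.commute period mod_add_self1 mod_add_self2)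
        \<comment> \<open>With \<open>b - a\<close> invertible modulo \<open>r\<close>, some iterate
          of \<open>g ^^ (b - a)\<close> acts on \<open>x\<close> as \<open>g\<close> itself, so
          \<open>x\<close> would be fixed.\<close>
        have "coprime (b - a) r"
        proof -
          have "\<not> r dvd b - a" using ab by (auto dest: dvd_imp_le)
          thus ?thesis using assms(2) by (metis prime_imp_coprime coprime_commute)
        qed
        then obtain c where c: "[(b - a) * c = 1] (mod r)" using cong_solve_coprime_nat by auto
        have "((g ^^ (b - a)) ^^ c) x = x" by (induction c) (use 1 in auto)
        hence "(g ^^ ((b - a) * c)) x = x" by (simp add: funpow_mult)
        hence "(g ^^ 1) x = x" using c period unfolding cong_def by metis
        thus False using psubset.prems(3)[OF x] by simp
      qed
    qed auto
    have cardO: "card O' = r" unfolding O'_def using inj by (simp add: card_image)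
    have sub: "O' \<subseteq> S" unfolding O'_def using closed by auto
    have "r dvd card (S - O')"
    proof (rule psubset.IH)
      show "S - O' \<subset> S" using sub cardO r0 by (cases "O' = {}") auto
      fix y assume y: "y \<in> S - O'"
      show "g y \<in> S - O'"
      proof
        show "g y \<in> S" using y psubset.prems by auto
        \<comment> \<open>On \<open>S\<close> the map \<open>g\<close> is inverted by
          \<open>g ^^ (r - 1)\<close>, so nothing outside the orbit is sent into it.\<close>
        show "g y \<notin> O'"
        proof
          assume "g y \<in> O'"
          then obtain i where i: "g y = (g ^^ i) x" unfolding O'_def by auto
          have "(g ^^ r) y = (g ^^ (r - 1)) (g y)"
            using r0 by (metis Suc_diff_1 Suc_lessD funpow_simps_right(2) comp_apply zero_less_Suc One_nat_def)
          hence "y = (g ^^ (r - 1 + i)) x"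
            using i psubset.prems(2)[of y] y by (simp add: funpow_add)
          hence "y = (g ^^ ((r - 1 + i) mod r)) x" using period by simp
          moreover have "(r - 1 + i) mod r \<in> {..<r}" using r0 by simp
          ultimately have "y \<in> O'" unfolding O'_def by blast
          thus False using y by simp
        qed
      qed
    qed (use psubset.prems in auto)
    moreover have "card S = card (S - O') + r"
      using cardO sub psubset.hyps by (metis card_Diff_subset card_mono finite_subset le_add_diff_inverse2)
    ultimately show ?thesis by simp
  qed simp
qed

section \<open>Finite fields as roots of unity modulo a prime ideal\<close>

lemma prod_diff_roots_of_unity:
  assumes "n > 0"
  shows "(\<Prod>t | t ^ n = (1::complex). x - t) = x ^ n - 1"
proof -
  define A where "A = {t::complex. t ^ n = 1}"
  have fin: "finite A" and card: "card A = n"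
    using assms finite_roots_unity[of n] card_roots_unity_eq[of n] by (auto simp: A_def)
  define P where "P = (\<Prod>t\<in>A. [:-t, 1:])"
  define Q where "Q = Polynomial.monom (1::complex) n - 1"
  have degP: "Polynomial.degree P = n"
    unfolding P_def using card by (subst degree_prod_eq_sum_degree) auto
  have leadP: "Polynomial.lead_coeff P = 1"
    unfolding P_def by (subst lead_coeff_prod) auto
  have "P = Q"
  proof (rule poly_eqI_degree_lead_coeff[where A = A and n = n])
    show "poly.coeff P n = poly.coeff Q n"
      using leadP degP assms by (simp add: Q_def)
    show "Polynomial.degree Q \<le> n"
      unfolding Q_def by (intro degree_diff_le) (auto simp: Polynomial.degree_monom_le)
    fix z assume z: "z \<in> A"
    have "poly P z = 0" unfolding P_def poly_prod using z fin by (auto intro: bexI[of _ z])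
    thus "poly P z = poly Q z" using z by (simp add: Q_def A_def poly_monom)
  qed (use card degP in auto)
  hence "poly P x = poly Q x" by simp
  thus ?thesis by (simp add: P_def Q_def poly_prod poly_monom A_def)
qed

text \<open>\<open>R / M\<close> is a domain of characteristic \<open>p\<close>. Having
  \<open>zeta p\<close> in \<open>R\<close> puts the Gauss sums into \<open>R\<close>, where they
  can be reduced modulo \<open>M\<close>.\<close>

locale residue_model =
  fixes R M :: "complex set" and p :: nat
  assumes one_R [simp]: "1 \<in> R"
    and add_R [simp]: "x \<in> R \<Longrightarrow> y \<in> R \<Longrightarrow> x + y \<in> R"
    and uminus_R [simp]: "x \<in> R \<Longrightarrow> - x \<in> R"
    and mult_R [simp]: "x \<in> R \<Longrightarrow> y \<in> R \<Longrightarrow> x * y \<in> R"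
    and M_subset: "M \<subseteq> R"
    and zero_M [simp]: "0 \<in> M"
    and add_M [simp]: "x \<in> M \<Longrightarrow> y \<in> M \<Longrightarrow> x + y \<in> M"
    and mult_M [simp]: "x \<in> R \<Longrightarrow> y \<in> M \<Longrightarrow> x * y \<in> M"
    and one_notin_M [simp]: "1 \<notin> M"
    and prime_M: "x \<in> R \<Longrightarrow> y \<in> R \<Longrightarrow> x * y \<in> M \<Longrightarrow> x \<in> M \<or> y \<in> M"
    and prime_p: "prime p"
    and p_in_M: "of_nat p \<in> M"
    and zeta_p_R [simp]: "zeta p \<in> R"
begin

lemma p_gt_1: "p > 1" and p_pos [simp]: "p > 0"
  using prime_p prime_gt_1_nat prime_gt_0_nat by auto

lemma p_nonzero [simp]: "p \<noteq> 0"
  using p_pos by blast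

lemma M_imp_R [simp]: "x \<in> M \<Longrightarrow> x \<in> R"
  using M_subset by blast

lemma diff_R [simp]: "x \<in> R \<Longrightarrow> y \<in> R \<Longrightarrow> x - y \<in> R"
  using add_R[of x "- y"] by simp

lemma power_R [simp]: "x \<in> R \<Longrightarrow> x ^ n \<in> R"
  by (induction n) auto

lemma of_nat_R [simp]: "of_nat n \<in> R"
  by (induction n) auto

lemma of_int_R [simp]: "of_int n \<in> R"
  by (cases n) (auto simp del: of_nat_Suc)

lemma sum_R [simp]: "(\<And>x. x \<in> A \<Longrightarrow> f x \<in> R) \<Longrightarrow> sum f A \<in> R"
  by (induction A rule: infinite_finite_induct) auto

lemma prod_R [simp]: "(\<And>x. x \<in> A \<Longrightarrow> f x \<in> R) \<Longrightarrow> prod f A \<in> R"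
  by (induction A rule: infinite_finite_induct) auto

lemma mult_M_right [simp]: "x \<in> M \<Longrightarrow> y \<in> R \<Longrightarrow> x * y \<in> M"
  using mult_M[of y x] by (simp add: mult.commute)

lemma uminus_M [simp]: "x \<in> M \<Longrightarrow> - x \<in> M"
  using mult_M[of "-1" x] by simp

lemma diff_M [simp]: "x \<in> M \<Longrightarrow> y \<in> M \<Longrightarrow> x - y \<in> M"
  using add_M[of x "- y"] uminus_M[of y] by simp

lemma sum_M [simp]: "(\<And>x. x \<in> A \<Longrightarrow> f x \<in> M) \<Longrightarrow> sum f A \<in> M"
  by (induction A rule: infinite_finite_induct) auto

lemma prod_in_M_D: "finite A \<Longrightarrow> (\<And>x. x \<in> A \<Longrightarrow> f x \<in> R) \<Longrightarrow> prod f A \<in> M \<Longrightarrow> \<exists>x\<in>A. f x \<in> M"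
proof (induction A rule: finite_induct)
  case (insert x A)
  from insert have "f x \<in> M \<or> prod f A \<in> M" by (intro prime_M) auto
  with insert show ?case by auto
qed simp

lemma mult_notin_M: "x \<in> R - M \<Longrightarrow> y \<in> R - M \<Longrightarrow> x * y \<in> R - M"
  using prime_M by auto

lemma of_nat_in_M_iff: "of_nat a \<in> M \<longleftrightarrow> p dvd a"
proof
  assume a: "of_nat a \<in> M"
  show "p dvd a"
  proof (rule ccontr)
    assume "\<not> p dvd a"
    hence "coprime p a" by (rule prime_imp_coprime[OF prime_p])
    hence "coprime a p" by (simp only: coprime_commute)
    then obtain b where "[a * b = 1] (mod p)" using cong_solve_coprime_nat by auto
    hence "[int (a * b) = int 1] (mod int p)" by (simp only: cong_int_iff)
    hence "int p dvd int (a * b) - int 1" by (simp only: cong_iff_dvd_diff)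
    then obtain c where c: "int (a * b) - int 1 = int p * c" by blast
    have "of_int (int (a * b) - int 1) = (of_int (int p * c) :: complex)" unfolding c ..
    hence "1 = of_nat a * of_nat b - of_nat p * (of_int c :: complex)"
      by (simp add: algebra_simps)
    also have "\<dots> \<in> M" using a p_in_M by (intro diff_M mult_M_right) auto
    finally show False by simp
  qed
next
  assume "p dvd a"
  then obtain b where "a = p * b" by blast
  thus "of_nat a \<in> M" using p_in_M by auto
qed

lemma of_int_in_M_iff: "of_int a \<in> M \<longleftrightarrow> int p dvd a"
proof (cases a)
  case (nonneg n)
  thus ?thesis by (simp add: of_nat_in_M_iff)
next
  case (neg n)
  have "of_int a \<in> M \<longleftrightarrow> of_nat (Suc n) \<in> M"
    unfolding neg using uminus_M[of "of_nat (Suc n)"] uminus_M[of "- of_nat (Suc n)"]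
    by (auto simp del: of_nat_Suc)
  also have "\<dots> \<longleftrightarrow> int p dvd a"
    unfolding of_nat_in_M_iff neg by (metis dvd_minus_iff int_dvd_int_iff)
  finally show ?thesis .
qed

text \<open>Membership in \<open>R\<close> is part of the relation, so that a chain of congruences
  carries its own side conditions.\<close>

definition eqm :: "complex \<Rightarrow> complex \<Rightarrow> bool" (infix "\<doteq>" 50) where
  "x \<doteq> y \<longleftrightarrow> x \<in> R \<and> y \<in> R \<and> x - y \<in> M"

lemma eqm_refl [simp]: "x \<in> R \<Longrightarrow> x \<doteq> x"
  by (simp add: eqm_def)

lemma eqm_sym: "x \<doteq> y \<Longrightarrow> y \<doteq> x"
  unfolding eqm_def using uminus_M[of "x - y"] by auto

lemma eqm_trans [trans]: "x \<doteq> y \<Longrightarrow> y \<doteq> z \<Longrightarrow> x \<doteq> z"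
  unfolding eqm_def using add_M[of "x - y" "y - z"] by auto

lemma eqm_add: "x \<doteq> y \<Longrightarrow> x' \<doteq> y' \<Longrightarrow> x + x' \<doteq> y + y'"
  unfolding eqm_def using add_M[of "x - y" "x' - y'"] by (auto simp: algebra_simps)

lemma eqm_uminus: "x \<doteq> y \<Longrightarrow> - x \<doteq> - y"
  unfolding eqm_def using uminus_M[of "x - y"] by auto

lemma eqm_diff: "x \<doteq> y \<Longrightarrow> x' \<doteq> y' \<Longrightarrow> x - x' \<doteq> y - y'"
  using eqm_add[of x y "- x'" "- y'"] eqm_uminus by simp

lemma eqm_mult: "x \<doteq> y \<Longrightarrow> x' \<doteq> y' \<Longrightarrow> x * x' \<doteq> y * y'"
proof -
  assume *: "x \<doteq> y" "x' \<doteq> y'"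
  have "x * x' - y * y' = (x - y) * x' + y * (x' - y')" by (simp add: algebra_simps)
  also have "\<dots> \<in> M" using * unfolding eqm_def by (intro add_M mult_M mult_M_right) auto
  finally show ?thesis using * unfolding eqm_def by auto
qed

lemma eqm_power: "x \<doteq> y \<Longrightarrow> x ^ n \<doteq> y ^ n"
  by (induction n) (auto intro: eqm_mult)

lemma eqm_sum: "(\<And>x. x \<in> A \<Longrightarrow> f x \<doteq> g x) \<Longrightarrow> sum f A \<doteq> sum g A"
  by (induction A rule: infinite_finite_induct) (auto intro: eqm_add)

lemma eqm_M_iff: "x \<doteq> y \<Longrightarrow> x \<in> M \<longleftrightarrow> y \<in> M"
  unfolding eqm_def using add_M[of "x - y" y] diff_M[of x "x - y"] by auto

lemma eqm_0_iff: "x \<doteq> 0 \<longleftrightarrow> x \<in> M"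
  unfolding eqm_def by auto

lemma eqm_R: "x \<doteq> y \<Longrightarrow> x \<in> R" "x \<doteq> y \<Longrightarrow> y \<in> R"
  by (auto simp: eqm_def)

lemma eqm_of_nat: "[a = b] (mod p) \<Longrightarrow> of_nat a \<doteq> of_nat b"
proof -
  assume "[a = b] (mod p)"
  hence "int p dvd int a - int b" by (metis cong_iff_dvd_diff cong_int_iff)
  hence "of_int (int a - int b) \<in> M" by (simp only: of_int_in_M_iff)
  thus ?thesis by (simp add: eqm_def)
qed

lemma eqm_of_nat_iff: "of_nat a \<doteq> of_nat b \<longleftrightarrow> [a = b] (mod p)"
proof
  assume "of_nat a \<doteq> of_nat b"
  hence "of_int (int a - int b) \<in> M" by (simp add: eqm_def)
  thus "[a = b] (mod p)" by (simp only: of_int_in_M_iff cong_iff_dvd_diff flip: cong_int_iff)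
qed (rule eqm_of_nat)

lemma frobenius_add:
  assumes "x \<in> R" "y \<in> R"
  shows "(x + y) ^ p \<doteq> x ^ p + y ^ p"
proof -
  have split: "{..p} = insert 0 (insert p {1..p - 1})" using p_gt_1 by auto
  have "(x + y) ^ p = (\<Sum>k\<le>p. of_nat (p choose k) * x ^ k * y ^ (p - k))"
    by (rule binomial_ring)
  also have "\<dots> = y ^ p + (x ^ p + (\<Sum>k\<in>{1..p - 1}. of_nat (p choose k) * x ^ k * y ^ (p - k)))"
    unfolding split using p_gt_1 by (subst sum.insert; simp)+
  finally have "(x + y) ^ p - (x ^ p + y ^ p) = (\<Sum>k\<in>{1..p - 1}. of_nat (p choose k) * x ^ k * y ^ (p - k))"
    by simp
  also have "\<dots> \<in> M"
  proof (rule sum_M)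
    fix k assume "k \<in> {1..p - 1}"
    hence "p dvd p choose k" using prime_p by (intro dvd_choose_prime) auto
    hence "of_nat (p choose k) \<in> M" by (simp add: of_nat_in_M_iff)
    thus "of_nat (p choose k) * x ^ k * y ^ (p - k) \<in> M" using assms by auto
  qed
  finally show ?thesis using assms by (auto simp: eqm_def)
qed

lemma frobenius_power_add:
  assumes "x \<in> R" "y \<in> R"
  shows "(x + y) ^ (p ^ i) \<doteq> x ^ (p ^ i) + y ^ (p ^ i)"
proof (induction i)
  case (Suc i)
  have "(x + y) ^ (p ^ Suc i) = ((x + y) ^ (p ^ i)) ^ p"
    by (simp add: power_mult[symmetric] mult.commute)
  also have "\<dots> \<doteq> (x ^ (p ^ i) + y ^ (p ^ i)) ^ p" by (rule eqm_power[OF Suc])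
  also have "\<dots> \<doteq> (x ^ (p ^ i)) ^ p + (y ^ (p ^ i)) ^ p" using assms by (intro frobenius_add) auto
  also have "\<dots> = x ^ (p ^ Suc i) + y ^ (p ^ Suc i)"
    by (simp add: power_mult[symmetric] mult.commute)
  finally show ?case .
qed (use assms in auto)

lemma frobenius_power_sum:
  assumes "\<And>j. j \<in> A \<Longrightarrow> g j \<in> R"
  shows "(\<Sum>j\<in>A. g j) ^ (p ^ i) \<doteq> (\<Sum>j\<in>A. g j ^ (p ^ i))"
  using assms
proof (induction A rule: infinite_finite_induct)
  case (insert j A)
  have "(g j + (\<Sum>j\<in>A. g j)) ^ (p ^ i) \<doteq> g j ^ (p ^ i) + (\<Sum>j\<in>A. g j) ^ (p ^ i)"
    using insert by (intro frobenius_power_add sum_R) auto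
  also have "\<dots> \<doteq> g j ^ (p ^ i) + (\<Sum>j\<in>A. g j ^ (p ^ i))"
    using insert by (intro eqm_add eqm_refl power_R insert.IH) auto
  finally show ?case using insert by simp
qed (auto simp: power_0_left)

lemma frobenius_power_of_nat: "of_nat n ^ (p ^ i) \<doteq> of_nat n"
proof (induction n)
  case (Suc n)
  have "(1 + of_nat n) ^ (p ^ i) \<doteq> 1 ^ (p ^ i) + of_nat n ^ (p ^ i)" by (intro frobenius_power_add) auto
  also have "\<dots> \<doteq> 1 + of_nat n" using eqm_add[OF eqm_refl[OF one_R] Suc] by simp
  finally show ?case by simp
qed (auto simp: power_0_left)

lemma frobenius_power_uminus: "x \<in> R \<Longrightarrow> (- x) ^ (p ^ i) \<doteq> - (x ^ (p ^ i))"
proof -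
  assume x: "x \<in> R"
  have "(x + - x) ^ (p ^ i) \<doteq> x ^ (p ^ i) + (- x) ^ (p ^ i)" using x by (intro frobenius_power_add) auto
  hence "x ^ (p ^ i) + (- x) ^ (p ^ i) \<doteq> 0" using eqm_sym[of 0] by (simp add: power_0_left)
  from eqm_diff[OF this eqm_refl, of "x ^ (p ^ i)"] show ?thesis using x by simp
qed

end

locale finite_field_model = residue_model +
  fixes f :: nat
  assumes f_pos: "f > 0"
    and roots_R: "t ^ (p ^ f - 1) = 1 \<Longrightarrow> t \<in> R"
begin

abbreviation q where "q \<equiv> p ^ f"

definition U :: "complex set" where "U = {t. t ^ (q - 1) = 1}"

definition T :: "complex set" where "T = insert 0 U"

text \<open>The preimage in \<open>R\<close> of the subfield with \<open>q\<close> elements of the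
  fraction field of \<open>R / M\<close>. Products of elements of \<open>T\<close> stay in
  \<open>T\<close>, sums only stay in \<open>F\<close>; \<open>rep\<close> leads back to
  \<open>T\<close>.\<close>

definition F :: "complex set" where "F = {x \<in> R. x ^ q \<doteq> x}"

definition rep :: "complex \<Rightarrow> complex" where "rep x = (THE t. t \<in> T \<and> x \<doteq> t)"

lemma q_gt_1: "q > 1"
  using p_gt_1 f_pos by (metis one_less_power)

lemma finite_U [simp]: "finite U"
  unfolding U_def using q_gt_1 by (intro finite_roots_unity) auto

lemma card_U: "card U = q - 1"
  unfolding U_def using q_gt_1 by (intro card_roots_unity_eq) auto

lemma zero_notin_U [simp]: "0 \<notin> U"
  using q_gt_1 by (auto simp: U_def power_0_left)

lemma U_nonzero: "t \<in> U \<Longrightarrow> t \<noteq> 0"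
  using zero_notin_U by blast

lemma finite_T [simp]: "finite T"
  by (simp add: T_def)

lemma card_T: "card T = q"
  using q_gt_1 by (simp add: T_def card_U)

lemma U_subset_T: "U \<subseteq> T"
  by (auto simp: T_def)

lemma zero_T [simp]: "0 \<in> T"
  by (simp add: T_def)

lemma one_U [simp]: "1 \<in> U"
  by (simp add: U_def)

lemma U_R [simp]: "t \<in> U \<Longrightarrow> t \<in> R"
  using roots_R by (auto simp: U_def)

lemma T_R [simp]: "t \<in> T \<Longrightarrow> t \<in> R"
  by (auto simp: T_def)

lemma mult_U [simp]: "s \<in> U \<Longrightarrow> t \<in> U \<Longrightarrow> s * t \<in> U"
  by (simp add: U_def power_mult_distrib)

lemma power_U [simp]: "t \<in> U \<Longrightarrow> t ^ n \<in> U"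
  by (induction n) auto

lemma inverse_U [simp]: "t \<in> U \<Longrightarrow> inverse t \<in> U"
  by (simp add: U_def power_inverse)

lemma mult_T [simp]: "s \<in> T \<Longrightarrow> t \<in> T \<Longrightarrow> s * t \<in> T"
  by (auto simp: T_def)

lemma power_T: "t \<in> T \<Longrightarrow> n > 0 \<Longrightarrow> t ^ n \<in> T"
  by (auto simp: T_def power_0_left)

lemma U_notin_M: "t \<in> U \<Longrightarrow> t \<notin> M"
proof
  assume t: "t \<in> U" "t \<in> M"
  hence "inverse t * t \<in> M" by auto
  thus False using t(1) U_nonzero by auto
qed

lemma power_q_T: "t \<in> T \<Longrightarrow> t ^ q = t"
proof -
  assume "t \<in> T"
  moreover have "t ^ q = t" if "t \<in> U"
  proof -
    have "t ^ q = t ^ (q - 1) * t" using q_gt_1 by (metis power_minus_mult zero_less_one less_trans)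
    thus ?thesis using that by (simp add: U_def)
  qed
  ultimately show ?thesis using q_gt_1 by (auto simp: T_def power_0_left)
qed

lemma F_R: "x \<in> F \<Longrightarrow> x \<in> R" and F_D: "x \<in> F \<Longrightarrow> x ^ q \<doteq> x"
  by (auto simp: F_def)

lemma F_I: "x ^ q \<doteq> x \<Longrightarrow> x \<in> F"
  by (auto simp: F_def eqm_R)

lemma T_F [simp]: "t \<in> T \<Longrightarrow> t \<in> F"
  using power_q_T[of t] by (intro F_I) simp

lemma U_F [simp]: "t \<in> U \<Longrightarrow> t \<in> F"
  using U_subset_T by (intro T_F) auto

declare F_R [simp]

lemma add_F [simp]: "x \<in> F \<Longrightarrow> y \<in> F \<Longrightarrow> x + y \<in> F"
  by (rule F_I, rule eqm_trans[OF frobenius_power_add eqm_add]) (simp_all add: F_D)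

lemma mult_F [simp]: "x \<in> F \<Longrightarrow> y \<in> F \<Longrightarrow> x * y \<in> F"
  by (intro F_I) (simp add: power_mult_distrib F_D eqm_mult)

lemma power_F [simp]: "x \<in> F \<Longrightarrow> x ^ n \<in> F"
proof (rule F_I)
  assume "x \<in> F"
  from eqm_power[OF F_D[OF this], of n] show "(x ^ n) ^ q \<doteq> x ^ n"
    by (simp only: power_mult[symmetric] mult.commute)
qed

lemma uminus_F [simp]: "x \<in> F \<Longrightarrow> - x \<in> F"
  by (rule F_I, rule eqm_trans[OF frobenius_power_uminus eqm_uminus]) (simp_all add: F_D)

lemma diff_F [simp]: "x \<in> F \<Longrightarrow> y \<in> F \<Longrightarrow> x - y \<in> F"
  using add_F[of x "- y"] by simp

lemma of_nat_F [simp]: "of_nat n \<in> F"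
  by (intro F_I frobenius_power_of_nat)

lemma sum_F [simp]: "(\<And>x. x \<in> A \<Longrightarrow> g x \<in> F) \<Longrightarrow> sum g A \<in> F"
  by (induction A rule: infinite_finite_induct) auto

lemma eqm_F: "x \<doteq> y \<Longrightarrow> x \<in> F \<Longrightarrow> y \<in> F"
proof -
  assume xy: "x \<doteq> y" "x \<in> F"
  have "y ^ q \<doteq> x ^ q" by (rule eqm_power[OF eqm_sym[OF xy(1)]])
  also have "\<dots> \<doteq> x" using xy(2) by (rule F_D)
  also note xy(1)
  finally show "y \<in> F" by (rule F_I)
qed

text \<open>\<open>x ^ q - x\<close> is the product of the \<open>x - t\<close> over
  \<open>t\<close> in \<open>T\<close>; it lies in the prime ideal \<open>M\<close>, so one factor
  does.\<close>

lemma ex_rep: "x \<in> F \<Longrightarrow> \<exists>t\<in>T. x \<doteq> t"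
proof -
  assume x: "x \<in> F"
  have "(\<Prod>t\<in>T. x - t) = x * (\<Prod>t\<in>U. x - t)" by (simp add: T_def)
  also have "(\<Prod>t\<in>U. x - t) = x ^ (q - 1) - 1"
    unfolding U_def using q_gt_1 by (intro prod_diff_roots_of_unity) simp
  also have "x * (x ^ (q - 1) - 1) = x ^ q - x"
    using power_minus_mult[of q x] q_gt_1 by (simp add: algebra_simps)
  also have "\<dots> \<in> M" using F_D[OF x] by (simp add: eqm_def)
  finally have "\<exists>t\<in>T. x - t \<in> M" using x by (intro prod_in_M_D) auto
  thus ?thesis using x by (auto simp: eqm_def)
qed

text \<open>After division it is enough to see that a root of unity \<open>u\<close> in
  \<open>U\<close> congruent to 1 is 1. Otherwise the geometric sum of its powers is 0 but congruent
  to \<open>q - 1\<close>, and \<open>p\<close> would divide \<open>q - 1\<close>.\<close>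

lemma T_eqI:
  assumes "s \<in> T" "t \<in> T" "s \<doteq> t"
  shows "s = t"
proof -
  have M: "s - t \<in> M" using assms by (simp add: eqm_def)
  have *: "u = 1" if u: "u \<in> U" "u \<doteq> 1" for u
  proof (rule ccontr)
    assume "u \<noteq> 1"
    hence 0: "(\<Sum>i<q - 1. u ^ i) = 0" using u by (simp add: geometric_sum U_def)
    have "(\<Sum>i<q - 1. u ^ i) \<doteq> (\<Sum>i<q - 1. 1)"
      using eqm_power[OF u(2)] by (intro eqm_sum) simp
    hence "of_nat (q - 1) \<doteq> 0" unfolding 0 using eqm_sym by simp
    hence "p dvd q - 1" unfolding eqm_0_iff of_nat_in_M_iff .
    moreover have "p dvd q" using f_pos by (simp add: dvd_power)
    ultimately have "p dvd 1" using q_gt_1 by (metis dvd_diffD1 less_imp_le)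
    thus False using p_gt_1 by simp
  qed
  consider "s = 0" "t = 0" | "s = 0" "t \<in> U" | "s \<in> U" "t = 0" | "s \<in> U" "t \<in> U"
    using assms by (auto simp: T_def)
  thus ?thesis
  proof cases
    case 2
    thus ?thesis using M U_notin_M[of t] uminus_M[of "- t"] by auto
  next
    case 3
    thus ?thesis using M U_notin_M by auto
  next
    case 4
    have "s * inverse t \<doteq> t * inverse t" using assms(3) 4 by (intro eqm_mult) auto
    hence "s * inverse t = 1" using 4 U_nonzero by (intro *) auto
    thus ?thesis using 4 U_nonzero by (simp add: field_simps)
  qed auto
qed

lemma rep_T: "x \<in> F \<Longrightarrow> rep x \<in> T" and rep_eqm: "x \<in> F \<Longrightarrow> x \<doteq> rep x"
proof -
  assume "x \<in> F"
  from ex_rep[OF this] obtain t where t: "t \<in> T" "x \<doteq> t" ..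
  have "rep x \<in> T \<and> x \<doteq> rep x" unfolding rep_def
  proof (rule theI[where a = t])
    fix s assume s: "s \<in> T \<and> x \<doteq> s"
    from s t have "s \<doteq> t" using eqm_trans[OF eqm_sym] by blast
    thus "s = t" using s t by (intro T_eqI) auto
  qed (use t in simp)
  thus "rep x \<in> T" "x \<doteq> rep x" by auto
qed

lemma rep_F [simp]: "x \<in> F \<Longrightarrow> rep x \<in> F"
  using rep_T[of x] by simp

lemma rep_eqI: "t \<in> T \<Longrightarrow> x \<doteq> t \<Longrightarrow> rep x = t"
proof -
  assume t: "t \<in> T" "x \<doteq> t"
  hence x: "x \<in> F" using eqm_F[OF eqm_sym[OF t(2)]] by simp
  show "rep x = t"
    using t by (intro T_eqI[OF rep_T[OF x]] eqm_trans[OF eqm_sym[OF rep_eqm[OF x]]])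
qed

lemma rep_T_id [simp]: "t \<in> T \<Longrightarrow> rep t = t"
  by (rule rep_eqI) auto

lemma rep_eq_iff: "x \<in> F \<Longrightarrow> y \<in> F \<Longrightarrow> rep x = rep y \<longleftrightarrow> x \<doteq> y"
proof
  assume "x \<in> F" "y \<in> F" "rep x = rep y"
  thus "x \<doteq> y" using rep_eqm[of x] eqm_sym[OF rep_eqm[of y]] eqm_trans[of x "rep x" y] by simp
next
  assume xy: "x \<in> F" "y \<in> F" "x \<doteq> y"
  thus "rep x = rep y" using eqm_trans[OF xy(3) rep_eqm[of y]] by (intro rep_eqI rep_T)
qed

lemma rep_U: "x \<in> F \<Longrightarrow> x \<notin> M \<Longrightarrow> rep x \<in> U"
  using rep_T[of x] rep_eqm[of x] by (auto simp: T_def eqm_0_iff)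

lemma bij_betw_rep_add:
  assumes "c \<in> F"
  shows "bij_betw (\<lambda>t. rep (t + c)) T T"
proof (rule bij_betwI[where g = "\<lambda>t. rep (t - c)"])
  show "(\<lambda>t. rep (t + c)) \<in> T \<rightarrow> T" "(\<lambda>t. rep (t - c)) \<in> T \<rightarrow> T"
    using assms by (auto intro!: rep_T)
  fix t assume t: "t \<in> T"
  have "rep (t + c) - c \<doteq> (t + c) - c"
    using assms t by (intro eqm_diff eqm_sym[OF rep_eqm]) auto
  thus "rep (rep (t + c) - c) = t" using t by (intro rep_eqI) auto
  have "rep (t - c) + c \<doteq> (t - c) + c"
    using assms t by (intro eqm_add eqm_sym[OF rep_eqm]) auto
  thus "rep (rep (t - c) + c) = t" using t by (intro rep_eqI) auto
qed

lemma sum_U_power: "(\<Sum>t\<in>U. t ^ a) = (if (q - 1) dvd a then of_nat (q - 1) else 0)"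
  unfolding U_def using q_gt_1 by (intro sum_powers_roots_of_unity) auto

lemma sum_U_mult:
  assumes "u \<in> U"
  shows "(\<Sum>t\<in>U. g (u * t)) = (\<Sum>t\<in>U. g t)"
  by (rule sum.reindex_bij_witness[of _ "\<lambda>t. inverse u * t" "\<lambda>t. u * t"])
     (use assms U_nonzero in \<open>auto simp: mult.assoc[symmetric]\<close>)

section \<open>The absolute trace and the additive character of the model\<close>

definition tr :: "complex \<Rightarrow> complex" where "tr x = (\<Sum>i<f. x ^ (p ^ i))"

lemma tr_F [simp]: "x \<in> F \<Longrightarrow> tr x \<in> F"
  unfolding tr_def by (intro sum_F power_F) auto

lemma tr_cong: "x \<doteq> y \<Longrightarrow> tr x \<doteq> tr y"
  unfolding tr_def by (intro eqm_sum eqm_power)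

lemma tr_add: "x \<in> R \<Longrightarrow> y \<in> R \<Longrightarrow> tr (x + y) \<doteq> tr x + tr y"
  unfolding tr_def sum.distrib[symmetric] by (intro eqm_sum frobenius_power_add)

lemma tr_frobenius: "x \<in> F \<Longrightarrow> tr x ^ p \<doteq> tr x"
proof -
  assume x: "x \<in> F"
  obtain g where f: "f = Suc g" using f_pos by (cases f) auto
  have "tr x ^ (p ^ 1) \<doteq> (\<Sum>i<f. (x ^ (p ^ i)) ^ (p ^ 1))"
    unfolding tr_def using x by (intro frobenius_power_sum) auto
  also have "(\<Sum>i<f. (x ^ (p ^ i)) ^ (p ^ 1)) = (\<Sum>i<g. x ^ (p ^ Suc i)) + x ^ q"
    unfolding f by (simp add: power_mult[symmetric] mult.commute)
  also have "\<dots> \<doteq> (\<Sum>i<g. x ^ (p ^ Suc i)) + x"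
    using x by (intro eqm_add eqm_refl F_D) auto
  also have "\<dots> = tr x"
  proof -
    have "tr x = (\<Sum>i<Suc g. x ^ (p ^ i))" unfolding tr_def f[symmetric] ..
    also have "\<dots> = x + (\<Sum>i<g. x ^ (p ^ Suc i))" by (subst sum.lessThan_Suc_shift) simp
    finally show ?thesis by simp
  qed
  finally show ?thesis by simp
qed

text \<open>By counting: \<open>u ^ p = u\<close> has at most \<open>p\<close> solutions in
  \<open>T\<close>, and the representatives of \<open>0, ..., p - 1\<close> are already
  \<open>p\<close> different ones.\<close>

lemma ex_of_nat_eqm:
  assumes "y \<in> F" "y ^ p \<doteq> y"
  shows "\<exists>j<p. y \<doteq> of_nat j"
proof -
  define V where "V = {u \<in> T. u ^ p = u}"
  have "V \<subseteq> insert 0 {z. z ^ (p - 1) = 1}"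
  proof
    fix u assume "u \<in> V"
    hence "u * (u ^ (p - 1) - 1) = 0"
      by (auto simp: V_def right_diff_distrib power_Suc[symmetric] simp del: power_Suc)
    thus "u \<in> insert 0 {z. z ^ (p - 1) = 1}" by auto
  qed
  moreover have fin: "finite (insert 0 {z::complex. z ^ (p - 1) = 1})"
    using p_gt_1 by (auto intro: finite_roots_unity)
  moreover have "card (insert 0 {z::complex. z ^ (p - 1) = 1}) \<le> p"
  proof -
    have "card (insert 0 {z::complex. z ^ (p - 1) = 1}) \<le> Suc (card {z::complex. z ^ (p - 1) = 1})"
      by (rule card_insert_le_m1) auto
    moreover have "card {z::complex. z ^ (p - 1) = 1} \<le> p - 1"
      using p_gt_1 by (intro card_roots_unity) simp
    ultimately show ?thesis using p_gt_1 by linarith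
  qed
  ultimately have cardV: "card V \<le> p" by (meson card_mono le_trans)
  have inV: "rep z \<in> V" if z: "z \<in> F" "z ^ p \<doteq> z" for z
  proof -
    have "rep z ^ p \<doteq> z ^ p" using z by (intro eqm_power eqm_sym[OF rep_eqm])
    also have "\<dots> \<doteq> z" by (rule z)
    also have "\<dots> \<doteq> rep z" using z by (intro rep_eqm)
    finally have "rep z ^ p = rep z" using z by (intro T_eqI) (auto intro!: rep_T power_T)
    thus ?thesis using z rep_T by (auto simp: V_def)
  qed
  have sub: "(\<lambda>j. rep (of_nat j)) ` {..<p} \<subseteq> V"
    using frobenius_power_of_nat[of _ 1] by (auto intro!: inV)
  have inj: "inj_on (\<lambda>j. rep (of_nat j)) {..<p}"
  proof (rule inj_onI)
    fix i j assume ij: "i \<in> {..<p}" "j \<in> {..<p}" "rep (of_nat i) = rep (of_nat j)"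
    hence "of_nat i \<doteq> of_nat j" by (subst (asm) rep_eq_iff) auto
    thus "i = j" using ij by (simp add: eqm_of_nat_iff cong_def)
  qed
  have "(\<lambda>j. rep (of_nat j)) ` {..<p} = V"
    using sub cardV inj by (intro card_seteq) (auto simp: card_image V_def)
  with inV[OF assms] obtain j where "j < p" "rep y = rep (of_nat j)" by auto
  thus ?thesis using assms by (auto simp: rep_eq_iff of_nat_F)
qed

definition trn :: "complex \<Rightarrow> nat" where "trn x = (THE j. j < p \<and> of_nat j \<doteq> tr x)"

definition psi :: "complex \<Rightarrow> complex" where "psi x = zeta p ^ trn x"

lemma trn_eqI: "j < p \<Longrightarrow> of_nat j \<doteq> tr x \<Longrightarrow> trn x = j"
proof -
  assume j: "j < p" "of_nat j \<doteq> tr x"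
  show ?thesis unfolding trn_def
  proof (rule the_equality)
    fix i assume i: "i < p \<and> of_nat i \<doteq> tr x"
    have "of_nat i \<doteq> of_nat j" by (rule eqm_trans[OF conjunct2[OF i] eqm_sym[OF j(2)]])
    thus "i = j" using i j by (simp add: eqm_of_nat_iff cong_def)
  qed (use j in simp)
qed

lemma trn: "x \<in> F \<Longrightarrow> trn x < p" "x \<in> F \<Longrightarrow> of_nat (trn x) \<doteq> tr x"
proof -
  assume x: "x \<in> F"
  from ex_of_nat_eqm[OF tr_F[OF this] tr_frobenius[OF this]]
  obtain j where "j < p" "tr x \<doteq> of_nat j" by auto
  thus "trn x < p" "of_nat (trn x) \<doteq> tr x" using trn_eqI[of j x] eqm_sym[of "tr x"] by auto
qed

lemma psi_eqI: "of_nat j \<doteq> tr x \<Longrightarrow> psi x = zeta p ^ j"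
proof -
  assume j: "of_nat j \<doteq> tr x"
  have "of_nat (j mod p) \<doteq> of_nat j" by (rule eqm_of_nat) simp
  hence "trn x = j mod p" using j by (intro trn_eqI) (auto intro: eqm_trans)
  thus ?thesis by (simp add: psi_def power_mod_root)
qed

lemma psi_add: "x \<in> F \<Longrightarrow> y \<in> F \<Longrightarrow> psi (x + y) = psi x * psi y"
proof -
  assume xy: "x \<in> F" "y \<in> F"
  have "of_nat (trn x) + of_nat (trn y) \<doteq> tr x + tr y" using xy trn by (intro eqm_add) auto
  also have "\<dots> \<doteq> tr (x + y)" using xy tr_add eqm_sym by auto
  finally have "of_nat (trn x + trn y) \<doteq> tr (x + y)" by simp
  from psi_eqI[OF this] show ?thesis by (simp add: psi_def power_add)
qed

lemma psi_cong: "x \<in> F \<Longrightarrow> x \<doteq> y \<Longrightarrow> psi x = psi y"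
proof -
  assume xy: "x \<in> F" "x \<doteq> y"
  have "of_nat (trn x) \<doteq> tr y" using trn(2)[OF xy(1)] tr_cong[OF xy(2)] eqm_trans by blast
  thus ?thesis using psi_eqI by (metis psi_def)
qed

lemma psi_0 [simp]: "psi 0 = 1"
  using psi_eqI[of 0 0] by (simp add: tr_def power_0_left)

lemma psi_rep: "x \<in> F \<Longrightarrow> psi (rep x) = psi x"
  using psi_cong rep_eqm by metis

lemma psi_R [simp]: "psi x \<in> R"
  by (auto simp: psi_def)

lemma psi_nonzero [simp]: "psi x \<noteq> 0"
  by (simp add: psi_def)

lemma cnj_psi: "x \<in> F \<Longrightarrow> cnj (psi x) = psi (- x)"
proof -
  assume "x \<in> F"
  hence "psi x * psi (- x) = 1" using psi_add[of x "- x"] by auto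
  moreover have "psi x * cnj (psi x) = 1"
    using complex_norm_square[of "psi x"] by (simp add: psi_def norm_power)
  ultimately show ?thesis by (metis mult_left_cancel psi_nonzero)
qed

text \<open>If the trace vanished modulo \<open>M\<close> on \<open>T\<close>, so would the sum of
  \<open>t ^ (q - 2) * tr t\<close>. The weight \<open>t ^ (q - 2)\<close> extracts one coefficient
  of the trace polynomial: \<open>q - 1\<close> divides \<open>q - 2 + p ^ i\<close> only for
  \<open>i = 0\<close>, so the sum is \<open>q - 1\<close>, which is not in
  \<open>M\<close>.\<close>

lemma ex_psi_neq_1: "\<exists>t\<in>T. psi t \<noteq> 1"
proof (rule ccontr)
  assume "\<not> (\<exists>t\<in>T. psi t \<noteq> 1)"
  hence 1: "psi t = 1" if "t \<in> T" for t using that by blast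
  have trM: "tr t \<in> M" if t: "t \<in> T" for t
  proof -
    have "p dvd trn t" using 1[OF t] by (simp add: psi_def zeta_power_eq_1_iff)
    hence "trn t = 0" using trn(1)[of t] t by (auto dest: dvd_imp_le)
    thus ?thesis using trn(2)[of t] t eqm_M_iff by fastforce
  qed
  have "(\<Sum>t\<in>U. t ^ (q - 2) * tr t) \<in> M"
    using trM U_subset_T by (intro sum_M mult_M) auto
  also have "(\<Sum>t\<in>U. t ^ (q - 2) * tr t) = (\<Sum>i<f. \<Sum>t\<in>U. t ^ (q - 2 + p ^ i))"
    unfolding tr_def sum_distrib_left power_add by (rule sum.swap)
  also have "\<dots> = (\<Sum>i<f. if i = 0 then of_nat (q - 1) else 0)"
  proof (rule sum.cong)
    fix i assume i: "i \<in> {..<f}"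
    have "(q - 1) dvd (q - 2 + p ^ i) \<longleftrightarrow> i = 0"
    proof
      assume d: "(q - 1) dvd (q - 2 + p ^ i)"
      show "i = 0"
      proof (rule ccontr)
        assume "i \<noteq> 0"
        hence pi: "p ^ i > 1" using p_gt_1 by (metis one_less_power neq0_conv)
        have "p ^ i < q" using i p_gt_1 by simp
        have "q - 2 + p ^ i = (q - 1) + (p ^ i - 1)" using pi q_gt_1 by linarith
        hence "(q - 1) dvd p ^ i - 1" using d by (metis dvd_add_right_iff dvd_refl)
        hence "q - 1 \<le> p ^ i - 1" using pi by (intro dvd_imp_le) auto
        thus False using \<open>p ^ i < q\<close> pi by linarith
      qed
    next
      assume "i = 0"
      hence "q - 2 + p ^ i = q - 1" using q_gt_1 by simp
      thus "(q - 1) dvd (q - 2 + p ^ i)" by simp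
    qed
    thus "(\<Sum>t\<in>U. t ^ (q - 2 + p ^ i)) = (if i = 0 then of_nat (q - 1) else 0)"
      by (simp only: sum_U_power)
  qed simp
  also have "\<dots> = of_nat (q - 1)" using f_pos by simp
  finally have "p dvd q - 1" by (simp only: of_nat_in_M_iff)
  moreover have "p dvd q" using f_pos by (simp add: dvd_power)
  ultimately have "p dvd 1" using q_gt_1 by (metis dvd_diffD1 less_imp_le)
  thus False using p_gt_1 by simp
qed

lemma sum_psi_T: "(\<Sum>t\<in>T. psi t) = 0"
proof -
  obtain c where c: "c \<in> T" "psi c \<noteq> 1" using ex_psi_neq_1 by blast
  have "(\<Sum>t\<in>T. psi t) = (\<Sum>t\<in>T. psi (rep (t + c)))"
    using c by (intro sum.reindex_bij_betw[symmetric] bij_betw_rep_add) auto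
  also have "\<dots> = (\<Sum>t\<in>T. psi t * psi c)"
    using c psi_add T_F by (intro sum.cong) (auto simp: psi_rep)
  also have "\<dots> = (\<Sum>t\<in>T. psi t) * psi c" by (simp add: sum_distrib_right)
  finally show ?thesis using c(2) by (simp add: algebra_simps)
qed

lemma sum_psi_U: "(\<Sum>t\<in>U. psi t) = -1"
  using sum_psi_T by (simp add: T_def add_eq_0_iff)

lemma sum_psi_mult_U:
  assumes "y \<in> F"
  shows "(\<Sum>t\<in>U. psi (t * y)) = (if y \<in> M then of_nat (q - 1) else -1)"
proof (cases "y \<in> M")
  case True
  have "psi (t * y) = psi 0" if "t \<in> U" for t
    using that True assms by (intro psi_cong) (auto simp: eqm_0_iff)
  thus ?thesis using True by (simp add: card_U)
next
  case False
  have u: "rep y \<in> U" using False assms by (rule rep_U[rotated])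
  have "psi (t * y) = psi (rep y * t)" if "t \<in> U" for t
  proof (rule psi_cong)
    have "t * y \<doteq> t * rep y" using that assms by (intro eqm_mult rep_eqm) auto
    thus "t * y \<doteq> rep y * t" by (simp add: mult.commute)
  qed (use that assms in auto)
  hence "(\<Sum>t\<in>U. psi (t * y)) = (\<Sum>t\<in>U. psi (rep y * t))" by simp
  also have "\<dots> = (\<Sum>t\<in>U. psi t)" by (rule sum_U_mult[OF u])
  finally show ?thesis using False sum_psi_U by simp
qed

section \<open>Gauss sums of the model: absolute value and complex conjugation\<close>

definition G :: "nat \<Rightarrow> complex" where "G a = (\<Sum>t\<in>U. t ^ a * psi t)"

lemma G_R [simp]: "G a \<in> R"
  unfolding G_def by auto

lemma norm_U: "t \<in> U \<Longrightarrow> norm t = 1"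
  using q_gt_1 by (intro norm_root_of_unity[of "q - 1"]) (auto simp: U_def)

lemma cnj_U: "t \<in> U \<Longrightarrow> cnj t = inverse t"
proof -
  assume t: "t \<in> U"
  have "t * cnj t = 1" using norm_U[OF t] using complex_norm_square[of t] by simp
  thus ?thesis by (metis inverse_unique)
qed

lemma norm_G:
  assumes "\<not> (q - 1) dvd a"
  shows "(norm (G a))\<^sup>2 = real q"
proof -
  have "G a * cnj (G a) = (\<Sum>s\<in>U. \<Sum>t\<in>U. (t ^ a * psi t) * (inverse s ^ a * psi (- s)))"
    unfolding G_def cnj_sum sum_distrib_left sum_distrib_right
    by (intro sum.cong refl) (use cnj_U cnj_psi in auto)
  also have "\<dots> = (\<Sum>s\<in>U. \<Sum>u\<in>U. u ^ a * psi (s * (u - 1)))"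
  proof (rule sum.cong)
    fix s assume s: "s \<in> U"
    have "(\<Sum>t\<in>U. (t ^ a * psi t) * (inverse s ^ a * psi (- s)))
        = (\<Sum>u\<in>U. ((s * u) ^ a * psi (s * u)) * (inverse s ^ a * psi (- s)))"
      by (rule sum_U_mult[OF s, symmetric])
    also have "\<dots> = (\<Sum>u\<in>U. u ^ a * psi (s * (u - 1)))"
    proof (rule sum.cong)
      fix u assume u: "u \<in> U"
      have "psi (s * (u - 1)) = psi (s * u) * psi (- s)"
        using psi_add[of "s * u" "- s"] s u by (auto simp: algebra_simps)
      thus "((s * u) ^ a * psi (s * u)) * (inverse s ^ a * psi (- s)) = u ^ a * psi (s * (u - 1))"
        using U_nonzero[OF s] by (simp add: power_mult_distrib power_inverse)
    qed simp
    finally show "(\<Sum>t\<in>U. (t ^ a * psi t) * (inverse s ^ a * psi (- s))) = (\<Sum>u\<in>U. u ^ a * psi (s * (u - 1)))" .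
  qed simp
  \<comment> \<open>With the ratio \<open>u\<close> outside, the inner sum runs over an additive
    character: it is \<open>q - 1\<close> for \<open>u = 1\<close> and -1 otherwise.\<close>
  also have "\<dots> = (\<Sum>u\<in>U. u ^ a * (\<Sum>s\<in>U. psi (s * (u - 1))))"
    unfolding sum_distrib_left by (rule sum.swap)
  also have "\<dots> = (\<Sum>u\<in>U. (if u = 1 then of_nat q else 0) - u ^ a)"
  proof (rule sum.cong)
    fix u assume u: "u \<in> U"
    have "u - 1 \<in> M \<longleftrightarrow> u = 1"
      using T_eqI[of u 1] subsetD[OF U_subset_T u] subsetD[OF U_subset_T one_U] u by (auto simp: eqm_def)
    moreover have "u - 1 \<in> F" using u by auto
    ultimately show "u ^ a * (\<Sum>s\<in>U. psi (s * (u - 1))) = (if u = 1 then of_nat q else 0) - u ^ a"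
      using q_gt_1 sum_psi_mult_U[of "u - 1"] by (auto simp: of_nat_diff)
  qed simp
  also have "\<dots> = of_nat q"
    using sum_U_power[of a] assms by (simp add: sum_subtractf sum.delta)
  finally have "complex_of_real ((norm (G a))\<^sup>2) = of_real (real q)"
    using complex_norm_square[of "G a"] by simp
  thus ?thesis by (simp only: of_real_eq_iff)
qed

text \<open>The first factor is the character value at -1 and comes from \<open>psi (- t)\<close>.
  The formula lets a division by a Gauss sum be replaced by a multiplication with one whose
  valuation can be bounded below.\<close>

lemma cnj_G:
  assumes "a < q - 1"
  shows "cnj (G a) = rep (- 1) ^ a * G (q - 1 - a)"
proof -
  have m: "rep (- 1) \<in> U" using uminus_M[of "-1"] by (intro rep_U) auto
  have mm: "rep (- 1) * rep (- 1) = 1"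
  proof (rule T_eqI)
    have "rep (- 1) * rep (- 1) \<doteq> (- 1) * (- 1)" by (intro eqm_mult eqm_sym[OF rep_eqm]) auto
    thus "rep (- 1) * rep (- 1) \<doteq> 1" by simp
  qed (use m U_subset_T in auto)
  have inv: "inverse t ^ a = t ^ (q - 1 - a)" if "t \<in> U" for t
  proof -
    have "t ^ a * t ^ (q - 1 - a) = 1" using that assms by (simp add: U_def power_add[symmetric])
    thus ?thesis by (metis inverse_unique power_inverse)
  qed
  have "cnj (G a) = (\<Sum>t\<in>U. inverse t ^ a * psi (- t))"
    unfolding G_def cnj_sum by (intro sum.cong) (use cnj_U cnj_psi in auto)
  also have "\<dots> = (\<Sum>t\<in>U. inverse (rep (- 1) * t) ^ a * psi (- (rep (- 1) * t)))"
    by (rule sum_U_mult[OF m, symmetric])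
  also have "\<dots> = (\<Sum>t\<in>U. rep (- 1) ^ a * (t ^ (q - 1 - a) * psi t))"
  proof (rule sum.cong)
    fix t assume t: "t \<in> U"
    have "- (rep (- 1) * t) \<doteq> - ((- 1) * t)"
      using t by (intro eqm_uminus eqm_mult eqm_sym[OF rep_eqm]) auto
    hence "psi (- (rep (- 1) * t)) = psi t"
      using t m by (intro psi_cong) auto
    moreover have "inverse (rep (- 1)) = rep (- 1)" using mm by (metis inverse_unique)
    ultimately show "inverse (rep (- 1) * t) ^ a * psi (- (rep (- 1) * t)) = rep (- 1) ^ a * (t ^ (q - 1 - a) * psi t)"
      by (simp only: inverse_mult_distrib power_mult_distrib inv[OF t] mult_ac)
  qed simp
  also have "\<dots> = rep (- 1) ^ a * G (q - 1 - a)" by (simp add: G_def sum_distrib_left)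
  finally show ?thesis .
qed

end

section \<open>Integer polynomials and local divisibility\<close>

text \<open>Complex polynomials with integer coefficients, so that they are evaluated at roots of
  unity without an embedding.\<close>

definition int_coeffs :: "complex poly \<Rightarrow> bool" where
  "int_coeffs P \<longleftrightarrow> (\<forall>i. poly.coeff P i \<in> \<int>)"

lemma int_coeffs_add: "int_coeffs P \<Longrightarrow> int_coeffs Q \<Longrightarrow> int_coeffs (P + Q)"
  by (simp add: int_coeffs_def)

lemma int_coeffs_uminus: "int_coeffs P \<Longrightarrow> int_coeffs (- P)"
  by (simp add: int_coeffs_def)

lemma int_coeffs_mult: "int_coeffs P \<Longrightarrow> int_coeffs Q \<Longrightarrow> int_coeffs (P * Q)"
  unfolding int_coeffs_def Polynomial.coeff_mult by (intro allI Ints_sum Ints_mult) auto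

lemma int_coeffs_const: "c \<in> \<int> \<Longrightarrow> int_coeffs [:c:]"
  unfolding int_coeffs_def by (auto simp: coeff_pCons split: nat.splits)

lemma int_coeffs_monom: "c \<in> \<int> \<Longrightarrow> int_coeffs (Polynomial.monom c n)"
  unfolding int_coeffs_def by auto

lemma int_coeffs_0: "int_coeffs 0"
  by (simp add: int_coeffs_def)

lemma int_coeffs_sum: "(\<And>i. i \<in> A \<Longrightarrow> int_coeffs (g i)) \<Longrightarrow> int_coeffs (sum g A)"
  by (induction A rule: infinite_finite_induct) (auto intro: int_coeffs_add int_coeffs_0)

lemma int_coeffs_power: "int_coeffs P \<Longrightarrow> int_coeffs (P ^ n)"
  by (induction n) (auto intro: int_coeffs_mult simp: one_pCons int_coeffs_const)

lemma int_coeffs_pcompose: "int_coeffs P \<Longrightarrow> int_coeffs Q \<Longrightarrow> int_coeffs (pcompose P Q)"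
proof (induction P)
  case (pCons a P)
  have "poly.coeff (pCons a P) 0 \<in> \<int>" "poly.coeff (pCons a P) (Suc i) \<in> \<int>" for i
    using pCons.prems(1) unfolding int_coeffs_def by blast+
  hence "a \<in> \<int>" "int_coeffs P" by (auto simp: int_coeffs_def)
  thus ?case using pCons.IH pCons.prems(2)
    unfolding pcompose_pCons by (intro int_coeffs_add int_coeffs_mult int_coeffs_const)
qed (simp add: int_coeffs_0)

lemma cnj_poly_int_coeffs:
  assumes "int_coeffs P"
  shows "cnj (poly P z) = poly P (cnj z)"
proof -
  have "cnj (poly.coeff P i) = poly.coeff P i" for i
  proof -
    obtain m where "poly.coeff P i = of_int m" using assms by (auto simp: int_coeffs_def elim: Ints_cases)
    thus ?thesis by simp
  qed
  thus ?thesis by (simp add: poly_altdef)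
qed

lemma zeta_power_power: "n > 0 \<Longrightarrow> (zeta n ^ i) ^ n = 1"
  using zeta_power_eq_1_iff[of n "i * n"] by (simp add: power_mult)

text \<open>The trace of an algebraic integer is an integer: exchanging the sums leaves integer
  combinations of Ramanujan sums.\<close>

lemma sum_poly_zeta_int:
  assumes "n > 0" "int_coeffs P"
  shows "(\<Sum>j | j \<in> {1..n} \<and> coprime j n. poly P (zeta n ^ j)) \<in> \<int>"
proof -
  have "(\<Sum>j | j \<in> {1..n} \<and> coprime j n. poly P (zeta n ^ j))
      = (\<Sum>i\<le>Polynomial.degree P. poly.coeff P i * (\<Sum>j | j \<in> {1..n} \<and> coprime j n. (zeta n ^ i) ^ j))"
  proof -
    have "(zeta n ^ j) ^ i = (zeta n ^ i) ^ j" for i j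
      unfolding power_mult[symmetric] by (simp only: mult.commute)
    thus ?thesis unfolding poly_altdef sum_distrib_left by (simp only: sum.swap[of _ "{..Polynomial.degree P}"])
  qed
  also have "\<dots> \<in> \<int>"
  proof (rule Ints_sum, rule Ints_mult)
    show "poly.coeff P i \<in> \<int>" for i using assms(2) by (simp add: int_coeffs_def)
    show "(\<Sum>j | j \<in> {1..n} \<and> coprime j n. (zeta n ^ i) ^ j) \<in> \<int>" for i
      by (intro ramanujan_sum_int zeta_power_power assms(1))
  qed
  finally show ?thesis .
qed

context residue_model
begin

text \<open>Divisibility in the localization of \<open>R\<close> at \<open>M\<close>.\<close>

definition ldvd :: "complex \<Rightarrow> complex \<Rightarrow> bool" where
  "ldvd a x \<longleftrightarrow> (\<exists>s\<in>R - M. \<exists>y\<in>R. s * x = a * y)"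

lemma ldvdI: "s \<in> R - M \<Longrightarrow> y \<in> R \<Longrightarrow> s * x = a * y \<Longrightarrow> ldvd a x"
  unfolding ldvd_def by blast

lemma ldvd_multI: "y \<in> R \<Longrightarrow> ldvd a (a * y)"
  by (rule ldvdI[of 1 y]) auto

lemma ldvd_mult:
  assumes "ldvd a x" "ldvd b y"
  shows "ldvd (a * b) (x * y)"
proof -
  obtain s u where 1: "s \<in> R - M" "u \<in> R" "s * x = a * u" using assms(1) by (auto simp: ldvd_def)
  obtain s' u' where 2: "s' \<in> R - M" "u' \<in> R" "s' * y = b * u'" using assms(2) by (auto simp: ldvd_def)
  show ?thesis
  proof (rule ldvdI)
    show "s * s' \<in> R - M" using 1 2 by (intro mult_notin_M)
    show "u * u' \<in> R" using 1 2 by simp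
    have "(s * s') * (x * y) = (s * x) * (s' * y)" by (simp only: mult_ac)
    also have "\<dots> = (a * b) * (u * u')" unfolding 1 2 by (simp only: mult_ac)
    finally show "(s * s') * (x * y) = (a * b) * (u * u')" .
  qed
qed

lemma ldvd_one: "x \<in> R \<Longrightarrow> ldvd 1 x"
  using ldvd_multI[of x 1] by simp

lemma ldvd_power: "ldvd a x \<Longrightarrow> ldvd (a ^ n) (x ^ n)"
  by (induction n) (auto intro: ldvd_mult ldvd_one)

lemma ldvd_mult_right: "ldvd a x \<Longrightarrow> y \<in> R \<Longrightarrow> ldvd a (x * y)"
  using ldvd_mult[of a x 1 y] ldvd_one by simp

lemma ldvd_add:
  assumes "ldvd a x" "ldvd a y"
  shows "ldvd a (x + y)"
proof -
  obtain s u where 1: "s \<in> R - M" "u \<in> R" "s * x = a * u" using assms(1) by (auto simp: ldvd_def)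
  obtain s' u' where 2: "s' \<in> R - M" "u' \<in> R" "s' * y = a * u'" using assms(2) by (auto simp: ldvd_def)
  show ?thesis
  proof (rule ldvdI)
    show "s * s' \<in> R - M" using 1 2 by (intro mult_notin_M)
    show "s' * u + s * u' \<in> R" using 1 2 by simp
    have "(s * s') * (x + y) = s' * (s * x) + s * (s' * y)" by (simp only: algebra_simps)
    also have "\<dots> = a * (s' * u + s * u')" unfolding 1 2 by (simp only: algebra_simps)
    finally show "(s * s') * (x + y) = a * (s' * u + s * u')" .
  qed
qed

lemma ldvd_uminus: "ldvd a x \<Longrightarrow> ldvd a (- x)"
  using ldvd_mult_right[of a x "-1"] by simp

lemma ldvd_diff: "ldvd a x \<Longrightarrow> ldvd a y \<Longrightarrow> ldvd a (x - y)"
  using ldvd_add[of a x "- y"] ldvd_uminus by simp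

lemma ldvd_0: "ldvd a 0"
  using ldvd_multI[of 0 a] by simp

lemma ldvd_sum: "(\<And>i. i \<in> A \<Longrightarrow> ldvd a (g i)) \<Longrightarrow> ldvd a (sum g A)"
  by (induction A rule: infinite_finite_induct) (auto intro: ldvd_add ldvd_0)

lemma ldvd_cancel:
  assumes "c \<in> R - M" "ldvd a (c * x)"
  shows "ldvd a x"
proof -
  obtain s u where 1: "s \<in> R - M" "u \<in> R" "s * (c * x) = a * u" using assms(2) by (auto simp: ldvd_def)
  show ?thesis
    by (rule ldvdI[of "s * c" u]) (use 1 assms(1) mult_notin_M in \<open>auto simp: mult.assoc\<close>)
qed

lemma ldvd_cancel_common:
  assumes "c \<noteq> 0" "ldvd (c * a) (c * x)"
  shows "ldvd a x"
proof -
  obtain s u where 1: "s \<in> R - M" "u \<in> R" "s * (c * x) = c * a * u" using assms(2) by (auto simp: ldvd_def)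
  hence "c * (s * x) = c * (a * u)" by (simp only: mult_ac)
  hence "s * x = a * u" using assms(1) by simp
  thus ?thesis using 1 by (intro ldvdI)
qed

lemma ldvd_trans:
  assumes "ldvd (a * y) x" "y \<in> R"
  shows "ldvd a x"
proof -
  obtain s u where 1: "s \<in> R - M" "u \<in> R" "s * x = a * y * u" using assms(1) by (auto simp: ldvd_def)
  thus ?thesis using assms(2) by (intro ldvdI[of s "y * u"]) (auto simp: mult.assoc)
qed

text \<open>This is why one prime over \<open>p\<close> suffices for a rational integer:
  \<open>s\<close> is not in \<open>M\<close> and \<open>M\<close> meets the integers in the
  multiples of \<open>p\<close>, so the factors \<open>p\<close> are split off one at a
  time.\<close>

lemma ldvd_of_int_imp_dvd:
  assumes "ldvd (of_nat p ^ N) (of_int w)"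
  shows "int p ^ N dvd w"
proof -
  obtain s u where s: "s \<in> R - M" "u \<in> R" and eq: "s * of_int w = of_nat p ^ N * u"
    using assms by (auto simp: ldvd_def)
  show ?thesis using eq
  proof (induction N arbitrary: w)
    case (Suc N)
    have "s * of_int w \<in> M" unfolding Suc.prems using p_in_M s by (simp add: mult.assoc)
    hence "of_int w \<in> M" using prime_M[of s "of_int w"] s by auto
    hence "int p dvd w" by (simp only: of_int_in_M_iff)
    then obtain v where v: "w = int p * v" by blast
    have "of_nat p * (s * of_int v) = of_nat p * (of_nat p ^ N * u)"
      using Suc.prems unfolding v by (simp add: mult_ac)
    hence "s * of_int v = of_nat p ^ N * u" by simp
    hence "int p ^ N dvd v" by (rule Suc.IH)
    thus ?case unfolding v by simp
  qed simp
qed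

text \<open>
  If a multiple \<open>r * P(\<zeta>)\<close> of a value of an integer polynomial is bounded by \<open>2 p ^ n\<close> together
  with all its conjugates, and locally divisible by \<open>p ^ n\<close>, then the integers
  \<open>\<Sum>\<bar>r * P(\<zeta> ^ j)\<bar> ^ (2 * m)\<close> are divisible by \<open>(r * p ^ n) ^ (2 * m)\<close> but smaller than that for
  large \<open>m\<close>.
\<close>

lemma int_poly_value_eq_0:
  assumes "k > 0" "r \<ge> 3" "coprime r p" "int_coeffs P"
  assumes bound: "\<And>j. coprime j k \<Longrightarrow> norm (of_nat r * poly P (zeta k ^ j)) \<le> 2 * real p ^ n"
  assumes div: "\<And>j. coprime j k \<Longrightarrow> ldvd (of_nat p ^ n) (of_nat r * poly P (zeta k ^ j))"
  shows "poly P (zeta k) = 0"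
proof -
  define \<delta> where "\<delta> j = of_nat r * poly P (zeta k ^ j)" for j
  define A where "A = {j. j \<in> {1..k} \<and> coprime j k}"
  have finA [simp]: "finite A" by (simp add: A_def)
  have one_A: "1 \<in> A" using assms(1) by (simp add: A_def)
  define c where "c = card A"
  \<comment> \<open>Conjugation of a \<open>k\<close>-th root of unity is the power
    \<open>k - 1\<close>, so \<open>Q\<close> takes the value \<open>\<bar>P(z)\<bar> ^ 2\<close> at
    each \<open>k\<close>-th root of unity \<open>z\<close>.\<close>
  define Q where "Q = P * pcompose P (Polynomial.monom 1 (k - 1))"
  have Q: "int_coeffs Q"
    unfolding Q_def by (intro int_coeffs_mult int_coeffs_pcompose int_coeffs_monom assms) auto
  have root: "(zeta k ^ j) ^ k = 1" for j
    by (simp only: zeta_power_power assms(1))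
  have cnj: "cnj (\<delta> j) = of_nat r * poly P (zeta k ^ (j * (k - 1)))" for j
  proof -
    have "cnj (poly P (zeta k ^ j)) = poly P (cnj (zeta k ^ j))" by (rule cnj_poly_int_coeffs[OF assms(4)])
    also have "cnj (zeta k ^ j) = zeta k ^ (j * (k - 1))"
      unfolding power_mult by (rule cnj_root_of_unity[OF assms(1) root])
    finally show ?thesis by (simp add: \<delta>_def)
  qed
  have prod: "\<delta> j * cnj (\<delta> j) = of_nat (r\<^sup>2) * poly Q (zeta k ^ j)" for j
    unfolding cnj by (simp add: \<delta>_def Q_def poly_pcompose poly_monom power_mult power2_eq_square)
  \<comment> \<open>The conjugate of \<open>\<delta> j\<close> is
    \<open>\<delta> (j * (k - 1))\<close>, hence the divisibility assumption covers it too.\<close>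
  have cop: "coprime (j * (k - 1)) k" if "coprime j k" for j
    using that assms(1) coprime_diff_one_left_nat[of k] by simp
  \<comment> \<open>The ratio \<open>4/9\<close> is the square of \<open>2/3\<close>: the bound 2
    against \<open>r >= 3\<close>. The exponent has to outweigh the number \<open>c\<close> of
    conjugates.\<close>
  obtain m0 where "(4/9::real) ^ m0 < 1 / (real c + 1)"
    using real_arch_pow_inv[of "1 / (real c + 1)" "4/9"] by auto
  define m where "m = Suc m0"
  have "(4/9::real) ^ m \<le> (4/9) ^ m0" unfolding m_def by simp
  hence "(4/9::real) ^ m < 1 / (real c + 1)" using \<open>(4/9::real) ^ m0 < 1 / (real c + 1)\<close> by linarith
  hence "(real c + 1) * 4 ^ m < 9 ^ m" by (simp add: power_divide field_simps)
  hence m: "real c * 4 ^ m < 9 ^ m" by (simp add: algebra_simps) (smt (verit) zero_less_power)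
  define W where "W = (\<Sum>j\<in>A. norm (\<delta> j) ^ (2 * m))"
  have W1: "complex_of_real W = (\<Sum>j\<in>A. (\<delta> j * cnj (\<delta> j)) ^ m)"
    unfolding W_def of_real_sum
    by (intro sum.cong refl) (simp add: power_mult flip: complex_norm_square)
  have "(\<Sum>j\<in>A. poly (Q ^ m) (zeta k ^ j)) \<in> \<int>"
    unfolding A_def by (intro sum_poly_zeta_int assms int_coeffs_power Q)
  then obtain z where z: "(\<Sum>j\<in>A. poly (Q ^ m) (zeta k ^ j)) = of_int z" by (auto elim: Ints_cases)
  have W2: "complex_of_real W = of_int (int r ^ (2 * m) * z)"
    unfolding W1 prod power_mult_distrib using z
    by (simp add: sum_distrib_left[symmetric] power_mult)
  have "ldvd (of_nat p ^ (2 * n * m)) (of_real W)"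
    unfolding W1
  proof (rule ldvd_sum)
    fix j assume "j \<in> A"
    hence j: "coprime j k" by (simp add: A_def)
    have "ldvd ((of_nat p ^ n * of_nat p ^ n) ^ m) ((\<delta> j * cnj (\<delta> j)) ^ m)"
      unfolding cnj unfolding \<delta>_def using j by (intro ldvd_power ldvd_mult div cop)
    thus "ldvd (of_nat p ^ (2 * n * m)) ((\<delta> j * cnj (\<delta> j)) ^ m)"
      by (simp add: power_mult[symmetric] power_add[symmetric] mult_2)
  qed
  hence "int p ^ (2 * n * m) dvd int r ^ (2 * m) * z"
    unfolding W2 by (rule ldvd_of_int_imp_dvd)
  moreover have "coprime (int p ^ (2 * n * m)) (int r ^ (2 * m))"
    using assms(3) by (simp add: coprime_commute)
  ultimately have "int p ^ (2 * n * m) dvd z" by (simp add: coprime_dvd_mult_right_iff)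
  then obtain w where w: "z = int p ^ (2 * n * m) * w" by blast
  have W3: "W = real r ^ (2 * m) * real p ^ (2 * n * m) * of_int w"
  proof -
    have "complex_of_real W = of_real (real r ^ (2 * m) * real p ^ (2 * n * m) * of_int w)"
      unfolding W2 w by simp
    thus ?thesis by (simp only: of_real_eq_iff)
  qed
  have "W \<le> (\<Sum>j\<in>A. (2 * real p ^ n) ^ (2 * m))"
    unfolding W_def \<delta>_def using bound by (intro sum_mono power_mono) (auto simp: A_def)
  also have "\<dots> = real c * 4 ^ m * real p ^ (2 * n * m)"
  proof -
    have "(2 * real p ^ n) ^ (2 * m) = (2 ^ 2) ^ m * real p ^ (n * (2 * m))"
      by (simp only: power_mult_distrib power_mult)
    thus ?thesis by (simp add: c_def mult_ac)
  qed
  finally have "W \<le> real c * 4 ^ m * real p ^ (2 * n * m)" .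
  moreover have "w \<le> 0"
  proof (rule ccontr)
    \<comment> \<open>A positive cofactor would make \<open>W\<close> at least
      \<open>9 ^ m * p ^ (2 * n * m)\<close>, beyond the upper bound.\<close>
    assume "\<not> w \<le> 0"
    hence w1: "1 \<le> real_of_int w" by simp
    have "(9::real) ^ m \<le> real r ^ (2 * m)"
      unfolding power_mult using assms(2) power_mono[of 3 "real r" 2] by (intro power_mono) auto
    hence "9 ^ m * real p ^ (2 * n * m) \<le> real r ^ (2 * m) * real p ^ (2 * n * m)"
      by (intro mult_right_mono) auto
    also have "\<dots> \<le> real r ^ (2 * m) * real p ^ (2 * n * m) * of_int w"
      using mult_left_mono[OF w1, of "real r ^ (2 * m) * real p ^ (2 * n * m)"] by simp
    also have "\<dots> = W" by (rule W3[symmetric])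
    also have "W \<le> real c * 4 ^ m * real p ^ (2 * n * m)" by fact
    finally have "(9::real) ^ m \<le> real c * 4 ^ m" by simp
    thus False using m by simp
  qed
  hence "W \<le> 0" unfolding W3 by (intro mult_nonneg_nonpos) auto
  moreover have "norm (\<delta> 1) ^ (2 * m) \<le> W"
    unfolding W_def by (rule member_le_sum[OF one_A]) auto
  ultimately have "norm (\<delta> 1) ^ (2 * m) = 0"
    by (metis order_antisym order_trans norm_ge_zero zero_le_power)
  hence "\<delta> 1 = 0" by simp
  thus ?thesis using assms(2) by (simp add: \<delta>_def)
qed

section \<open>Lower bounds for the valuation of Gauss sums\<close>

text \<open>The uniformizer \<open>1 - zeta p\<close> over \<open>p\<close>: its power
  \<open>p - 1\<close> is \<open>p\<close> up to a unit, and Stickelberger's digit sums count powers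
  of \<open>lam\<close>.\<close>

definition lam :: complex where "lam = 1 - zeta p"

lemma one_minus_zeta_power: "\<exists>y\<in>R. 1 - zeta p ^ j = lam * y"
  using power_diff_1_eq[of "zeta p" j]
  by (intro bexI[of _ "\<Sum>i<j. zeta p ^ i"]) (auto simp: lam_def algebra_simps)

lemma prod_one_minus_roots_of_unity:
  assumes "n > 0"
  shows "(\<Prod>t\<in>{t. t ^ n = (1::complex)} - {1}. 1 - t) = of_nat n"
proof -
  define A where "A = {t. t ^ n = (1::complex)}"
  have fin: "finite A" unfolding A_def using assms by (intro finite_roots_unity) auto
  define P where "P = (\<Prod>t\<in>A - {1}. [:- t, 1:])"
  define Q where "Q = (\<Sum>i<n. Polynomial.monom (1::complex) i)"
  have "[:-1, 1:] * P = [:-1, 1:] * Q"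
  proof (rule poly_eq_poly_eq_iff[THEN iffD1], rule ext)
    fix x
    have "poly ([:-1, 1:] * P) x = (\<Prod>t\<in>A. x - t)"
      using fin by (subst prod.remove[of A 1]) (auto simp: P_def A_def poly_prod algebra_simps)
    also have "\<dots> = x ^ n - 1" unfolding A_def by (rule prod_diff_roots_of_unity[OF assms])
    also have "\<dots> = poly ([:-1, 1:] * Q) x"
      by (simp add: Q_def poly_sum poly_monom power_diff_1_eq algebra_simps)
    finally show "poly ([:-1, 1:] * P) x = poly ([:-1, 1:] * Q) x" .
  qed
  moreover have "[:-1, 1:] \<noteq> (0 :: complex poly)" by simp
  ultimately have "P = Q" by (simp only: mult_cancel_left simp_thms)
  hence "poly P 1 = poly Q 1" by simp
  thus ?thesis by (simp add: P_def Q_def A_def poly_prod poly_sum poly_monom)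
qed

text \<open>The number \<open>p\<close> is the product of \<open>1 - t\<close> over the
  \<open>p\<close>-th roots \<open>t\<close> other than 1. Each \<open>1 - t\<close> divides
  \<open>lam\<close>, since \<open>zeta p\<close> is a power of \<open>t\<close>.\<close>

lemma lam_power: "\<exists>y\<in>R. lam ^ (p - 1) = of_nat p * y"
proof -
  define B where "B = {t. t ^ p = (1::complex)} - {1}"
  have "finite B" "card B = p - 1"
    unfolding B_def using finite_roots_unity[of p] card_roots_unity_eq[of p] p_gt_1 by auto
  have "\<exists>z\<in>R. lam = (1 - t) * z" if t: "t \<in> B" for t
  proof -
    obtain i where i: "i < p" "t = zeta p ^ i"
      using t root_of_unity_zeta[of p t] by (auto simp: B_def)
    have "i \<noteq> 0" using t i by (auto simp: B_def intro: ccontr)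
    hence "\<not> p dvd i" using i by (auto dest: dvd_imp_le)
    hence "coprime p i" by (rule prime_imp_coprime[OF prime_p])
    hence "coprime i p" by (simp only: coprime_commute)
    then obtain j where "[i * j = Suc 0] (mod p)" using cong_solve_coprime_nat by auto
    hence "zeta p ^ (i * j) = zeta p ^ (Suc 0)" by (intro power_cong_root[of _ p]) auto
    hence "t ^ j = zeta p" by (simp add: i power_mult)
    thus ?thesis
      using power_diff_1_eq[of t j] i
      by (intro bexI[of _ "\<Sum>m<j. t ^ m"]) (auto simp: lam_def algebra_simps)
  qed
  then obtain z where z: "\<And>t. t \<in> B \<Longrightarrow> z t \<in> R" "\<And>t. t \<in> B \<Longrightarrow> lam = (1 - t) * z t"
    by metis
  have "lam ^ (p - 1) = (\<Prod>t\<in>B. lam)" using \<open>card B = p - 1\<close> by simp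
  also have "\<dots> = (\<Prod>t\<in>B. (1 - t) * z t)" by (intro prod.cong z) auto
  also have "\<dots> = of_nat p * (\<Prod>t\<in>B. z t)"
    unfolding prod.distrib B_def by (subst prod_one_minus_roots_of_unity) auto
  finally show ?thesis using z by (intro bexI[of _ "\<Prod>t\<in>B. z t"] prod_R) auto
qed

lemma ldvd_lam_power:
  assumes "ldvd (lam ^ ((p - 1) * N)) x"
  shows "ldvd (of_nat p ^ N) x"
proof -
  obtain y where y: "y \<in> R" "lam ^ (p - 1) = of_nat p * y" using lam_power by blast
  have "lam ^ ((p - 1) * N) = of_nat p ^ N * y ^ N" by (simp only: power_mult y power_mult_distrib)
  with assms have "ldvd (of_nat p ^ N * y ^ N) x" by (simp only:)
  thus ?thesis by (rule ldvd_trans[OF _ power_R[OF y(1)]])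
qed

end

context finite_field_model
begin

lemma G_cong:
  assumes "[a = b] (mod (q - 1))"
  shows "G a = G b"
  unfolding G_def using assms by (intro sum.cong refl) (metis (mono_tags, lifting) U_def mem_Collect_eq power_cong_root)

lemma psi_frobenius:
  assumes "x \<in> F"
  shows "psi (x ^ p) = psi x"
proof -
  have "tr (x ^ p) = (\<Sum>i<f. x ^ (p ^ Suc i))"
    unfolding tr_def by (simp add: power_mult[symmetric] mult.commute)
  also have "\<dots> \<doteq> tr x"
  proof -
    obtain g where f: "f = Suc g" using f_pos by (cases f) auto
    have "(\<Sum>i<f. x ^ (p ^ Suc i)) = (\<Sum>i<g. x ^ (p ^ Suc i)) + x ^ q" unfolding f by simp
    also have "\<dots> \<doteq> (\<Sum>i<g. x ^ (p ^ Suc i)) + x"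
      using assms by (intro eqm_add eqm_refl F_D) auto
    also have "\<dots> = tr x"
    proof -
      have "tr x = (\<Sum>i<Suc g. x ^ (p ^ i))" unfolding tr_def f[symmetric] ..
      also have "\<dots> = x + (\<Sum>i<g. x ^ (p ^ Suc i))" by (subst sum.lessThan_Suc_shift) simp
      finally show ?thesis by simp
    qed
    finally show ?thesis .
  qed
  finally have "tr x \<doteq> tr (x ^ p)" by (rule eqm_sym)
  with trn(2)[OF assms] have "of_nat (trn x) \<doteq> tr (x ^ p)" by (rule eqm_trans)
  thus ?thesis using psi_eqI by (simp add: psi_def[of x])
qed

text \<open>The \<open>p\<close>-th power map permutes \<open>U\<close> and preserves the
  trace.\<close>

lemma G_frobenius: "G (p * a) = G a"
proof -
  have bij: "bij_betw (\<lambda>t. t ^ p) U U"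
  proof (rule bij_betwI[where g = "\<lambda>t. t ^ (p ^ (f - 1))"])
    fix t assume t: "t \<in> U"
    have "p ^ (f - 1) * p = q" "p * p ^ (f - 1) = q"
      using f_pos power_minus_mult[of f p] by (auto simp: mult.commute)
    moreover have "t ^ q = t" using t U_subset_T by (intro power_q_T) auto
    ultimately show "(t ^ p) ^ (p ^ (f - 1)) = t" "(t ^ (p ^ (f - 1))) ^ p = t"
      by (simp_all only: power_mult[symmetric])
  qed auto
  have "G a = (\<Sum>t\<in>U. (t ^ p) ^ a * psi (t ^ p))"
    unfolding G_def by (rule sum.reindex_bij_betw[OF bij, symmetric])
  also have "\<dots> = G (p * a)"
    unfolding G_def by (intro sum.cong) (simp_all add: psi_frobenius power_mult)
  finally show ?thesis ..
qed

text \<open>Substitute \<open>t = s * v\<close>, then rescale \<open>s\<close> by the representative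
  of \<open>1 + v\<close>; the coefficient is a Jacobi sum. Where \<open>1 + v\<close> is in
  \<open>M\<close> the additive character is 1, and a full sum of a nontrivial character remains,
  which is 0.\<close>

lemma G_mult:
  assumes "\<not> (q - 1) dvd (a + b)"
  shows "G a * G b = (\<Sum>v\<in>U. if 1 + v \<in> M then 0 else v ^ b * inverse (rep (1 + v)) ^ (a + b)) * G (a + b)"
proof -
  have "G a * G b = (\<Sum>s\<in>U. \<Sum>t\<in>U. (s ^ a * psi s) * (t ^ b * psi t))"
    unfolding G_def by (rule sum_product)
  also have "\<dots> = (\<Sum>s\<in>U. \<Sum>v\<in>U. v ^ b * (s ^ (a + b) * psi (s * (1 + v))))"
  proof (rule sum.cong)
    fix s assume s: "s \<in> U"
    have "(\<Sum>t\<in>U. (s ^ a * psi s) * (t ^ b * psi t)) = (\<Sum>v\<in>U. (s ^ a * psi s) * ((s * v) ^ b * psi (s * v)))"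
      by (rule sum_U_mult[OF s, symmetric])
    also have "\<dots> = (\<Sum>v\<in>U. v ^ b * (s ^ (a + b) * psi (s * (1 + v))))"
    proof (rule sum.cong)
      fix v assume v: "v \<in> U"
      have "psi (s * (1 + v)) = psi s * psi (s * v)"
        using psi_add[of s "s * v"] s v by (simp add: algebra_simps)
      thus "(s ^ a * psi s) * ((s * v) ^ b * psi (s * v)) = v ^ b * (s ^ (a + b) * psi (s * (1 + v)))"
        by (simp add: power_mult_distrib power_add)
    qed simp
    finally show "(\<Sum>t\<in>U. (s ^ a * psi s) * (t ^ b * psi t)) = (\<Sum>v\<in>U. v ^ b * (s ^ (a + b) * psi (s * (1 + v))))" .
  qed simp
  also have "\<dots> = (\<Sum>v\<in>U. v ^ b * (\<Sum>s\<in>U. s ^ (a + b) * psi (s * (1 + v))))"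
    unfolding sum_distrib_left by (rule sum.swap)
  also have "\<dots> = (\<Sum>v\<in>U. (if 1 + v \<in> M then 0 else v ^ b * inverse (rep (1 + v)) ^ (a + b)) * G (a + b))"
  proof (rule sum.cong)
    fix v assume v: "v \<in> U"
    have F: "1 + v \<in> F" using v by simp
    show "v ^ b * (\<Sum>s\<in>U. s ^ (a + b) * psi (s * (1 + v)))
        = (if 1 + v \<in> M then 0 else v ^ b * inverse (rep (1 + v)) ^ (a + b)) * G (a + b)"
    proof (cases "1 + v \<in> M")
      case True
      have "psi (s * (1 + v)) = psi 0" if "s \<in> U" for s
        using that True F by (intro psi_cong) (auto simp: eqm_0_iff)
      hence "(\<Sum>s\<in>U. s ^ (a + b) * psi (s * (1 + v))) = (\<Sum>s\<in>U. s ^ (a + b))" by simp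
      also have "\<dots> = 0" using sum_U_power[of "a + b"] assms by simp
      finally show ?thesis using True by simp
    next
      case False
      define w where "w = rep (1 + v)"
      have w: "w \<in> U" unfolding w_def using F False by (rule rep_U)
      have "psi (s * (1 + v)) = psi (w * s)" if s: "s \<in> U" for s
      proof (rule psi_cong)
        have "s * (1 + v) \<doteq> s * w" unfolding w_def using s F by (intro eqm_mult rep_eqm) auto
        thus "s * (1 + v) \<doteq> w * s" by (simp only: mult.commute)
      qed (use s F in simp)
      hence "(\<Sum>s\<in>U. s ^ (a + b) * psi (s * (1 + v)))
          = (\<Sum>s\<in>U. inverse w ^ (a + b) * ((w * s) ^ (a + b) * psi (w * s)))"
        using U_nonzero[OF w] by (intro sum.cong) (simp_all add: power_mult_distrib power_inverse)
      also have "\<dots> = inverse w ^ (a + b) * G (a + b)"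
        unfolding sum_distrib_left[symmetric] using sum_U_mult[OF w, of "\<lambda>s. s ^ (a + b) * psi s"]
        by (simp add: G_def)
      finally show ?thesis using False by (simp add: w_def mult.assoc)
    qed
  qed simp
  also have "\<dots> = (\<Sum>v\<in>U. if 1 + v \<in> M then 0 else v ^ b * inverse (rep (1 + v)) ^ (a + b)) * G (a + b)"
    by (simp only: sum_distrib_right)
  finally show ?thesis .
qed

text \<open>Modulo \<open>M\<close> the inverse power of \<open>rep (1 + v)\<close> becomes
  \<open>(1 + v) ^ Suc c\<close>, because the two exponents add up to \<open>2 * (q - 1)\<close>. In
  the binomial expansion only \<open>j = c\<close> survives the sum over \<open>U\<close> and leaves
  \<open>Suc c * (q - 1)\<close>, which is prime to \<open>p\<close>.\<close>

lemma jacobi_sum_notin_M: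
  assumes "0 < c" "Suc c < q - 1" "\<not> p dvd Suc c"
  shows "(\<Sum>v\<in>U. if 1 + v \<in> M then 0 else v ^ (q - 1 - c) * inverse (rep (1 + v)) ^ (q - 2 + (q - 1 - c))) \<in> R - M"
    (is "?J \<in> _")
proof -
  have summand: "(if 1 + v \<in> M then 0 else v ^ (q - 1 - c) * inverse (rep (1 + v)) ^ (q - 2 + (q - 1 - c)))
      \<doteq> v ^ (q - 1 - c) * (1 + v) ^ Suc c" if v: "v \<in> U" for v
  proof (cases "1 + v \<in> M")
    case True
    hence "(1 + v) ^ Suc c \<in> M" using v by simp
    hence "v ^ (q - 1 - c) * (1 + v) ^ Suc c \<in> M" using v by (intro mult_M) auto
    thus ?thesis using True eqm_sym by (simp add: eqm_0_iff)
  next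
    case False
    define w where "w = rep (1 + v)"
    have w: "w \<in> U" "1 + v \<doteq> w" unfolding w_def using v False by (auto intro: rep_U rep_eqm)
    have "w ^ (q - 2 + (q - 1 - c)) * w ^ Suc c = w ^ ((q - 1) * 2)"
      unfolding power_add[symmetric] using assms by (intro arg_cong[where f = "\<lambda>n. w ^ n"]) simp
    also have "\<dots> = 1" using w by (simp add: U_def power_mult)
    finally have "inverse w ^ (q - 2 + (q - 1 - c)) = w ^ Suc c"
      by (metis inverse_unique power_inverse)
    moreover have "v ^ (q - 1 - c) * w ^ Suc c \<doteq> v ^ (q - 1 - c) * (1 + v) ^ Suc c"
      using v w by (intro eqm_mult eqm_refl eqm_power eqm_sym[OF w(2)]) auto
    ultimately show ?thesis using False by (simp add: w_def del: power_Suc)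
  qed
  hence "?J \<doteq> (\<Sum>v\<in>U. v ^ (q - 1 - c) * (1 + v) ^ Suc c)" by (rule eqm_sum)
  also have "(\<Sum>v\<in>U. v ^ (q - 1 - c) * (1 + v) ^ Suc c)
      = (\<Sum>v\<in>U. \<Sum>j\<le>Suc c. of_nat (Suc c choose j) * v ^ (q - 1 - c + j))"
  proof (rule sum.cong)
    fix v :: complex
    have "(1 + v) ^ Suc c = (\<Sum>j\<le>Suc c. of_nat (Suc c choose j) * v ^ j)"
      using binomial_ring[of v 1 "Suc c"] by (simp add: add.commute del: power_Suc binomial_Suc_Suc)
    thus "v ^ (q - 1 - c) * (1 + v) ^ Suc c = (\<Sum>j\<le>Suc c. of_nat (Suc c choose j) * v ^ (q - 1 - c + j))"
      by (simp only: sum_distrib_left power_add mult_ac)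
  qed simp
  also have "\<dots> = (\<Sum>j\<le>Suc c. of_nat (Suc c choose j) * (\<Sum>v\<in>U. v ^ (q - 1 - c + j)))"
    unfolding sum_distrib_left by (rule sum.swap)
  also have "\<dots> = (\<Sum>j\<le>Suc c. if j = c then of_nat (Suc c * (q - 1)) else 0)"
  proof (rule sum.cong)
    fix j assume j: "j \<in> {..Suc c}"
    have "(q - 1) dvd (q - 1 - c + j) \<longleftrightarrow> j = c"
    proof
      assume d: "(q - 1) dvd (q - 1 - c + j)"
      then obtain m where m: "q - 1 - c + j = (q - 1) * m" by blast
      have "q - 1 - c + j < (q - 1) * 2" "q - 1 - c + j > 0" using j assms by auto
      hence "m < 2" "m > 0" unfolding m by auto
      hence "m = 1" by linarith
      thus "j = c" using m assms by simp
    qed (use assms in auto)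
    thus "of_nat (Suc c choose j) * (\<Sum>v\<in>U. v ^ (q - 1 - c + j)) = (if j = c then of_nat (Suc c * (q - 1)) else 0)"
      unfolding sum_U_power by (simp only: binomial_Suc_n of_nat_mult mult_zero_right if_True if_False split: if_splits) simp
  qed simp
  also have "\<dots> = of_nat (Suc c * (q - 1))" by simp
  finally have J: "?J \<doteq> of_nat (Suc c * (q - 1))" .
  have "\<not> p dvd q - 1"
  proof
    assume "p dvd q - 1"
    moreover have "p dvd q" using f_pos by (simp add: dvd_power)
    ultimately have "p dvd 1" using q_gt_1 by (metis dvd_diffD1 less_imp_le)
    thus False using p_gt_1 by simp
  qed
  hence "\<not> p dvd Suc c * (q - 1)" using assms(3) by (simp add: prime_dvd_mult_iff[OF prime_p] del: mult_Suc)
  hence "of_nat (Suc c * (q - 1)) \<notin> M" by (simp only: of_nat_in_M_iff not_False_eq_True)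
  thus ?thesis using J eqm_M_iff[OF J] eqm_R(1)[OF J] by blast
qed

text \<open>For \<open>q > 2\<close> the plain sum of \<open>t ^ (q - 2)\<close> is 0, so
  \<open>psi t\<close> may be replaced by \<open>psi t - 1\<close>, a multiple of
  \<open>lam\<close>.\<close>

lemma ldvd_G_pred:
  assumes "q > 2"
  shows "ldvd lam (G (q - 2))"
proof -
  have "\<forall>t. \<exists>y\<in>R. 1 - psi t = lam * y" using one_minus_zeta_power by (simp add: psi_def)
  then obtain y where y: "\<And>t. y t \<in> R" "\<And>t. 1 - psi t = lam * y t" by metis
  have "\<not> (q - 1) dvd (q - 2)" using assms by (auto dest: dvd_imp_le)
  hence 0: "(\<Sum>t\<in>U. t ^ (q - 2)) = 0" by (simp add: sum_U_power)
  have "G (q - 2) = (\<Sum>t\<in>U. t ^ (q - 2) - t ^ (q - 2) * (1 - psi t))"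
    unfolding G_def by (simp add: algebra_simps)
  also have "\<dots> = lam * (\<Sum>t\<in>U. - (t ^ (q - 2) * y t))"
    unfolding sum_subtractf 0 y by (simp add: sum_distrib_left sum_negf mult_ac)
  finally show ?thesis
    using y by (simp only:) (intro ldvd_multI sum_R, simp)
qed

text \<open>
  A nonzero last digit is lowered through the Jacobi sum of two Gauss sums, a zero last digit is
  removed by the Frobenius map.
\<close>

lemma stickelberger_lower_bound:
  assumes "b < q - 1"
  shows "ldvd (lam ^ digit_sum p f b) (G (q - 1 - b))"
  using assms
proof (induction b rule: less_induct)
  case (less b)
  consider "b = 0" | "b > 0" "p dvd b" | "b = 1" | c where "b = Suc c" "c > 0" "\<not> p dvd b"
    by (cases b) (metis One_nat_def neq0_conv zero_less_Suc)+
  thus ?case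
  proof cases
    case 1
    thus ?thesis by (simp add: ldvd_one)
  next
    case 2
    then obtain c where c: "b = p * c" by blast
    have "c > 0" "c < b" using 2 c p_gt_1 by auto
    hence cq: "c < q - 1" using less.prems by simp
    have ds: "digit_sum p f b = digit_sum p f c"
      unfolding c using less.prems c p_gt_1 by (intro digit_sum_mult) auto
    have "G (q - 1 - b) = G (p * (q - 1 - c))"
    proof (rule G_cong)
      have "q - 1 - b + b = q - 1" using less.prems by simp
      moreover have "p * (q - 1 - c) + b = p * (q - 1)"
        unfolding c add_mult_distrib2[symmetric] using cq by simp
      ultimately have "[q - 1 - b + b = p * (q - 1 - c) + b] (mod (q - 1))" by (simp add: cong_def)
      thus "[q - 1 - b = p * (q - 1 - c)] (mod (q - 1))" by (simp only: cong_add_rcancel_nat)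
    qed
    thus ?thesis using less.IH[OF \<open>c < b\<close> cq] ds by (simp add: G_frobenius)
  next
    \<comment> \<open>The Jacobi sum step needs \<open>c > 0\<close>, so \<open>b = 1\<close> is a
      base case of its own.\<close>
    case 3
    hence "q > 2" using less.prems by simp
    moreover have "digit_sum p f (Suc 0) = Suc (digit_sum p f 0)"
      using p_gt_1 f_pos by (intro digit_sum_Suc) auto
    ultimately show ?thesis using ldvd_G_pred 3 by (simp add: numeral_2_eq_2)
  next
    case 4
    define J where "J = (\<Sum>v\<in>U. if 1 + v \<in> M then 0 else v ^ (q - 1 - c) * inverse (rep (1 + v)) ^ (q - 2 + (q - 1 - c)))"
    have bq: "Suc c < q - 1" "q > 2" using less.prems 4 by auto
    have J: "J \<in> R - M" unfolding J_def using 4 bq by (intro jacobi_sum_notin_M) auto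
    have eq: "q - 2 + (q - 1 - c) = (q - 1) + (q - 1 - b)" using bq 4 by simp
    have ndvd: "\<not> (q - 1) dvd (q - 2 + (q - 1 - c))"
    proof
      assume "(q - 1) dvd (q - 2 + (q - 1 - c))"
      hence "(q - 1) dvd (q - 1 - b)" unfolding eq by (simp only: dvd_add_right_iff[OF dvd_refl])
      hence "q - 1 \<le> q - 1 - b" using less.prems by (intro dvd_imp_le) auto
      thus False using less.prems 4 by simp
    qed
    have G: "G (q - 2) * G (q - 1 - c) = J * G (q - 1 - b)"
    proof -
      have "G (q - 2 + (q - 1 - c)) = G (q - 1 - b)" unfolding eq by (rule G_cong) (simp add: cong_def)
      thus ?thesis using G_mult[OF ndvd] by (simp add: J_def)
    qed
    have "ldvd (lam * lam ^ digit_sum p f c) (G (q - 2) * G (q - 1 - c))"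
      using bq 4 by (intro ldvd_mult ldvd_G_pred less.IH) auto
    moreover have "digit_sum p f b = Suc (digit_sum p f c)"
      unfolding 4(1) using p_gt_1 f_pos 4 by (intro digit_sum_Suc) auto
    ultimately have "ldvd (lam ^ digit_sum p f b) (J * G (q - 1 - b))" unfolding G by simp
    thus ?thesis by (rule ldvd_cancel[OF J])
  qed
qed

end

section \<open>Prime ideals of cyclotomic rings\<close>

text \<open>Subrings as plain sets, so that the operations are those of the complex numbers and no
  ring record is carried along.\<close>

locale complex_subring =
  fixes A :: "complex set"
  assumes one_closed: "1 \<in> A"
    and add_closed: "x \<in> A \<Longrightarrow> y \<in> A \<Longrightarrow> x + y \<in> A"
    and uminus_closed: "x \<in> A \<Longrightarrow> - x \<in> A"
    and mult_closed: "x \<in> A \<Longrightarrow> y \<in> A \<Longrightarrow> x * y \<in> A"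
begin

lemma zero_closed: "0 \<in> A"
  using add_closed[OF one_closed uminus_closed[OF one_closed]] by simp

lemma diff_closed: "x \<in> A \<Longrightarrow> y \<in> A \<Longrightarrow> x - y \<in> A"
  using add_closed[of x "- y"] uminus_closed[of y] by simp

lemma power_closed: "x \<in> A \<Longrightarrow> x ^ n \<in> A"
  by (induction n) (auto intro: one_closed mult_closed)

lemma of_nat_closed: "of_nat n \<in> A"
  by (induction n) (auto intro: zero_closed one_closed add_closed)

lemma of_int_closed: "of_int n \<in> A"
  by (cases n) (auto simp del: of_nat_Suc intro: of_nat_closed uminus_closed)

lemma sum_closed: "(\<And>i. i \<in> I \<Longrightarrow> g i \<in> A) \<Longrightarrow> sum g I \<in> A"
  by (induction I rule: infinite_finite_induct) (auto intro: zero_closed add_closed)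

end

locale prime_ideal_in = complex_subring A for A +
  fixes P :: "complex set"
  assumes P_subset: "P \<subseteq> A"
    and P_zero: "0 \<in> P"
    and P_add: "x \<in> P \<Longrightarrow> y \<in> P \<Longrightarrow> x + y \<in> P"
    and P_mult: "x \<in> A \<Longrightarrow> y \<in> P \<Longrightarrow> x * y \<in> P"
    and P_one: "1 \<notin> P"
    and P_prime: "x \<in> A \<Longrightarrow> y \<in> A \<Longrightarrow> x * y \<in> P \<Longrightarrow> x \<in> P \<or> y \<in> P"

text \<open>
  Nakayama's argument, eliminating the generators of \<open>R\<close> one at a time, shows that
  the ideal generated by \<open>P\<close> in \<open>R\<close> does not meet \<open>A - P\<close>.
\<close>

lemma (in prime_ideal_in) lying_over:
  fixes g :: "nat \<Rightarrow> complex"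
  assumes R: "complex_subring R" and AR: "A \<subseteq> R"
    and g: "\<And>i. g i \<in> R"
    and span: "\<And>x. x \<in> R \<Longrightarrow> \<exists>a. (\<forall>i. a i \<in> A) \<and> x = (\<Sum>i<m. a i * g i)"
  shows "\<exists>M. prime_ideal_in R M \<and> M \<inter> A = P"
proof -
  interpret R: complex_subring R by fact
  define PR where "PR n = {x. \<exists>b. (\<forall>i. b i \<in> P) \<and> x = (\<Sum>i<n. b i * g i)}" for n :: nat
  have PR_mono_mult: "a * x \<in> PR n" if "a \<in> A" "x \<in> PR n" for a x n
  proof -
    from that obtain b where "\<forall>i. b i \<in> P" "x = (\<Sum>i<n. b i * g i)" by (auto simp: PR_def)
    thus ?thesis unfolding PR_def using P_mult[OF that(1)]
      by (intro CollectI exI[of _ "\<lambda>i. a * b i"]) (simp add: sum_distrib_left mult.assoc)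
  qed
  have PR_add: "x + y \<in> PR n" if "x \<in> PR n" "y \<in> PR n" for x y n
  proof -
    from that obtain b c where "\<forall>i. b i \<in> P" "x = (\<Sum>i<n. b i * g i)"
      "\<forall>i. c i \<in> P" "y = (\<Sum>i<n. c i * g i)" by (auto simp: PR_def)
    thus ?thesis unfolding PR_def using P_add
      by (intro CollectI exI[of _ "\<lambda>i. b i + c i"]) (simp add: sum.distrib distrib_right)
  qed
  have PR_0: "0 \<in> PR n" for n
    unfolding PR_def using P_zero by (intro CollectI exI[of _ "\<lambda>i. 0"]) simp
  have PR_sum: "sum h I \<in> PR n" if "\<And>i. i \<in> I \<Longrightarrow> h i \<in> PR n" for h :: "nat \<Rightarrow> complex" and I n
    using that by (induction I rule: infinite_finite_induct) (auto intro: PR_0 PR_add)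
  have PR_single: "b * x \<in> PR m" if b: "b \<in> P" and x: "x \<in> R" for b x
  proof -
    obtain a where a: "\<forall>i. a i \<in> A" "x = (\<Sum>i<m. a i * g i)" using span[OF x] by blast
    show ?thesis unfolding PR_def a(2) using a(1) P_mult b
      by (intro CollectI exI[of _ "\<lambda>i. a i * b"]) (simp add: sum_distrib_left mult_ac(1), simp add: mult_ac)
  qed
  have PR_mult: "y * x \<in> PR m" if y: "y \<in> R" and x: "x \<in> PR m" for x y
  proof -
    from x obtain b where b: "\<forall>i. b i \<in> P" "x = (\<Sum>i<m. b i * g i)" by (auto simp: PR_def)
    have "y * x = (\<Sum>i<m. b i * (y * g i))" unfolding b(2) by (simp add: sum_distrib_left mult_ac)
    also have "\<dots> \<in> PR m" using b(1) y g by (intro PR_sum PR_single R.mult_closed) auto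
    finally show ?thesis .
  qed
  have elim: False if "s \<in> A" "s \<notin> P" "\<And>x. x \<in> R \<Longrightarrow> s * x \<in> PR n" for s n
    using that
  proof (induction n arbitrary: s)
    case 0
    have "s * 1 \<in> PR 0" by (rule "0.prems"(3)) (rule R.one_closed)
    hence "s = 0" by (simp add: PR_def)
    thus False using "0.prems" P_zero by simp
  next
    case (Suc n)
    obtain b where b: "\<forall>i. b i \<in> P" "s * g n = (\<Sum>i<Suc n. b i * g i)"
      using Suc.prems(3)[OF g[of n]] by (auto simp: PR_def)
    \<comment> \<open>Subtracting the last coefficient removes \<open>g n\<close> from the
      right-hand side, so \<open>s'\<close> sends \<open>g n\<close> into \<open>PR n\<close>; it
      stays outside of \<open>P\<close> because \<open>b n\<close> is in \<open>P\<close>. Then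
      \<open>s' * s\<close> sends all of \<open>R\<close> into \<open>PR n\<close>.\<close>
    define s' where "s' = s - b n"
    have bA: "b n \<in> A" using b P_subset by auto
    have s'A: "s' \<in> A" unfolding s'_def using Suc.prems(1) bA by (rule diff_closed)
    have s'P: "s' \<notin> P"
    proof
      assume "s' \<in> P"
      hence "s' + b n \<in> P" using b P_add by blast
      thus False using Suc.prems by (simp add: s'_def)
    qed
    have gn: "s' * g n \<in> PR n"
      unfolding PR_def s'_def using b by (intro CollectI exI[of _ b]) (simp add: algebra_simps)
    show False
    proof (rule Suc.IH)
      show "s' * s \<in> A" using s'A Suc.prems(1) by (rule mult_closed)
      show "s' * s \<notin> P" using P_prime[OF s'A Suc.prems(1)] s'P Suc.prems(2) by blast
      fix x assume "x \<in> R"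
      then obtain c where c: "\<forall>i. c i \<in> P" "s * x = (\<Sum>i<Suc n. c i * g i)"
        using Suc.prems(3) by (auto simp: PR_def)
      have "(\<Sum>i<n. c i * g i) \<in> PR n" unfolding PR_def using c by blast
      hence "s' * (\<Sum>i<n. c i * g i) + c n * (s' * g n) \<in> PR n"
        using c P_subset by (intro PR_add PR_mono_mult[OF s'A] PR_mono_mult[OF _ gn]) auto
      also have "s' * (\<Sum>i<n. c i * g i) + c n * (s' * g n) = s' * s * x"
        unfolding mult.assoc c(2) by (simp add: algebra_simps)
      finally show "s' * s * x \<in> PR n" .
    qed
  qed
  \<comment> \<open>The ideals of \<open>R\<close> that contain \<open>P\<close> and meet
    \<open>A\<close> in nothing more. One that is maximal in this family turns out to be
    prime.\<close>
  define \<I> where "\<I> = {I. I \<subseteq> R \<and> P \<subseteq> I \<and> (\<forall>x\<in>I. \<forall>y\<in>I. x + y \<in> I) \<and>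
    (\<forall>x\<in>R. \<forall>y\<in>I. x * y \<in> I) \<and> I \<inter> A \<subseteq> P}"
  have "PR m \<in> \<I>"
    unfolding \<I>_def
  proof (intro CollectI conjI ballI)
    show "PR m \<subseteq> R"
      unfolding PR_def using P_subset AR g by (auto intro!: R.sum_closed R.mult_closed)
    show "P \<subseteq> PR m"
    proof
      fix b assume "b \<in> P"
      thus "b \<in> PR m" using PR_single[of b 1] R.one_closed by simp
    qed
    show "PR m \<inter> A \<subseteq> P"
    proof
      fix s assume s: "s \<in> PR m \<inter> A"
      show "s \<in> P"
      proof (rule ccontr)
        assume "s \<notin> P"
        thus False using elim[of s m] s PR_mult by (metis IntD1 IntD2 mult.commute)
      qed
    qed
  qed (use PR_add PR_mult in auto)
  have "\<exists>M\<in>\<I>. \<forall>Y\<in>\<I>. M \<subseteq> Y \<longrightarrow> Y = M"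
  proof (rule subset_Zorn_nonempty)
    show "\<I> \<noteq> {}" using \<open>PR m \<in> \<I>\<close> by blast
    fix C assume C: "C \<noteq> {}" "subset.chain \<I> C"
    have sub: "C \<subseteq> \<I>" using C(2) unfolding subset_chain_def by blast
    have tot: "I \<subseteq> J \<or> J \<subseteq> I" if "I \<in> C" "J \<in> C" for I J
      using C(2) that unfolding subset_chain_def by blast
    show "\<Union>C \<in> \<I>"
      unfolding \<I>_def
    proof (intro CollectI conjI ballI)
      fix x y assume "x \<in> \<Union>C" "y \<in> \<Union>C"
      then obtain I J where IJ: "I \<in> C" "J \<in> C" "x \<in> I" "y \<in> J" by blast
      then obtain K where "K \<in> C" "x \<in> K" "y \<in> K" using tot[of I J] by blast
      moreover from this have "x + y \<in> K" using sub unfolding \<I>_def by blast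
      ultimately show "x + y \<in> \<Union>C" by blast
    next
      fix x y assume x: "x \<in> R" and "y \<in> \<Union>C"
      then obtain K where K: "K \<in> C" "y \<in> K" by blast
      hence "x * y \<in> K" using sub x unfolding \<I>_def by blast
      thus "x * y \<in> \<Union>C" using K by blast
    next
      obtain K where "K \<in> C" using C(1) by blast
      thus "P \<subseteq> \<Union>C" using sub unfolding \<I>_def by blast
    qed (use sub in \<open>unfold \<I>_def, blast+\<close>)
  qed
  then obtain M where M: "M \<in> \<I>" and max: "\<And>Y. Y \<in> \<I> \<Longrightarrow> M \<subseteq> Y \<Longrightarrow> Y = M" by blast
  have MR: "M \<subseteq> R" and PM: "P \<subseteq> M" and M_add: "x \<in> M \<Longrightarrow> y \<in> M \<Longrightarrow> x + y \<in> M"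
    and M_mult: "r \<in> R \<Longrightarrow> y \<in> M \<Longrightarrow> r * y \<in> M" and MA: "M \<inter> A \<subseteq> P" for x y r
    using M unfolding \<I>_def by auto
  have MP: "M \<inter> A = P" using PM MA P_subset by blast
  have ext: "\<exists>m\<in>M. \<exists>r\<in>R. m + x * r \<in> A - P" if x: "x \<in> R" "x \<notin> M" for x
  proof -
    define Y where "Y = {m + x * r | m r. m \<in> M \<and> r \<in> R}"
    have MY: "M \<subseteq> Y"
    proof
      fix y assume "y \<in> M"
      thus "y \<in> Y" unfolding Y_def using R.zero_closed by (intro CollectI exI[of _ y] exI[of _ 0]) simp
    qed
    have "x \<in> Y"
      unfolding Y_def using P_zero PM R.one_closed by (intro CollectI exI[of _ 0] exI[of _ 1]) auto
    hence "Y \<noteq> M" using x by blast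
    hence "Y \<notin> \<I>" using max MY by blast
    moreover have "Y \<subseteq> R" unfolding Y_def using MR x by (auto intro: R.add_closed R.mult_closed)
    moreover have "P \<subseteq> Y" using MY PM by blast
    moreover have "u + v \<in> Y" if "u \<in> Y" "v \<in> Y" for u v
    proof -
      from that obtain m r m' r' where "m \<in> M" "r \<in> R" "u = m + x * r" "m' \<in> M" "r' \<in> R" "v = m' + x * r'"
        unfolding Y_def by blast
      thus ?thesis unfolding Y_def
        by (intro CollectI exI[of _ "m + m'"] exI[of _ "r + r'"])
           (simp add: M_add R.add_closed algebra_simps)
    qed
    moreover have "u * v \<in> Y" if "u \<in> R" "v \<in> Y" for u v
    proof -
      from \<open>v \<in> Y\<close> obtain m r where "m \<in> M" "r \<in> R" "v = m + x * r" unfolding Y_def by blast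
      hence "u * v = u * m + x * (u * r)" "u * m \<in> M" "u * r \<in> R"
        using \<open>u \<in> R\<close> by (simp_all add: M_mult R.mult_closed distrib_left mult.left_commute)
      thus ?thesis unfolding Y_def by blast
    qed
    ultimately have "\<not> Y \<inter> A \<subseteq> P" unfolding \<I>_def by blast
    thus ?thesis unfolding Y_def by blast
  qed
  have "prime_ideal_in R M"
  proof (unfold_locales)
    show "1 \<notin> M" using MA one_closed P_one by blast
    fix x y assume xy: "x \<in> R" "y \<in> R" "x * y \<in> M"
    show "x \<in> M \<or> y \<in> M"
    proof (rule ccontr)
      assume "\<not> (x \<in> M \<or> y \<in> M)"
      then obtain m r m' r' where 1: "m \<in> M" "r \<in> R" "m + x * r \<in> A - P"
        and 2: "m' \<in> M" "r' \<in> R" "m' + y * r' \<in> A - P"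
        using ext xy by blast
      \<comment> \<open>The product of two elements of \<open>A - P\<close> would be an element of
        \<open>M\<close> in \<open>A\<close>, hence of \<open>P\<close>, against the primality of
        \<open>P\<close>.\<close>
      have "(m' + y * r') * m + ((x * r) * m' + (r * r') * (x * y)) \<in> M"
        using 1(2) 2(1,2) xy(1,2) MR
        by (intro M_add M_mult[OF _ 1(1)] M_mult[OF _ 2(1)] M_mult[OF _ xy(3)] R.add_closed R.mult_closed) auto
      also have "(m' + y * r') * m + ((x * r) * m' + (r * r') * (x * y)) = (m + x * r) * (m' + y * r')"
        by (simp add: algebra_simps)
      finally have "(m + x * r) * (m' + y * r') \<in> M \<inter> A" using 1 2 mult_closed by auto
      thus False using MA P_prime 1 2 by blast
    qed
  qed (use MR PM P_zero M_add M_mult in auto)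
  thus ?thesis using MP by blast
qed

definition cyc :: "nat \<Rightarrow> complex set" where
  "cyc n = carrier (cyclotomic_ring n)"

lemma cyclotomic_ring_simps [simp]:
  "x \<otimes>\<^bsub>cyclotomic_ring n\<^esub> y = x * y" "x \<oplus>\<^bsub>cyclotomic_ring n\<^esub> y = x + y"
  "\<one>\<^bsub>cyclotomic_ring n\<^esub> = 1" "\<zero>\<^bsub>cyclotomic_ring n\<^esub> = 0"
  "carrier (cyclotomic_ring n) = cyc n"
  by (simp_all add: cyclotomic_ring_def ring_of_type_algebra_def cyc_def)

lemma a_inv_ring_of_type_algebra: "\<ominus>\<^bsub>ring_of_type_algebra\<^esub> x = - (x :: complex)"
proof -
  interpret ring "ring_of_type_algebra :: complex ring" by (rule ring_from_type_algebra)
  show ?thesis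
    by (rule minus_equality) (auto simp: ring_of_type_algebra_def)
qed

lemma cyc_eq_generate: "cyc n = generate_ring ring_of_type_algebra {zeta n}"
  by (simp add: cyc_def cyclotomic_ring_def)

lemma cyc_subring: "complex_subring (cyc n)"
proof
  show "1 \<in> cyc n"
    unfolding cyc_eq_generate using generate_ring.one[of "ring_of_type_algebra :: complex ring" "{zeta n}"]
    by (simp add: ring_of_type_algebra_def)
  fix x y assume xy: "x \<in> cyc n" "y \<in> cyc n"
  show "x + y \<in> cyc n"
    using generate_ring.eng_add[OF xy[unfolded cyc_eq_generate]]
    unfolding cyc_eq_generate by (simp add: ring_of_type_algebra_def)
  show "x * y \<in> cyc n"
    using generate_ring.eng_mult[OF xy[unfolded cyc_eq_generate]]
    unfolding cyc_eq_generate by (simp add: ring_of_type_algebra_def)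
next
  fix x assume "x \<in> cyc n"
  thus "- x \<in> cyc n"
    unfolding cyc_eq_generate using generate_ring.a_inv by (metis a_inv_ring_of_type_algebra)
qed

lemma zeta_cyc: "zeta n \<in> cyc n"
  unfolding cyc_eq_generate by (rule generate_ring.incl) simp

lemma cyc_least:
  assumes "complex_subring B" "zeta n \<in> B"
  shows "cyc n \<subseteq> B"
proof
  interpret complex_subring B by fact
  fix x assume "x \<in> cyc n"
  thus "x \<in> B" unfolding cyc_eq_generate
  proof (induction rule: generate_ring.induct)
    case (a_inv h)
    thus ?case by (simp only: a_inv_ring_of_type_algebra uminus_closed)
  qed (use assms(2) one_closed add_closed mult_closed in \<open>auto simp: ring_of_type_algebra_def\<close>)
qed

lemma cyc_mono:
  assumes "m > 0" "n dvd m" "n > 0"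
  shows "cyc n \<subseteq> cyc m"
proof (rule cyc_least[OF cyc_subring])
  obtain d where d: "m = d * n" using assms(2) by (metis dvdE mult.commute)
  hence "d > 0" using assms(1) by (cases d) auto
  hence "zeta n = zeta m ^ d" unfolding d by (rule zeta_mult_power[symmetric])
  thus "zeta n \<in> cyc m" using complex_subring.power_closed[OF cyc_subring zeta_cyc] by simp
qed

lemma root_of_unity_cyc: "n > 0 \<Longrightarrow> t ^ n = 1 \<Longrightarrow> t \<in> cyc n"
  using root_of_unity_zeta complex_subring.power_closed[OF cyc_subring zeta_cyc] by metis

text \<open>Exponents are reduced modulo \<open>n\<close>. The powers are generators but in general
  no basis, and finitely many generators are all that Nakayama's argument asks for.\<close>

lemma cyc_span:
  assumes "n > 0" "x \<in> cyc n"
  shows "\<exists>a. (\<forall>i. a i \<in> \<int>) \<and> x = (\<Sum>i<n. a i * zeta n ^ i)"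
proof -
  define B where "B = {poly P (zeta n) | P. int_coeffs P}"
  have "cyc n \<subseteq> B"
  proof (rule cyc_least)
    show "complex_subring B"
    proof
      show "1 \<in> B" unfolding B_def
        by (intro CollectI exI[of _ "[:1:]"]) (simp add: int_coeffs_const)
      fix x y assume "x \<in> B" "y \<in> B"
      then obtain P Q where "int_coeffs P" "int_coeffs Q" "x = poly P (zeta n)" "y = poly Q (zeta n)"
        unfolding B_def by blast
      thus "x + y \<in> B" "x * y \<in> B" unfolding B_def
        by (metis (mono_tags, lifting) CollectI int_coeffs_add int_coeffs_mult Polynomial.poly_add poly_mult)+
    next
      fix x assume "x \<in> B"
      then obtain P where "int_coeffs P" "x = poly P (zeta n)" unfolding B_def by blast
      thus "- x \<in> B" unfolding B_def
        by (metis (mono_tags, lifting) CollectI int_coeffs_uminus Polynomial.poly_minus)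
    qed
    show "zeta n \<in> B" unfolding B_def
      by (intro CollectI exI[of _ "Polynomial.monom 1 1"]) (simp add: int_coeffs_monom poly_monom)
  qed
  with assms(2) obtain P where P: "int_coeffs P" "x = poly P (zeta n)" unfolding B_def by blast
  define D where "D = {..Polynomial.degree P}"
  have "x = (\<Sum>j\<in>D. poly.coeff P j * zeta n ^ j)" unfolding P(2) poly_altdef D_def ..
  also have "\<dots> = (\<Sum>i<n. \<Sum>j\<in>{j\<in>D. j mod n = i}. poly.coeff P j * zeta n ^ j)"
    using assms(1) by (intro sum.group[symmetric]) (auto simp: D_def)
  also have "\<dots> = (\<Sum>i<n. (\<Sum>j\<in>{j\<in>D. j mod n = i}. poly.coeff P j) * zeta n ^ i)"
    unfolding sum_distrib_right
    using power_mod_root[OF zeta_power_self[OF assms(1)]] by (intro sum.cong refl) auto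
  finally have "x = (\<Sum>i<n. (\<Sum>j\<in>{j\<in>D. j mod n = i}. poly.coeff P j) * zeta n ^ i)" .
  moreover have "\<forall>i. (\<Sum>j\<in>{j\<in>D. j mod n = i}. poly.coeff P j) \<in> \<int>"
    using P(1) by (intro allI Ints_sum) (simp add: int_coeffs_def)
  ultimately show ?thesis by (intro exI conjI)
qed

lemma prime_over_prime_ideal_in:
  assumes "prime_over n p P"
  shows "prime_ideal_in (cyc n) P" "of_nat p \<in> P"
proof -
  have pr: "primeideal P (cyclotomic_ring n)" and Z: "P \<inter> \<int> = (\<lambda>a::int. of_int (int p * a)) ` UNIV"
    using assms by (auto simp: prime_over_def)
  interpret primeideal P "cyclotomic_ring n" by (rule pr)
  interpret C: complex_subring "cyc n" by (rule cyc_subring)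
  show "prime_ideal_in (cyc n) P"
  proof (unfold_locales)
    show "P \<subseteq> cyc n" using a_subset by simp
    show "0 \<in> P" using additive_subgroup.zero_closed[OF is_additive_subgroup] by simp
    show "1 \<notin> P"
    proof
      assume "1 \<in> P"
      hence "cyc n \<subseteq> P" using I_l_closed[of 1] by auto
      thus False using I_notcarr a_subset by auto
    qed
    fix x y
    show "x \<in> P \<Longrightarrow> y \<in> P \<Longrightarrow> x + y \<in> P" using additive_subgroup.a_closed[OF is_additive_subgroup, of x y] by simp
    show "x \<in> cyc n \<Longrightarrow> y \<in> P \<Longrightarrow> x * y \<in> P" using I_l_closed[of y x] by simp
    show "x \<in> cyc n \<Longrightarrow> y \<in> cyc n \<Longrightarrow> x * y \<in> P \<Longrightarrow> x \<in> P \<or> y \<in> P" using I_prime[of x y] by simp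
  qed
  have "of_int (int p * 1) \<in> P \<inter> \<int>" unfolding Z by blast
  thus "of_nat p \<in> P" by simp
qed

section \<open>Gauss sums over residue fields\<close>

lemma (in complex_subring) coeffs_synthetic_div:
  assumes "\<And>i. poly.coeff P i \<in> A" "c \<in> A"
  shows "poly.coeff (synthetic_div P c) i \<in> A"
  using assms(1)
proof (induction P arbitrary: i)
  case (pCons a P)
  have coeffs: "poly.coeff P i \<in> A" for i using pCons.prems[of "Suc i"] by simp
  have "poly P c \<in> A"
    unfolding poly_altdef using coeffs assms(2) by (intro sum_closed mult_closed power_closed) auto
  moreover have "poly.coeff (synthetic_div P c) j \<in> A" for j using coeffs by (rule pCons.IH)
  ultimately show ?case
    by (cases i) (simp_all only: synthetic_div_pCons coeff_pCons_0 coeff_pCons_Suc)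
qed (simp add: zero_closed)

context residue_model
begin

lemma complex_subring_R: "complex_subring R"
  by unfold_locales auto

text \<open>A nonzero polynomial over the domain \<open>R / M\<close> has no more roots than its
  degree; the roots are split off by synthetic division.\<close>

lemma coeffs_in_M_of_roots:
  assumes "finite Z" "Z \<subseteq> R" "\<And>x y. x \<in> Z \<Longrightarrow> y \<in> Z \<Longrightarrow> x \<doteq> y \<Longrightarrow> x = y"
    and "\<And>i. poly.coeff P i \<in> R" "Polynomial.degree P < card Z"
    and "\<And>x. x \<in> Z \<Longrightarrow> poly P x \<in> M"
  shows "poly.coeff P i \<in> M"
  using assms
proof (induction Z arbitrary: P i rule: finite_induct)
  case (insert a Z)
  interpret R: complex_subring R by (rule complex_subring_R)
  define Q where "Q = synthetic_div P a"
  have a: "a \<in> R" using insert.prems by auto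
  have P: "P = [:- a, 1:] * Q + [:poly P a:]"
    unfolding Q_def by (rule synthetic_div_correct'[symmetric])
  have Pa: "poly P a \<in> M" using insert.prems by auto
  have Qcoeff: "poly.coeff Q j \<in> M" for j
  \<comment> \<open>For a constant \<open>P\<close> and empty \<open>Z\<close> the degree bound of
    the induction hypothesis fails for \<open>Q = 0\<close>, so this case is separate.\<close>
  proof (cases "Polynomial.degree P = 0")
    case True
    hence "Q = 0" unfolding Q_def by (simp add: synthetic_div_eq_0_iff)
    thus ?thesis by simp
  next
    case False
    show ?thesis
    proof (rule insert.IH)
      show "Z \<subseteq> R" using insert.prems by auto
      show "x = y" if "x \<in> Z" "y \<in> Z" "x \<doteq> y" for x y using insert.prems(2)[of x y] that by auto
      show "poly.coeff Q i \<in> R" for i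
        unfolding Q_def using insert.prems(3) a by (rule R.coeffs_synthetic_div)
      show "Polynomial.degree Q < card Z"
        using insert.prems(4) insert.hyps False unfolding Q_def degree_synthetic_div by simp
      fix x assume x: "x \<in> Z"
      have xR: "x \<in> R" using x insert.prems by auto
      have "poly P x = (x - a) * poly Q x + poly P a"
        by (subst P) (simp add: algebra_simps)
      hence "(x - a) * poly Q x = poly P x - poly P a" by simp
      also have "\<dots> \<in> M" using insert.prems(5) x by (intro diff_M) auto
      finally have "(x - a) * poly Q x \<in> M" .
      moreover have "poly Q x \<in> R"
        unfolding poly_altdef using xR R.coeffs_synthetic_div[of P a] insert.prems(3) a
        by (intro sum_R mult_R power_R) (simp_all add: Q_def)
      moreover have "x - a \<notin> M"
        using insert.prems(2)[of x a] x insert.hyps xR a by (auto simp: eqm_def)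
      ultimately show "poly Q x \<in> M" using prime_M[of "x - a" "poly Q x"] xR a by auto
    qed
  qed
  show ?case
  proof (cases i)
    case 0
    have "poly.coeff P 0 = - a * poly.coeff Q 0 + poly P a" by (subst P) simp
    also have "\<dots> \<in> M" using Qcoeff Pa a by (intro add_M mult_M) auto
    finally show ?thesis using 0 by simp
  next
    case (Suc j)
    have "poly.coeff P (Suc j) = - a * poly.coeff Q (Suc j) + poly.coeff Q j" by (subst P) simp
    also have "\<dots> \<in> M" using Qcoeff a by (intro add_M mult_M) auto
    finally show ?thesis using Suc by simp
  qed
qed simp

end

context finite_field_model
begin

lemma ord_properties:
  assumes "n > 0" "ord n p = f"
  shows "coprime n p" "n dvd q - 1" "zeta n \<in> U"
proof -
  show "coprime n p" using assms(2) f_pos by (metis ord_gt_0_iff)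
  have "[q = 1] (mod n)" using assms(2) ord_divides[of p f n] by simp
  thus dvd: "n dvd q - 1" using q_gt_1 by (metis cong_altdef_nat cong_sym less_imp_le)
  show "zeta n \<in> U" unfolding U_def using dvd zeta_power_eq_1_iff[OF assms(1)] by simp
qed

lemma cyc_subset_F:
  assumes "n > 0" "ord n p = f"
  shows "cyc n \<subseteq> F"
  by (rule cyc_least) (unfold_locales, use ord_properties[OF assms] in auto)

text \<open>The residue field of \<open>cyc n\<close> has all \<open>q\<close> elements: as
  \<open>ord n p = f\<close>, the powers \<open>zeta n ^ (p ^ j)\<close> for \<open>j < f\<close>
  are different, so no nonzero polynomial of degree below \<open>f\<close> over the prime field
  kills \<open>zeta n\<close>. Hence the \<open>p ^ f\<close> combinations \<open>val c\<close> are
  incongruent and exhaust \<open>T\<close>.\<close>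

lemma ex_cyc_eqm:
  assumes n: "n > 0" "ord n p = f" and t: "t \<in> T"
  shows "\<exists>\<alpha>\<in>cyc n. \<alpha> \<doteq> t"
proof -
  interpret C: complex_subring "cyc n" by (rule cyc_subring)
  define C where "C = {..<f} \<rightarrow>\<^sub>E {..<p}"
  define val where "val c = (\<Sum>i<f. of_nat (c i) * zeta n ^ i)" for c :: "nat \<Rightarrow> nat"
  have zU: "zeta n \<in> U" by (rule ord_properties[OF n])
  have val_cyc: "val c \<in> cyc n" for c
    unfolding val_def by (intro C.sum_closed C.mult_closed C.power_closed C.of_nat_closed zeta_cyc)
  hence val_F: "val c \<in> F" for c using cyc_subset_F[OF n] by blast
  define Z where "Z = (\<lambda>j. zeta n ^ (p ^ j)) ` {..<f}"
  have ZU: "Z \<subseteq> U" unfolding Z_def using zU by auto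
  have inj: "inj_on (\<lambda>j. zeta n ^ (p ^ j)) {..<f}"
  proof (rule linorder_inj_onI)
    fix a b assume ab: "a < b" "a \<in> {..<f}" "b \<in> {..<f}"
    show "zeta n ^ (p ^ a) \<noteq> zeta n ^ (p ^ b)"
    proof
      assume eq: "zeta n ^ (p ^ a) = zeta n ^ (p ^ b)"
      have le: "p ^ a \<le> p ^ b" using ab p_gt_1 by simp
      have "zeta n ^ (p ^ a) * zeta n ^ (p ^ b - p ^ a) = zeta n ^ (p ^ b)"
        using le by (simp add: power_add[symmetric])
      also have "\<dots> = zeta n ^ (p ^ a)" by (rule eq[symmetric])
      finally have "zeta n ^ (p ^ a) * zeta n ^ (p ^ b - p ^ a) = zeta n ^ (p ^ a)" .
      hence "zeta n ^ (p ^ b - p ^ a) = 1" by simp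
      hence "n dvd p ^ b - p ^ a" by (simp only: zeta_power_eq_1_iff[OF n(1)])
      also have "p ^ b - p ^ a = p ^ a * (p ^ (b - a) - 1)"
        using ab by (simp add: diff_mult_distrib2 power_add[symmetric])
      finally have "n dvd p ^ (b - a) - 1"
        using ord_properties(1)[OF n] by (simp add: coprime_dvd_mult_right_iff)
      hence "[p ^ (b - a) = 1] (mod n)"
        using p_gt_1 by (metis cong_altdef_nat cong_sym one_le_power less_imp_le)
      hence "f dvd b - a" using ord_divides[of p "b - a" n] n(2) by simp
      thus False using ab by (auto dest: dvd_imp_le)
    qed
  qed auto
  have inj_val: "inj_on (\<lambda>c. rep (val c)) C"
  proof (rule inj_onI)
    fix c d assume cd: "c \<in> C" "d \<in> C" "rep (val c) = rep (val d)"
    define P where "P = (\<Sum>i<f. Polynomial.monom (of_nat (c i) - of_nat (d i) :: complex) i)"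
    have coeff: "poly.coeff P i = (if i < f then of_nat (c i) - of_nat (d i) else 0)" for i
      unfolding P_def Polynomial.coeff_sum by (simp add: sum.delta)
    have poly_P: "poly P x = (\<Sum>i<f. (of_nat (c i) - of_nat (d i)) * x ^ i)" for x
      unfolding P_def by (simp add: poly_sum poly_monom)
    have "val c \<doteq> val d" using cd(3) val_F by (simp add: rep_eq_iff)
    hence root: "poly P (zeta n) \<in> M"
      unfolding poly_P eqm_def val_def by (simp add: left_diff_distrib sum_subtractf)
    have "poly.coeff P i \<in> M" for i
    proof (rule coeffs_in_M_of_roots[where Z = Z])
      show "finite Z" by (simp add: Z_def)
      show "Z \<subseteq> R" using ZU by auto
      show "x = y" if "x \<in> Z" "y \<in> Z" "x \<doteq> y" for x y
        using that ZU U_subset_T T_eqI[of x y] by blast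
      show "poly.coeff P j \<in> R" for j unfolding coeff by simp
      have "Polynomial.degree P < f"
        using f_pos by (intro degree_lessI) (auto simp: coeff)
      thus "Polynomial.degree P < card Z" unfolding Z_def by (simp add: card_image[OF inj])
      fix x assume "x \<in> Z"
      then obtain j where x: "x = zeta n ^ (p ^ j)" unfolding Z_def by auto
      \<comment> \<open>Frobenius fixes the integer coefficients modulo \<open>M\<close>, so it
        moves the root \<open>zeta n\<close> to the root \<open>x\<close>.\<close>
      have "poly P (zeta n) ^ (p ^ j) \<doteq> (\<Sum>i<f. ((of_nat (c i) - of_nat (d i)) * zeta n ^ i) ^ (p ^ j))"
        unfolding poly_P using zU by (intro frobenius_power_sum) auto
      also have "\<dots> \<doteq> (\<Sum>i<f. (of_nat (c i) - of_nat (d i)) * x ^ i)"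
      proof (rule eqm_sum)
        fix i
        have "(of_nat (c i) - of_nat (d i)) ^ (p ^ j) \<doteq> of_nat (c i) ^ (p ^ j) + (- of_nat (d i)) ^ (p ^ j)"
          using frobenius_power_add[of "of_nat (c i)" "- of_nat (d i)" j] by simp
        also have "\<dots> \<doteq> of_nat (c i) + - (of_nat (d i) ^ (p ^ j))"
          by (intro eqm_add frobenius_power_of_nat frobenius_power_uminus) simp
        also have "\<dots> \<doteq> of_nat (c i) + - of_nat (d i)"
          by (intro eqm_add eqm_refl eqm_uminus frobenius_power_of_nat) simp
        finally have "(of_nat (c i) - of_nat (d i)) ^ (p ^ j) * (zeta n ^ i) ^ (p ^ j)
            \<doteq> (of_nat (c i) - of_nat (d i)) * (zeta n ^ i) ^ (p ^ j)"
          using zU by (intro eqm_mult eqm_refl) auto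
        moreover have "(zeta n ^ i) ^ (p ^ j) = x ^ i"
          unfolding x power_mult[symmetric] by (simp only: mult.commute)
        ultimately show "((of_nat (c i) - of_nat (d i)) * zeta n ^ i) ^ (p ^ j) \<doteq> (of_nat (c i) - of_nat (d i)) * x ^ i"
          by (simp only: power_mult_distrib)
      qed
      also have "\<dots> = poly P x" unfolding poly_P ..
      finally have eq: "poly P (zeta n) ^ (p ^ j) \<doteq> poly P x" .
      obtain m where "p ^ j = Suc m" using p_pos by (metis gr0_conv_Suc zero_less_power)
      hence "poly P (zeta n) ^ (p ^ j) \<in> M" using root by simp
      thus "poly P x \<in> M" using eqm_M_iff[OF eq] by blast
    qed
    have "c i = d i" if i: "i < f" for i
    proof -
      have "of_nat (c i) - of_nat (d i) \<in> M" using \<open>poly.coeff P i \<in> M\<close> i by (simp add: coeff)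
      hence "of_nat (c i) \<doteq> of_nat (d i)" by (simp add: eqm_def)
      moreover have "c i < p" "d i < p" using cd i by (auto simp: C_def)
      ultimately show ?thesis by (simp add: eqm_of_nat_iff cong_def)
    qed
    thus "c = d" using cd unfolding C_def by (intro PiE_ext) auto
  qed
  have "card C = q" unfolding C_def by (simp add: card_PiE)
  hence "card ((\<lambda>c. rep (val c)) ` C) = card T" by (simp add: card_image[OF inj_val] card_T)
  moreover have "(\<lambda>c. rep (val c)) ` C \<subseteq> T" using rep_T[OF val_F] by blast
  ultimately have "(\<lambda>c. rep (val c)) ` C = T" by (intro card_subset_eq) auto
  then obtain c where "t = rep (val c)" using t by blast
  thus ?thesis using val_cyc rep_eqm[OF val_F] by blast
qed

text \<open>The bridge from the quotient ring to the model: the nonzero cosets of \<open>P\<close>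
  are parametrized by \<open>U\<close>, and in this parametrization the Teichmueller character is
  the power \<open>(q - 1) div n\<close> and the additive character is \<open>psi\<close>.\<close>

lemma gauss_sum_eq_G:
  assumes n: "n > 0" "ord n p = f"
    and P: "ideal P (cyclotomic_ring n)" "P = M \<inter> cyc n"
  shows "gauss_sum p f (cyclotomic_ring n Quot P) (teichmueller n q P) = G ((q - 1) div n)"
proof -
  let ?C = "cyclotomic_ring n" and ?K = "cyclotomic_ring n Quot P"
  interpret ideal P ?C by (rule P(1))
  interpret C: complex_subring "cyc n" by (rule cyc_subring)
  interpret h: ring_hom_ring ?C ?K "\<lambda>x. P +>\<^bsub>?C\<^esub> x"
    using rcos_ring_hom_ring by simp
  have CF: "\<alpha> \<in> F" if "\<alpha> \<in> cyc n" for \<alpha> using cyc_subset_F[OF n] that by blast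
  have coset: "P +>\<^bsub>?C\<^esub> \<alpha> = {\<beta> \<in> cyc n. \<beta> \<doteq> \<alpha>}" if \<alpha>: "\<alpha> \<in> cyc n" for \<alpha>
  proof -
    have "P +>\<^bsub>?C\<^esub> \<alpha> = {m + \<alpha> | m. m \<in> P}" by (auto simp: a_r_coset_def')
    also have "\<dots> = {\<beta> \<in> cyc n. \<beta> \<doteq> \<alpha>}"
    proof (intro equalityI subsetI)
      fix \<beta> assume "\<beta> \<in> {m + \<alpha> | m. m \<in> P}"
      thus "\<beta> \<in> {\<beta> \<in> cyc n. \<beta> \<doteq> \<alpha>}" using \<alpha> CF P(2) by (auto simp: eqm_def C.add_closed)
    next
      fix \<beta> assume "\<beta> \<in> {\<beta> \<in> cyc n. \<beta> \<doteq> \<alpha>}"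
      hence "\<beta> = (\<beta> - \<alpha>) + \<alpha>" "\<beta> - \<alpha> \<in> P" using \<alpha> P(2) by (auto simp: eqm_def C.diff_closed)
      thus "\<beta> \<in> {m + \<alpha> | m. m \<in> P}" by blast
    qed
    finally show ?thesis .
  qed
  have coset_eq: "P +>\<^bsub>?C\<^esub> \<alpha> = P +>\<^bsub>?C\<^esub> \<beta> \<longleftrightarrow> \<alpha> \<doteq> \<beta>" if "\<alpha> \<in> cyc n" "\<beta> \<in> cyc n" for \<alpha> \<beta>
  proof
    assume "P +>\<^bsub>?C\<^esub> \<alpha> = P +>\<^bsub>?C\<^esub> \<beta>"
    moreover have "\<alpha> \<in> P +>\<^bsub>?C\<^esub> \<alpha>" using that CF by (simp add: coset)
    ultimately show "\<alpha> \<doteq> \<beta>" using that by (simp add: coset)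
  next
    assume "\<alpha> \<doteq> \<beta>"
    thus "P +>\<^bsub>?C\<^esub> \<alpha> = P +>\<^bsub>?C\<^esub> \<beta>"
      using that eqm_trans[of _ \<alpha> \<beta>] eqm_trans[of _ \<beta> \<alpha>] eqm_sym[of \<alpha> \<beta>] by (auto simp: coset)
  qed
  have zero: "P = P +>\<^bsub>?C\<^esub> 0"
    unfolding coset[OF C.zero_closed] using P(2) by (auto simp: eqm_0_iff)
  have K_carrier: "carrier ?K = (\<lambda>\<alpha>. P +>\<^bsub>?C\<^esub> \<alpha>) ` cyc n"
    by (auto simp: FactRing_def A_RCOSETS_def')
  have K_zero: "\<zero>\<^bsub>?K\<^esub> = P" by (simp add: FactRing_def)
  \<comment> \<open>An element \<open>t\<close> of \<open>U\<close> need not lie in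
    \<open>cyc n\<close>; \<open>s t\<close> is a congruent element that does.\<close>
  define s where "s t = (SOME \<alpha>. \<alpha> \<in> cyc n \<and> \<alpha> \<doteq> t)" for t
  have s: "s t \<in> cyc n" "s t \<doteq> t" if "t \<in> T" for t
    unfolding s_def using someI_ex[of "\<lambda>\<alpha>. \<alpha> \<in> cyc n \<and> \<alpha> \<doteq> t"] ex_cyc_eqm[OF n that] by blast+
  have sU: "s t \<in> cyc n" "s t \<doteq> t" if "t \<in> U" for t using s that U_subset_T by blast+
  have bij: "bij_betw (\<lambda>t. P +>\<^bsub>?C\<^esub> s t) U (carrier ?K - {\<zero>\<^bsub>?K\<^esub>})"
  proof (rule bij_betw_imageI)
    show "inj_on (\<lambda>t. P +>\<^bsub>?C\<^esub> s t) U"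
    proof (rule inj_onI)
      fix t u assume tu: "t \<in> U" "u \<in> U" "P +>\<^bsub>?C\<^esub> s t = P +>\<^bsub>?C\<^esub> s u"
      hence "s t \<doteq> s u" using sU by (simp add: coset_eq)
      hence "t \<doteq> u" using eqm_trans[OF eqm_sym[OF sU(2)[OF tu(1)]]] eqm_trans[OF _ sU(2)[OF tu(2)]] by blast
      thus "t = u" using tu U_subset_T by (intro T_eqI) auto
    qed
    show "(\<lambda>t. P +>\<^bsub>?C\<^esub> s t) ` U = carrier ?K - {\<zero>\<^bsub>?K\<^esub>}"
    proof (intro equalityI subsetI)
      fix c assume "c \<in> (\<lambda>t. P +>\<^bsub>?C\<^esub> s t) ` U"
      then obtain t where t: "t \<in> U" "c = P +>\<^bsub>?C\<^esub> s t" by blast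
      have "s t \<notin> M" using eqm_M_iff[OF sU(2)[OF t(1)]] U_notin_M[OF t(1)] by simp
      hence "c \<noteq> P" using t sU C.zero_closed by (subst zero) (simp add: coset_eq eqm_0_iff)
      thus "c \<in> carrier ?K - {\<zero>\<^bsub>?K\<^esub>}" unfolding K_carrier K_zero using t sU by blast
    next
      fix c assume "c \<in> carrier ?K - {\<zero>\<^bsub>?K\<^esub>}"
      then obtain \<alpha> where \<alpha>: "\<alpha> \<in> cyc n" "c = P +>\<^bsub>?C\<^esub> \<alpha>" "c \<noteq> P" unfolding K_carrier K_zero by blast
      have "\<not> \<alpha> \<doteq> 0"
      proof
        assume "\<alpha> \<doteq> 0"
        hence "P +>\<^bsub>?C\<^esub> \<alpha> = P +>\<^bsub>?C\<^esub> 0" using \<alpha> C.zero_closed by (simp add: coset_eq)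
        thus False using \<alpha> zero by simp
      qed
      hence aM: "\<alpha> \<notin> M" using eqm_0_iff by blast
      define t where "t = rep \<alpha>"
      have t: "t \<in> U" "\<alpha> \<doteq> t" unfolding t_def using CF[OF \<alpha>(1)] aM by (auto intro: rep_U rep_eqm)
      have "\<alpha> \<doteq> s t" using eqm_sym[OF sU(2)[OF t(1)]] t(2) eqm_trans by blast
      hence "c = P +>\<^bsub>?C\<^esub> s t" using \<alpha> sU(1)[OF t(1)] by (simp add: coset_eq)
      thus "c \<in> (\<lambda>t. P +>\<^bsub>?C\<^esub> s t) ` U" using t(1) by blast
    qed
  qed
  have teich: "teichmueller n q P (P +>\<^bsub>?C\<^esub> s t) = t ^ ((q - 1) div n)" if t: "t \<in> U" for t
  proof -
    define a where "a = (q - 1) div n"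
    have an: "a * n = q - 1" unfolding a_def using ord_properties(2)[OF n] by simp
    have root: "(t ^ a) ^ n = 1" using t by (simp add: power_mult[symmetric] an U_def)
    have ta: "t ^ a \<in> U" using t by simp
    have ne: "P +>\<^bsub>?C\<^esub> s t \<noteq> P" using bij t K_zero by (auto simp: bij_betw_def)
    have "(THE z. (\<exists>j::nat. z = zeta n ^ j) \<and> (\<forall>\<alpha>\<in>P +>\<^bsub>?C\<^esub> s t. \<alpha> ^ ((q - 1) div n) - z \<in> P)) = t ^ a"
    proof (rule the_equality)
      show "(\<exists>j::nat. t ^ a = zeta n ^ j) \<and> (\<forall>\<alpha>\<in>P +>\<^bsub>?C\<^esub> s t. \<alpha> ^ ((q - 1) div n) - t ^ a \<in> P)"
      proof (intro conjI ballI)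
        show "\<exists>j::nat. t ^ a = zeta n ^ j" using root_of_unity_zeta[OF n(1) root] by metis
        fix \<alpha> assume "\<alpha> \<in> P +>\<^bsub>?C\<^esub> s t"
        hence \<alpha>: "\<alpha> \<in> cyc n" "\<alpha> \<doteq> s t" using sU(1)[OF t] by (auto simp: coset)
        have "\<alpha> ^ a \<doteq> t ^ a" using eqm_trans[OF \<alpha>(2) sU(2)[OF t]] by (rule eqm_power)
        moreover have "t ^ a \<in> cyc n" using root by (intro root_of_unity_cyc n)
        ultimately show "\<alpha> ^ ((q - 1) div n) - t ^ a \<in> P"
          unfolding P(2) a_def[symmetric] using \<alpha> by (auto simp: eqm_def intro: C.diff_closed C.power_closed)
      qed
      fix z assume z: "(\<exists>j::nat. z = zeta n ^ j) \<and> (\<forall>\<alpha>\<in>P +>\<^bsub>?C\<^esub> s t. \<alpha> ^ ((q - 1) div n) - z \<in> P)"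
      \<comment> \<open>Powers of \<open>zeta n\<close> are in \<open>U\<close>, where congruence
        modulo \<open>M\<close> is equality; this gives uniqueness.\<close>
      have zU: "z \<in> U" using z ord_properties(3)[OF n] by auto
      have "s t \<in> P +>\<^bsub>?C\<^esub> s t" using sU(1)[OF t] CF by (simp add: coset)
      hence "s t ^ a - z \<in> M" using z P(2) by (auto simp: a_def)
      hence "s t ^ a \<doteq> z" using sU[OF t] CF zU by (simp add: eqm_def)
      moreover have "s t ^ a \<doteq> t ^ a" using sU(2)[OF t] by (rule eqm_power)
      ultimately have "z \<doteq> t ^ a" using eqm_sym eqm_trans by blast
      thus "z = t ^ a" using zU ta U_subset_T by (intro T_eqI) auto
    qed
    thus ?thesis unfolding teichmueller_def a_def[symmetric] using ne by simp
  qed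
  have nat_pow: "x [^]\<^bsub>?C\<^esub> (m::nat) = x ^ m" if "x \<in> cyc n" for x m
    by (induction m) (simp_all add: nat_pow_def[symmetric] mult.commute)
  have K_pow: "(P +>\<^bsub>?C\<^esub> x) [^]\<^bsub>?K\<^esub> (m::nat) = P +>\<^bsub>?C\<^esub> (x ^ m)" if "x \<in> cyc n" for x m
    using h.hom_nat_pow[of x m] that by (simp add: nat_pow)
  have finsum: "finsum ?C g I = sum g I" if "finite I" "\<And>i. i \<in> I \<Longrightarrow> g i \<in> cyc n" for g :: "nat \<Rightarrow> complex" and I
    using that
  proof (induction I rule: finite_induct)
    case (insert i I)
    thus ?case by (subst finsum_insert) auto
  qed (simp add: finsum_empty)
  have trace: "ff_trace p f ?K (P +>\<^bsub>?C\<^esub> x) = P +>\<^bsub>?C\<^esub> tr x" if x: "x \<in> cyc n" for x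
  proof -
    have "ff_trace p f ?K (P +>\<^bsub>?C\<^esub> x) = finsum ?K (\<lambda>i. P +>\<^bsub>?C\<^esub> (x ^ (p ^ i))) {..<f}"
      unfolding ff_trace_def K_pow[OF x] ..
    also have "\<dots> = P +>\<^bsub>?C\<^esub> finsum ?C (\<lambda>i. x ^ (p ^ i)) {..<f}"
      using x C.power_closed by (subst h.hom_finsum) (auto simp: comp_def)
    also have "finsum ?C (\<lambda>i. x ^ (p ^ i)) {..<f} = tr x"
      unfolding tr_def using x C.power_closed by (intro finsum) auto
    finally show ?thesis .
  qed
  have multiple: "[j] \<cdot>\<^bsub>?K\<^esub> \<one>\<^bsub>?K\<^esub> = P +>\<^bsub>?C\<^esub> of_nat j" for j :: nat
  proof (induction j)
    case 0
    show ?case using zero by (simp add: K_zero)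
  next
    case (Suc j)
    have "[Suc j] \<cdot>\<^bsub>?K\<^esub> \<one>\<^bsub>?K\<^esub> = ([j] \<cdot>\<^bsub>?K\<^esub> \<one>\<^bsub>?K\<^esub>) \<oplus>\<^bsub>?K\<^esub> \<one>\<^bsub>?K\<^esub>"
      by (rule h.S.add.nat_pow_Suc)
    also have "\<dots> = P +>\<^bsub>?C\<^esub> (of_nat j + 1)"
      unfolding Suc.IH using h.hom_add[of "of_nat j" 1] C.of_nat_closed[of j] C.one_closed h.hom_one by simp
    finally show ?case by (simp add: add.commute)
  qed
  have addchar: "additive_char p f ?K (P +>\<^bsub>?C\<^esub> s t) = psi t" if t: "t \<in> U" for t
  proof -
    have st: "s t \<in> cyc n" "tr (s t) \<in> cyc n"
      using sU(1)[OF t] unfolding tr_def by (auto intro!: C.sum_closed C.power_closed)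
    have "[j] \<cdot>\<^bsub>?K\<^esub> \<one>\<^bsub>?K\<^esub> = ff_trace p f ?K (P +>\<^bsub>?C\<^esub> s t) \<longleftrightarrow> of_nat j \<doteq> tr (s t)" for j :: nat
      unfolding multiple trace[OF st(1)] by (rule coset_eq[OF C.of_nat_closed st(2)])
    hence "additive_char p f ?K (P +>\<^bsub>?C\<^esub> s t) = psi (s t)"
      unfolding additive_char_def psi_def trn_def by simp
    also have "psi (s t) = psi t" using sU[OF t] CF by (intro psi_cong) auto
    finally show ?thesis .
  qed
  have "gauss_sum p f ?K (teichmueller n q P)
      = (\<Sum>t\<in>U. teichmueller n q P (P +>\<^bsub>?C\<^esub> s t) * additive_char p f ?K (P +>\<^bsub>?C\<^esub> s t))"
    unfolding gauss_sum_def by (rule sum.reindex_bij_betw[OF bij, symmetric])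
  also have "\<dots> = G ((q - 1) div n)"
    unfolding G_def by (intro sum.cong) (auto simp: teich addchar)
  finally show ?thesis .
qed

end

section \<open>Gauss sums in an extension of prime degree\<close>

lemma root_of_unity_coprime:
  assumes "(y::complex) ^ m = 1" "y ^ n = 1" "coprime m n" "m > 0"
  shows "y = 1"
proof -
  obtain i where i: "y = zeta m ^ i" using root_of_unity_zeta[OF assms(4,1)] by metis
  have "zeta m ^ (i * n) = 1" using assms(2) by (simp add: i power_mult)
  hence "m dvd i * n" by (simp only: zeta_power_eq_1_iff[OF assms(4)])
  hence "m dvd i" using assms(3) by (simp add: coprime_dvd_mult_left_iff)
  thus ?thesis unfolding i by (simp only: zeta_power_eq_1_iff[OF assms(4)])
qed

lemma sum_lessThan_odd:
  fixes r :: nat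
  assumes "odd r"
  shows "(\<Sum>c<r. c) = r * ((r - 1) div 2)"
proof -
  obtain m where m: "r = Suc (2 * m)" using assms by (auto elim: oddE)
  have "2 * (\<Sum>c<n. c) = n * (n - 1)" for n :: nat
  proof (induction n)
    case (Suc n)
    thus ?case by (cases n) auto
  qed simp
  from this[of r] have "2 * (\<Sum>c<r. c) = 2 * (r * m)" unfolding m by simp
  thus ?thesis unfolding m by simp
qed

text \<open>Here \<open>k * r\<close> is \<open>k'\<close>, and the fields with \<open>p ^ f\<close>
  and \<open>p ^ (r * f)\<close> elements are modelled modulo the same \<open>M\<close>, the
  representatives of the small one being among those of the large one.\<close>

locale gauss_tower = residue_model +
  fixes f k r :: nat
  assumes prime_r: "prime r" and odd_r: "odd r" and r_dvd_k: "r dvd k" and k_pos: "k > 0"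
    and ord_k: "ord k p = f" and ord_kr: "ord (k * r) p = r * f"
    and coprime_kr_p: "coprime (k * r) p" and coprime_kr_pred: "coprime (k * r) (p - 1)"
    and all_roots_R: "t ^ (p ^ (r * f) - 1) = 1 \<Longrightarrow> t \<in> R"
begin

lemma r_gt_1: "r > 1" and r_pos: "r > 0"
  using prime_r prime_gt_1_nat prime_gt_0_nat by auto

lemma r_ge_3: "r \<ge> 3"
  using r_gt_1 odd_r by (cases "r = 2") auto

lemma k_gt_1: "k > 1"
  using r_dvd_k k_pos r_gt_1 by (auto dest: dvd_imp_le)

lemma coprime_k_p: "coprime k p" and coprime_r_p: "coprime r p"
  using coprime_kr_p by auto

lemma f_gt_0: "f > 0"
  using coprime_k_p ord_gt_0_iff[of k p] ord_k by simp

lemma pow_rf: "p ^ (r * f) = (p ^ f) ^ r"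
  by (simp add: power_mult[symmetric] mult.commute)

lemma pf_gt_1: "p ^ f > 1"
  using p_gt_1 f_gt_0 by (metis one_less_power)

lemma dvd_pred: "p ^ f - 1 dvd p ^ (r * f) - 1"
proof -
  have "[p ^ f = 1] (mod (p ^ f - 1))"
    using pf_gt_1 by (simp add: cong_altdef_nat)
  hence "[(p ^ f) ^ r = 1 ^ r] (mod (p ^ f - 1))" by (rule cong_pow)
  hence "[(p ^ f) ^ r = 1] (mod (p ^ f - 1))" by simp
  thus ?thesis unfolding pow_rf using pf_gt_1 by (subst (asm) cong_altdef_nat) auto
qed

sublocale K: finite_field_model R M p f
proof
  fix t :: complex assume "t ^ (p ^ f - 1) = 1"
  thus "t \<in> R" using dvd_pred by (intro all_roots_R) (auto simp: power_mult elim!: dvdE)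
qed (rule f_gt_0)

sublocale L: finite_field_model R M p "r * f"
  by unfold_locales (use f_gt_0 r_pos all_roots_R in auto)

abbreviation q where "q \<equiv> p ^ f"

text \<open>By \<open>gauss_sum_eq_G\<close> the Teichmueller characters are the powers
  \<open>t ^ a\<close> on the large field and \<open>t ^ aK\<close> on the small one.\<close>

definition a :: nat where "a = (L.q - 1) div (k * r)"
definition aK :: nat where "aK = (q - 1) div k"
definition n :: nat where "n = f * ((r - 1) div 2)"

lemma aK: "aK * k = q - 1"
  unfolding aK_def using K.ord_properties(2)[OF k_pos ord_k] by simp

lemma a: "a * (k * r) = L.q - 1"
  unfolding a_def using L.ord_properties(2)[OF _ ord_kr] k_pos r_pos by simp

lemma q_eq: "q = 1 + k * aK"
  using aK pf_gt_1 by (simp add: mult.commute)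

lemma aK_pos: "aK > 0"
  using aK pf_gt_1 by (cases aK) auto

lemma a_pos: "a > 0"
  using a L.q_gt_1 by (cases a) auto

text \<open>Otherwise \<open>k * r\<close> would divide \<open>p ^ f - 1\<close>, and the order of
  \<open>p\<close> modulo \<open>k * r\<close> would not exceed \<open>f\<close>.\<close>

lemma r_ndvd_aK: "\<not> r dvd aK"
proof
  assume "r dvd aK"
  hence "k * r dvd q - 1" using aK by (metis dvd_triv_right mult.commute mult_dvd_mono dvd_refl)
  hence "[p ^ f = 1] (mod (k * r))" using pf_gt_1 by (simp add: cong_altdef_nat)
  hence "r * f dvd f" using ord_divides[of p f "k * r"] ord_kr by simp
  hence "r * f \<le> f" using f_gt_0 by (intro dvd_imp_le)
  thus False using r_gt_1 f_gt_0 by simp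
qed

lemma q_power_cong: "[q ^ i = 1 + i * (k * aK)] (mod (k * r))"
proof (induction i)
  case (Suc i)
  have "[q * q ^ i = (1 + k * aK) * (1 + i * (k * aK))] (mod (k * r))"
    by (intro cong_mult Suc) (simp only: q_eq cong_refl)
  also have "(1 + k * aK) * (1 + i * (k * aK)) = (1 + Suc i * (k * aK)) + k * k * (i * aK * aK)"
    by (simp add: algebra_simps)
  also have "[(1 + Suc i * (k * aK)) + k * k * (i * aK * aK) = 1 + Suc i * (k * aK)] (mod (k * r))"
  proof -
    have "k * r dvd k * k * (i * aK * aK)" using r_dvd_k by (intro dvd_mult2 mult_dvd_mono) auto
    hence "[k * k * (i * aK * aK) = 0] (mod (k * r))" by (simp only: cong_0_iff)
    from cong_add[OF cong_refl this, of "1 + Suc i * (k * aK)"] show ?thesis by simp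
  qed
  finally show ?case by simp
qed simp

text \<open>This makes \<open>chi'\<close> restrict to \<open>chi\<close> on the small field. The
  quotient \<open>Y = (q ^ r - 1) / (q - 1)\<close> is \<open>r\<close> modulo \<open>k * r\<close>:
  by \<open>q_power_cong\<close> the error is \<open>k * aK\<close> times
  \<open>r * (r - 1) / 2\<close>, a multiple of \<open>k * r\<close> for odd
  \<open>r\<close>.\<close>

lemma a_eq: "\<exists>w. a = aK + (q - 1) * w"
proof -
  define Y where "Y = (\<Sum>i<r. q ^ i)"
  have "[Y = (\<Sum>i<r. 1 + i * (k * aK))] (mod (k * r))"
    unfolding Y_def by (intro cong_sum q_power_cong)
  also have "(\<Sum>i<r. 1 + i * (k * aK)) = r + (k * r) * (((r - 1) div 2) * aK)"
    unfolding sum.distrib sum_distrib_right[symmetric] sum_lessThan_odd[OF odd_r] by simp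
  also have "[r + (k * r) * (((r - 1) div 2) * aK) = r] (mod (k * r))"
    by (simp add: cong_def)
  finally have cong: "[Y = r] (mod (k * r))" .
  have "(\<Sum>i<r. 1) \<le> Y" unfolding Y_def using pf_gt_1 by (intro sum_mono) simp
  hence "r \<le> Y" by simp
  with cong have "k * r dvd Y - r" by (simp add: cong_altdef_nat)
  then obtain w where "Y - r = k * r * w" by blast
  hence w: "Y = r + k * r * w" using \<open>r \<le> Y\<close> by simp
  have "(q - 1) * Y = L.q - 1"
  proof -
    have "int ((q - 1) * Y) = (int q - 1) * (\<Sum>i<r. int q ^ i)"
      using pf_gt_1 by (simp add: Y_def of_nat_diff)
    also have "\<dots> = int q ^ r - 1" by (rule power_diff_1_eq[symmetric])
    also have "\<dots> = int (L.q - 1)" using L.q_gt_1 by (simp add: pow_rf of_nat_diff)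
    finally show ?thesis by (simp only: of_nat_eq_iff)
  qed
  hence "a * (k * r) = (aK * k) * (r + k * r * w)" by (simp only: a aK w)
  hence "k * r * a = k * r * (aK + aK * k * w)" by (simp only: algebra_simps)
  hence "a = aK + aK * k * w" using k_pos r_pos by simp
  thus ?thesis unfolding aK by blast
qed

lemma K_U_subset: "c \<in> K.U \<Longrightarrow> c \<in> L.U"
  unfolding K.U_def L.U_def using dvd_pred by (auto simp: power_mult elim!: dvdE)

lemma K_U_power_a: "c \<in> K.U \<Longrightarrow> c ^ a = c ^ aK"
  using a_eq by (auto simp: K.U_def power_add power_mult)

section \<open>The relative trace and the factorization of the large Gauss sum\<close>

definition reltr :: "complex \<Rightarrow> complex" where "reltr x = (\<Sum>i<r. x ^ (q ^ i))"

lemma q_power: "q ^ i = p ^ (f * i)"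
  by (simp add: power_mult)

lemma reltr_frobenius: "x \<in> L.F \<Longrightarrow> reltr (x ^ q) \<doteq> reltr x"
proof -
  assume x: "x \<in> L.F"
  obtain g where g: "r = Suc g" using r_pos by (cases r) auto
  have reltr: "reltr y = (\<Sum>i<Suc g. y ^ (q ^ i))" for y
    unfolding reltr_def g[symmetric] ..
  have Lq: "L.q = q ^ Suc g" unfolding g[symmetric] by (rule pow_rf)
  have "reltr (x ^ q) = (\<Sum>i<Suc g. x ^ (q ^ Suc i))"
    unfolding reltr by (intro sum.cong refl) (metis power_mult power_Suc)
  also have "\<dots> = (\<Sum>i<g. x ^ (q ^ Suc i)) + x ^ L.q"
    unfolding Lq by (rule sum.lessThan_Suc)
  also have "\<dots> \<doteq> (\<Sum>i<g. x ^ (q ^ Suc i)) + x"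
    using x by (intro eqm_add eqm_refl L.F_D sum_R power_R) auto
  also have "\<dots> = reltr x"
    unfolding reltr by (subst sum.lessThan_Suc_shift) simp
  finally show ?thesis .
qed

lemma reltr_F: "x \<in> L.F \<Longrightarrow> reltr x \<in> K.F"
proof (rule K.F_I)
  assume x: "x \<in> L.F"
  have "reltr x ^ q \<doteq> (\<Sum>i<r. (x ^ (q ^ i)) ^ q)"
    unfolding reltr_def using x by (intro frobenius_power_sum) auto
  also have "(\<Sum>i<r. (x ^ (q ^ i)) ^ q) = reltr (x ^ q)"
    unfolding reltr_def power_mult[symmetric] by (simp only: mult.commute)
  also have "\<dots> \<doteq> reltr x" by (rule reltr_frobenius[OF x])
  finally show "reltr x ^ q \<doteq> reltr x" .
qed

lemma reltr_mult: "c \<in> K.U \<Longrightarrow> reltr (c * x) = c * reltr x"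
proof -
  assume c: "c \<in> K.U"
  have "c ^ (q ^ i) = c" for i
  proof (induction i)
    case (Suc i)
    have "c ^ (q ^ Suc i) = (c ^ q) ^ (q ^ i)" by (simp only: power_mult[symmetric] power_Suc)
    also have "c ^ q = c" using c K.U_subset_T by (intro K.power_q_T) auto
    finally show ?case using Suc by simp
  qed simp
  thus ?thesis unfolding reltr_def by (simp add: power_mult_distrib sum_distrib_left)
qed

text \<open>Transitivity of the trace: an index below \<open>r * f\<close> is
  \<open>m * f + i\<close> with \<open>m < r\<close> and \<open>i < f\<close>.\<close>

lemma L_psi: "x \<in> L.F \<Longrightarrow> L.psi x = K.psi (reltr x)"
proof -
  assume x: "x \<in> L.F"
  have "K.tr (reltr x) = (\<Sum>i<f. reltr x ^ (p ^ i))" by (simp only: K.tr_def)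
  also have "\<dots> \<doteq> (\<Sum>i<f. \<Sum>m<r. (x ^ (q ^ m)) ^ (p ^ i))"
    unfolding reltr_def using x by (intro eqm_sum frobenius_power_sum) auto
  also have "\<dots> = (\<Sum>m<r. \<Sum>i<f. x ^ (p ^ (m * f + i)))"
    unfolding power_mult[symmetric] power_add q_power
    by (subst sum.swap) (simp only: mult.commute[of f])
  also have "\<dots> = (\<Sum>m<r. \<Sum>i\<in>{m*f..<m*f+f}. x ^ (p ^ i))"
  proof (rule sum.cong)
    fix m
    show "(\<Sum>i<f. x ^ (p ^ (m * f + i))) = (\<Sum>i\<in>{m*f..<m*f+f}. x ^ (p ^ i))"
      by (rule sum.reindex_bij_witness[of _ "\<lambda>i. i - m * f" "\<lambda>i. m * f + i"]) auto
  qed simp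
  also have "\<dots> = L.tr x" unfolding L.tr_def by (rule sum.nat_group)
  finally have "L.tr x \<doteq> K.tr (reltr x)" by (rule eqm_sym)
  with L.trn(2)[OF x] have "of_nat (L.trn x) \<doteq> K.tr (reltr x)" by (rule eqm_trans)
  thus ?thesis using K.psi_eqI by (simp add: L.psi_def)
qed

definition D :: "complex set" where "D = {t \<in> L.U. reltr t \<doteq> 1}"

definition E :: "nat \<Rightarrow> complex" where "E j = (\<Sum>t\<in>D. t ^ (a * j))"

lemma finite_D [simp]: "finite D"
  unfolding D_def by simp

text \<open>On the fibre \<open>S w\<close> of the relative trace the additive character is
  constant. Scaling by \<open>c\<close> in \<open>K.U\<close> carries the fibre of 1 to that of
  \<open>c\<close> and pulls out the character value at \<open>c\<close>.\<close>

lemma L_G_eq: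
  assumes "\<not> k dvd j"
  shows "L.G (a * j) = E j * K.G (aK * j)"
proof -
  define S where "S w = {t \<in> L.U. K.rep (reltr t) = w}" for w
  have repF: "reltr t \<in> K.F" if "t \<in> L.U" for t using that by (intro reltr_F) simp
  have cS: "(\<Sum>t\<in>S (c * w). t ^ (a * j)) = c ^ (a * j) * (\<Sum>t\<in>S w. t ^ (a * j))"
    if c: "c \<in> K.U" and w: "w \<in> K.T" for c w
  proof -
    have cL: "c \<in> L.U" by (rule K_U_subset[OF c])
    have S_mult: "d * t \<in> S (d * v)" if "d \<in> K.U" "t \<in> S v" for d t v
    proof -
      have t: "t \<in> L.U" "K.rep (reltr t) = v" using that by (auto simp: S_def)
      have "reltr (d * t) \<doteq> d * v"
        unfolding reltr_mult[OF that(1)] using K.rep_eqm[OF repF[OF t(1)]] t(2) that(1)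
        by (intro eqm_mult eqm_refl) auto
      moreover have "d * v \<in> K.T" using K.rep_T[OF repF[OF t(1)]] t(2) that(1) K.U_subset_T by auto
      ultimately have "K.rep (reltr (d * t)) = d * v" by (intro K.rep_eqI)
      thus ?thesis using t that K_U_subset by (auto simp: S_def)
    qed
    have "(\<Sum>t\<in>S (c * w). t ^ (a * j)) = (\<Sum>t\<in>S w. (c * t) ^ (a * j))"
    proof (rule sum.reindex_bij_witness[of _ "\<lambda>t. c * t" "\<lambda>t. inverse c * t"])
      fix t assume "t \<in> S (c * w)"
      hence "inverse c * t \<in> S (inverse c * (c * w))" using c by (intro S_mult) auto
      thus "inverse c * t \<in> S w" using K.U_nonzero[OF c] by (simp add: mult.assoc[symmetric])
    qed (use S_mult[OF c] K.U_nonzero[OF c] in \<open>auto simp: mult.assoc[symmetric]\<close>)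
    thus ?thesis by (simp add: power_mult_distrib sum_distrib_left)
  qed
  have S1: "S 1 = D"
    unfolding S_def D_def
  proof (intro Collect_cong conj_cong refl)
    fix t assume "t \<in> L.U"
    thus "K.rep (reltr t) = 1 \<longleftrightarrow> reltr t \<doteq> 1"
      using K.rep_eq_iff[OF repF, of t 1] K.rep_T_id[OF subsetD[OF K.U_subset_T K.one_U]] by simp
  qed
  \<comment> \<open>Scaling by a generator \<open>c\<close> of \<open>K.U\<close> preserves the
    fibre of 0 but multiplies its sum by a character value, which is not 1 because \<open>k\<close>
    does not divide \<open>j\<close>.\<close>
  have S0: "(\<Sum>t\<in>S 0. t ^ (a * j)) = 0"
  proof -
    define c where "c = zeta (q - 1)"
    have c: "c \<in> K.U" unfolding c_def K.U_def using pf_gt_1 by simp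
    have "c ^ (a * j) \<noteq> 1"
    proof
      assume "c ^ (a * j) = 1"
      hence "c ^ (aK * j) = 1" by (simp add: power_mult K_U_power_a[OF c])
      hence "q - 1 dvd aK * j" unfolding c_def using pf_gt_1 by (simp add: zeta_power_eq_1_iff)
      hence "aK * k dvd aK * j" by (simp only: aK)
      thus False using assms aK_pos by simp
    qed
    moreover have "(\<Sum>t\<in>S 0. t ^ (a * j)) = c ^ (a * j) * (\<Sum>t\<in>S 0. t ^ (a * j))"
      using cS[OF c K.zero_T] by simp
    ultimately show ?thesis by simp
  qed
  have "L.G (a * j) = (\<Sum>w\<in>K.T. \<Sum>t\<in>S w. t ^ (a * j) * L.psi t)"
    unfolding L.G_def S_def using K.rep_T[OF repF] by (intro sum.group[symmetric]) auto
  also have "\<dots> = (\<Sum>w\<in>K.T. (\<Sum>t\<in>S w. t ^ (a * j)) * K.psi w)"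
    unfolding sum_distrib_right
    by (intro sum.cong refl) (use K.psi_rep repF in \<open>auto simp: S_def L_psi\<close>)
  also have "\<dots> = (\<Sum>w\<in>K.U. (\<Sum>t\<in>S w. t ^ (a * j)) * K.psi w)"
    unfolding K.T_def by (simp add: S0)
  also have "\<dots> = (\<Sum>w\<in>K.U. E j * (w ^ (aK * j) * K.psi w))"
  proof (rule sum.cong)
    fix w assume w: "w \<in> K.U"
    have "(\<Sum>t\<in>S w. t ^ (a * j)) = w ^ (a * j) * E j"
      using cS[OF w subsetD[OF K.U_subset_T K.one_U]] by (simp add: S1 E_def)
    thus "(\<Sum>t\<in>S w. t ^ (a * j)) * K.psi w = E j * (w ^ (aK * j) * K.psi w)"
      by (simp add: power_mult K_U_power_a[OF w])
  qed simp
  also have "\<dots> = E j * K.G (aK * j)" by (simp add: K.G_def sum_distrib_left)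
  finally show ?thesis .
qed

section \<open>Absolute value and local divisibility of \<open>E j\<close>\<close>

lemma k_ndvd: "coprime j k \<Longrightarrow> \<not> k dvd j"
  using k_gt_1 by (metis coprime_absorb_right nat_dvd_1_iff_1 less_irrefl)

lemma norm_K_G: "coprime j k \<Longrightarrow> (norm (K.G (aK * j)))\<^sup>2 = real q"
proof (rule K.norm_G)
  assume "coprime j k"
  thus "\<not> q - 1 dvd aK * j" unfolding aK[symmetric] using k_ndvd aK_pos by simp
qed

lemma norm_E:
  assumes "coprime j k"
  shows "norm (E j) = real p ^ n"
proof -
  have "\<not> L.q - 1 dvd a * j"
  proof
    assume "L.q - 1 dvd a * j"
    hence "k * r dvd j" unfolding a[symmetric] using a_pos by simp
    thus False using k_ndvd[OF assms] by (metis dvd_mult_left)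
  qed
  hence "(norm (L.G (a * j)))\<^sup>2 = real L.q" by (rule L.norm_G)
  hence "(norm (E j))\<^sup>2 * real q = real L.q"
    unfolding L_G_eq[OF k_ndvd[OF assms]] norm_mult power_mult_distrib norm_K_G[OF assms] .
  also have "L.q = p ^ (2 * n) * q"
  proof -
    have "2 * ((r - 1) div 2) + 1 = r" using odd_r by presburger
    hence "(2 * ((r - 1) div 2) + 1) * f = r * f" by (simp only:)
    hence "r * f = 2 * n + f" unfolding n_def by (simp add: algebra_simps)
    thus ?thesis by (simp only: power_add)
  qed
  finally have "(norm (E j))\<^sup>2 * real q = (real p ^ n)\<^sup>2 * real q"
    by (simp add: power_mult[symmetric] mult.commute)
  hence "(norm (E j))\<^sup>2 = (real p ^ n)\<^sup>2" using pf_gt_1 by simp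
  thus ?thesis by (rule power2_eq_imp_eq) auto
qed

text \<open>Write \<open>j'\<close> for the residue of \<open>-j\<close>. By
  \<open>sum_residues_tower\<close> the large residues of \<open>j'\<close> add up to
  \<open>r\<close> times the small ones plus \<open>f * k * r * (r - 1) / 2\<close>, and the small
  residues of \<open>j'\<close> and \<open>j\<close> pair up to \<open>k\<close> each. Dividing the
  total by \<open>k * r\<close> leaves \<open>f + f * (r - 1) / 2 = f + n\<close>.\<close>

lemma digit_sums:
  assumes "coprime j k"
  shows "digit_sum p (r * f) (a * (k * r - j mod (k * r))) + digit_sum p f (aK * (j mod k))
    = (p - 1) * (f + n)"
proof -
  define j' where "j' = k * r - j mod (k * r)"
  have kr: "k * r > 0" using k_pos r_pos by simp
  have cop: "coprime j (k * r)"
    using assms r_dvd_k by (metis coprime_divisors coprime_mult_right_iff dvd_refl)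
  have jpos: "j mod (k * r) > 0"
  proof (rule ccontr)
    assume "\<not> j mod (k * r) > 0"
    hence "k * r dvd j" by auto
    thus False using k_ndvd[OF assms] by (metis dvd_mult_left)
  qed
  have j': "j' < k * r" "j' + j mod (k * r) = k * r"
    unfolding j'_def using jpos kr by (auto intro: less_imp_le)
  have j'k: "k dvd j' + j"
  proof -
    have "[j' + j = j' + j mod (k * r)] (mod (k * r))" by (simp add: cong_def mod_add_right_eq)
    hence "k * r dvd j' + j" unfolding j'(2) by (simp add: cong_def dvd_eq_mod_eq_0)
    thus ?thesis by (metis dvd_mult_left)
  qed
  have cop': "coprime j' (k * r)"
  proof -
    have "coprime (j mod (k * r)) (k * r)" using cop kr by (simp only: coprime_mod_left_iff)
    moreover have "j mod (k * r) = k * r - j'" using j'(2) by simp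
    ultimately show ?thesis
      by (metis coprime_common_divisor coprimeI dvd_diff_nat)
  qed
  have L: "k * r * digit_sum p (r * f) (a * j') = (p - 1) * (\<Sum>i<r * f. (p ^ i * j') mod (k * r))"
    using p_gt_1 kr a j' L.q_gt_1 by (intro digit_sum_eq_sum_residues_multiple) (auto simp: mult_ac)
  have K: "k * digit_sum p f (aK * (j mod k)) = (p - 1) * (\<Sum>i<f. (p ^ i * (j mod k)) mod k)"
    using p_gt_1 k_pos aK K.q_gt_1 by (intro digit_sum_eq_sum_residues_multiple) (auto simp: mult_ac)
  have tower: "(\<Sum>i<r * f. (p ^ i * j') mod (k * r)) = r * (\<Sum>i<f. (p ^ i * j') mod k) + f * (k * (\<Sum>c<r. c))"
    using k_pos r_pos ord_k ord_kr cop' coprime_kr_p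
    by (intro sum_residues_tower) (auto simp: coprime_commute)
  \<comment> \<open>Neither residue is 0, and \<open>k\<close> divides their sum, which is below
    \<open>2 * k\<close>.\<close>
  have "(p ^ i * j') mod k + (p ^ i * (j mod k)) mod k = k" for i
  proof -
    have "\<not> k dvd p ^ i * j"
    proof
      assume "k dvd p ^ i * j"
      hence "k dvd j" using coprime_k_p by (simp add: coprime_dvd_mult_right_iff)
      thus False using k_ndvd[OF assms] by simp
    qed
    hence 1: "(p ^ i * j) mod k > 0" by (simp add: dvd_eq_mod_eq_0)
    have "k dvd p ^ i * j' + p ^ i * j" using j'k by (simp add: distrib_left[symmetric])
    hence "((p ^ i * j') mod k + (p ^ i * j) mod k) mod k = 0" by (simp add: mod_add_eq dvd_eq_mod_eq_0)
    hence "k dvd (p ^ i * j') mod k + (p ^ i * j) mod k" by (simp only: dvd_eq_mod_eq_0)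
    then obtain c where c: "(p ^ i * j') mod k + (p ^ i * j) mod k = k * c" by blast
    have "(p ^ i * j') mod k < k" "(p ^ i * j) mod k < k" using k_pos by auto
    hence "k * c < k * 2" "k * c > 0" using c 1 by linarith+
    hence "c = 1" using k_pos by simp
    thus ?thesis using c by (simp add: mod_mult_right_eq)
  qed
  hence sumK: "(\<Sum>i<f. (p ^ i * j') mod k) + (\<Sum>i<f. (p ^ i * (j mod k)) mod k) = f * k"
    unfolding sum.distrib[symmetric] by simp
  have "k * r * (digit_sum p (r * f) (a * j') + digit_sum p f (aK * (j mod k)))
      = k * r * digit_sum p (r * f) (a * j') + r * (k * digit_sum p f (aK * (j mod k)))"
    by (simp only: distrib_left mult_ac)
  also have "\<dots> = (p - 1) * (r * ((\<Sum>i<f. (p ^ i * j') mod k) + (\<Sum>i<f. (p ^ i * (j mod k)) mod k))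
      + f * (k * (\<Sum>c<r. c)))"
    unfolding L K tower by (simp only: distrib_left mult_ac add_ac)
  also have "\<dots> = k * r * ((p - 1) * (f + n))"
    unfolding sumK sum_lessThan_odd[OF odd_r] n_def by (simp only: distrib_left mult_ac)
  finally show ?thesis using kr unfolding j'_def by (metis mult_left_cancel less_irrefl)
qed

text \<open>Instead of dividing by \<open>K.G\<close>, multiply by its conjugate:
  \<open>E j * q\<close> is a product of two Gauss sums to which Stickelberger's bound applies. The
  digit sums give \<open>p ^ (f + n)\<close>, and \<open>q = p ^ f\<close> is cancelled.\<close>

lemma ldvd_E:
  assumes "coprime j k"
  shows "ldvd (of_nat p ^ n) (E j)"
proof -
  define b where "b = aK * (j mod k)"
  define B where "B = a * (k * r - j mod (k * r))"
  have kr: "k * r > 0" using k_pos r_pos by simp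
  have b: "b < q - 1" unfolding b_def using aK aK_pos k_pos by (metis mod_less_divisor mult_less_mono2)
  have jpos: "j mod (k * r) > 0"
  proof (rule ccontr)
    assume "\<not> j mod (k * r) > 0"
    hence "k * r dvd j" by auto
    thus False using k_ndvd[OF assms] by (metis dvd_mult_left)
  qed
  have "a * (k * r - j mod (k * r)) < a * (k * r)"
    by (rule mult_less_mono2[OF diff_less[OF jpos kr] a_pos])
  hence B: "B < L.q - 1" by (simp only: B_def a)
  have "[aK * j = b] (mod (q - 1))"
    unfolding b_def aK[symmetric] by (simp only: cong_def mult_mod_right mod_mod_trivial)
  hence Kb: "K.G (aK * j) = K.G b" by (rule K.G_cong)
  have "a * (k * r) - B = a * (k * r - (k * r - j mod (k * r)))"
    by (simp only: B_def diff_mult_distrib2)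
  also have "k * r - (k * r - j mod (k * r)) = j mod (k * r)"
    using kr by (intro diff_diff_cancel less_imp_le mod_less_divisor)
  finally have "L.q - 1 - B = a * (j mod (k * r))" by (simp only: a)
  hence "[a * j = L.q - 1 - B] (mod (L.q - 1))"
    unfolding a[symmetric] by (simp only: cong_def mult_mod_right mod_mod_trivial)
  hence LB: "L.G (a * j) = L.G (L.q - 1 - B)" by (rule L.G_cong)
  have "E j * of_nat q = E j * (K.G (aK * j) * cnj (K.G (aK * j)))"
    using norm_K_G[OF assms] complex_norm_square[of "K.G (aK * j)"]
    by (metis of_real_of_nat_eq of_real_power)
  also have "\<dots> = L.G (L.q - 1 - B) * (K.rep (- 1) ^ b * K.G (q - 1 - b))"
    unfolding mult.assoc[symmetric] L_G_eq[OF k_ndvd[OF assms], symmetric] LB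
    unfolding Kb K.cnj_G[OF b] by simp
  also have "ldvd (lam ^ digit_sum p (r * f) B * lam ^ digit_sum p f b) \<dots>"
  proof (rule ldvd_mult)
    show "ldvd (lam ^ digit_sum p (r * f) B) (L.G (L.q - 1 - B))"
      by (rule L.stickelberger_lower_bound[OF B])
    have "ldvd (lam ^ digit_sum p f b) (K.G (q - 1 - b) * K.rep (- 1) ^ b)"
      by (rule ldvd_mult_right[OF K.stickelberger_lower_bound[OF b]]) simp
    thus "ldvd (lam ^ digit_sum p f b) (K.rep (- 1) ^ b * K.G (q - 1 - b))" by (simp only: mult.commute)
  qed
  finally have "ldvd (lam ^ ((p - 1) * (f + n))) (E j * of_nat q)"
    unfolding power_add[symmetric] digit_sums[OF assms, folded b_def B_def] .
  hence "ldvd (of_nat p ^ (f + n)) (E j * of_nat q)" by (rule ldvd_lam_power)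
  hence "ldvd (of_nat q * of_nat p ^ n) (of_nat q * E j)"
    by (simp only: power_add of_nat_power mult.commute)
  thus ?thesis by (rule ldvd_cancel_common[rotated]) simp
qed

section \<open>The congruence of \<open>E j\<close> modulo \<open>r\<close>\<close>

lemma D_U: "t \<in> D \<Longrightarrow> t \<in> L.U" and D_reltr: "t \<in> D \<Longrightarrow> reltr t \<doteq> 1"
  by (auto simp: D_def)

lemma D_frobenius: "t \<in> D \<Longrightarrow> t ^ q \<in> D"
  unfolding D_def using reltr_frobenius[of t] eqm_trans by auto

lemma power_qr_U: "t \<in> L.U \<Longrightarrow> t ^ (q ^ r) = t"
  using L.power_q_T[of t] L.U_subset_T by (auto simp: pow_rf)

lemma power_q_compose: "(t ^ q ^ i) ^ q = (t :: complex) ^ q ^ Suc i"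
  by (simp only: power_mult[symmetric] power_Suc mult.commute)

lemma power_a_kr: "t \<in> L.U \<Longrightarrow> (t ^ a) ^ (k * r) = 1"
  by (simp only: power_mult[symmetric] a L.U_def mem_Collect_eq)

text \<open>Frobenius multiplies an element outside of the \<open>k\<close>-th roots of unity by a primitive \<open>r\<close>-th root.\<close>

lemma sum_frobenius_orbit:
  assumes z: "z ^ (k * r) = 1" "z ^ k \<noteq> (1::complex)" and j: "coprime j r"
  shows "(\<Sum>i<r. (z ^ (q ^ i)) ^ j) = 0"
proof -
  \<comment> \<open>This is \<open>z ^ (q - 1)\<close>, the factor by which Frobenius moves
    \<open>z\<close>. It is an \<open>r\<close>-th root of unity, and \<open>r\<close> divides
    \<open>q - 1\<close>, so Frobenius fixes it and the orbit is
    \<open>z * \<rho> ^ i\<close>.\<close>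
  define \<rho> where "\<rho> = z ^ (k * aK)"
  have \<rho>r: "\<rho> ^ r = 1"
  proof -
    have "\<rho> ^ r = (z ^ (k * r)) ^ aK" unfolding \<rho>_def power_mult[symmetric] by (simp only: mult_ac)
    thus ?thesis using z by simp
  qed
  have zq: "z ^ q = z * \<rho>" unfolding \<rho>_def q_eq by (simp only: power_add power_one_right)
  have \<rho>q: "\<rho> ^ q = \<rho>"
  proof -
    obtain m where "k = r * m" using r_dvd_k by blast
    thus ?thesis unfolding q_eq using \<rho>r by (simp add: power_mult mult.assoc)
  qed
  have pow: "z ^ (q ^ i) = z * \<rho> ^ i" for i
  proof (induction i)
    case (Suc i)
    have "z ^ (q ^ Suc i) = (z ^ (q ^ i)) ^ q" by (rule power_q_compose[symmetric])
    also have "\<dots> = z ^ q * (\<rho> ^ q) ^ i"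
      unfolding Suc power_mult_distrib by (simp only: power_mult[symmetric] mult.commute)
    also have "\<dots> = z * \<rho> ^ Suc i" unfolding zq \<rho>q by simp
    finally show ?case .
  qed simp
  have "\<rho> ^ j \<noteq> 1"
  proof
    assume "\<rho> ^ j = 1"
    \<comment> \<open>Then the order of \<open>z ^ k\<close> would divide both \<open>r\<close> and
      \<open>aK\<close>, which are coprime by \<open>r_ndvd_aK\<close>.\<close>
    hence "\<rho> = 1" using \<rho>r j r_pos by (intro root_of_unity_coprime[of \<rho> r j]) (auto simp: coprime_commute)
    hence "(z ^ k) ^ aK = 1" by (simp add: \<rho>_def power_mult)
    moreover have "(z ^ k) ^ r = 1" using z by (simp add: power_mult)
    moreover have "coprime r aK" using prime_imp_coprime[OF prime_r r_ndvd_aK] .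
    ultimately have "z ^ k = 1" using r_pos by (intro root_of_unity_coprime[of "z ^ k" r aK])
    thus False using z by simp
  qed
  moreover have "(\<rho> ^ j) ^ r = 1" using \<rho>r by (simp only: power_mult[symmetric] mult.commute[of j]) (simp only: power_mult power_one)
  ultimately have "(\<Sum>i<r. (\<rho> ^ j) ^ i) = 0" by (simp add: geometric_sum)
  moreover have "(z ^ (q ^ i)) ^ j = z ^ j * (\<rho> ^ j) ^ i" for i
    unfolding pow power_mult_distrib by (simp only: power_mult[symmetric] mult.commute)
  ultimately show ?thesis by (simp add: sum_distrib_left[symmetric])
qed

text \<open>The index set is stable under Frobenius, whose orbit sums are 0. What is left of
  \<open>E j\<close> lies in the ring of \<open>zeta k\<close>, so conjugates are indexed by
  \<open>j\<close> coprime to \<open>k\<close>.\<close>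

lemma sum_non_kth_roots:
  assumes "coprime j r"
  shows "(\<Sum>t | t \<in> D \<and> (t ^ a) ^ k \<noteq> 1. t ^ (a * j)) = 0"
proof -
  define D2 where "D2 = {t \<in> D. (t ^ a) ^ k \<noteq> 1}"
  have step: "t ^ q \<in> D2" if t: "t \<in> D2" for t
  proof -
    have tU: "t \<in> L.U" using t D_U by (auto simp: D2_def)
    have "((t ^ q) ^ a) ^ k \<noteq> 1"
    proof
      assume "((t ^ q) ^ a) ^ k = 1"
      hence 1: "((t ^ a) ^ k) ^ q = 1" by (simp only: power_mult[symmetric] mult_ac)
      have 2: "((t ^ a) ^ k) ^ r = 1" using power_a_kr[OF tU] by (simp add: power_mult)
      have "coprime r q" using coprime_r_p by simp
      hence "(t ^ a) ^ k = 1" by (rule root_of_unity_coprime[OF 2 1 _ r_pos])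
      thus False using t by (simp add: D2_def)
    qed
    thus ?thesis using D_frobenius[of t] t by (simp add: D2_def)
  qed
  have steps: "t ^ (q ^ i) \<in> D2" if "t \<in> D2" for t i
  proof (induction i)
    case (Suc i)
    thus ?case using step[of "t ^ (q ^ i)"] by (simp only: power_q_compose)
  qed (use that in simp)
  have shift: "(\<Sum>t\<in>D2. t ^ (a * j)) = (\<Sum>t\<in>D2. ((t ^ a) ^ (q ^ i)) ^ j)" if i: "i < r" for i
  proof -
    have inv: "(t ^ (q ^ (r - i))) ^ (q ^ i) = t" "(t ^ (q ^ i)) ^ (q ^ (r - i)) = t" if t: "t \<in> D2" for t
    proof -
      have "q ^ (r - i) * q ^ i = q ^ r" "q ^ i * q ^ (r - i) = q ^ r"
        using i by (simp_all add: power_add[symmetric])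
      moreover have "t ^ (q ^ r) = t" using t D_U by (intro power_qr_U) (auto simp: D2_def)
      ultimately show "(t ^ (q ^ (r - i))) ^ (q ^ i) = t" "(t ^ (q ^ i)) ^ (q ^ (r - i)) = t"
        by (simp_all only: power_mult[symmetric])
    qed
    have "(\<Sum>t\<in>D2. t ^ (a * j)) = (\<Sum>t\<in>D2. (t ^ (q ^ i)) ^ (a * j))"
      by (rule sum.reindex_bij_witness[of _ "\<lambda>t. t ^ (q ^ i)" "\<lambda>t. t ^ (q ^ (r - i))"])
         (simp_all only: steps inv)
    also have "\<dots> = (\<Sum>t\<in>D2. ((t ^ a) ^ (q ^ i)) ^ j)"
      by (simp only: power_mult[symmetric] mult_ac)
    finally show ?thesis .
  qed
  \<comment> \<open>Averaging over the \<open>r\<close> shifts avoids a decomposition of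
    \<open>D2\<close> into orbits.\<close>
  have "of_nat r * (\<Sum>t\<in>D2. t ^ (a * j)) = (\<Sum>i<r. \<Sum>t\<in>D2. ((t ^ a) ^ (q ^ i)) ^ j)"
  proof -
    have "(\<Sum>i<r. \<Sum>t\<in>D2. ((t ^ a) ^ (q ^ i)) ^ j) = (\<Sum>i<r. \<Sum>t\<in>D2. t ^ (a * j))"
      by (rule sum.cong[OF refl], rule shift[symmetric]) simp
    thus ?thesis by simp
  qed
  also have "\<dots> = (\<Sum>t\<in>D2. \<Sum>i<r. ((t ^ a) ^ (q ^ i)) ^ j)" by (rule sum.swap)
  also have "\<dots> = 0"
    using assms D_U power_a_kr by (intro sum.neutral ballI sum_frobenius_orbit) (auto simp: D2_def)
  finally show ?thesis using r_pos by (simp add: D2_def)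
qed

lemma ex_fixpoint: "\<exists>t0\<in>D. t0 ^ a = 1 \<and> (\<forall>t\<in>D. t ^ q = t \<longleftrightarrow> t = t0)"
proof -
  obtain v where v: "[r * v = Suc 0] (mod p)" using cong_solve_coprime_nat[OF coprime_r_p] by auto
  hence rv: "of_nat r * of_nat v \<doteq> 1" using eqm_of_nat[OF v] by simp
  define t0 where "t0 = K.rep (of_nat v)"
  have t0: "t0 \<in> K.T" "of_nat v \<doteq> t0" unfolding t0_def by (auto intro: K.rep_T K.rep_eqm K.of_nat_F)
  have rt0: "of_nat r * t0 \<doteq> 1"
    using eqm_trans[OF eqm_sym[OF eqm_mult[OF eqm_refl t0(2)]] rv] by simp
  have "t0 \<noteq> 0"
  proof
    assume "t0 = 0"
    hence "1 \<in> M" using rt0 eqm_sym[of 0 1] by (simp add: eqm_0_iff)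
    thus False by simp
  qed
  hence t0U: "t0 \<in> K.U" using t0 by (auto simp: K.T_def)
  \<comment> \<open>On the small field all \<open>r\<close> relative conjugates agree, so relative
    trace 1 means being \<open>1 / r\<close> there.\<close>
  have reltr_fixed: "reltr t = of_nat r * t" if "t \<in> K.U" for t
    using reltr_mult[OF that, of 1] by (simp add: reltr_def)
  have t0D: "t0 \<in> D"
    unfolding D_def using K_U_subset[OF t0U] rt0 reltr_fixed[OF t0U] by simp
  have "t0 ^ p \<doteq> of_nat v ^ p" by (rule eqm_power[OF eqm_sym[OF t0(2)]])
  also have "\<dots> \<doteq> of_nat v" using frobenius_power_of_nat[of v 1] by simp
  also note t0(2)
  finally have "t0 ^ p = t0" using t0 by (intro K.T_eqI K.power_T) auto
  moreover have "t0 ^ p = t0 ^ (p - 1) * t0" using p_pos by (metis power_minus_mult)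
  ultimately have "t0 ^ (p - 1) = 1" using \<open>t0 \<noteq> 0\<close> by simp
  moreover have "(t0 ^ a) ^ (p - 1) = (t0 ^ (p - 1)) ^ a" by (simp only: power_mult[symmetric] mult.commute)
  ultimately have "(t0 ^ a) ^ (p - 1) = 1" by (simp only: power_one)
  hence "t0 ^ a = 1"
    by (rule root_of_unity_coprime[OF power_a_kr[OF K_U_subset[OF t0U]] _ coprime_kr_pred mult_pos_pos[OF k_pos r_pos]])
  moreover have "t ^ q = t \<longleftrightarrow> t = t0" if t: "t \<in> D" for t
  proof
    assume "t ^ q = t"
    moreover have "t ^ q = t ^ (q - 1) * t" using pf_gt_1 by (intro power_minus_mult[symmetric]) simp
    moreover have "t \<noteq> 0" using D_U[OF t] L.U_nonzero by blast
    ultimately have tU: "t \<in> K.U" by (simp add: K.U_def)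
    have "of_nat r * t \<doteq> 1" using D_reltr[OF t] reltr_fixed[OF tU] by simp
    hence "(of_nat r * t) * of_nat v \<doteq> 1 * of_nat v" by (intro eqm_mult) auto
    moreover have "(of_nat r * of_nat v) * t \<doteq> 1 * t" using rv K.U_R[OF tU] by (intro eqm_mult) auto
    ultimately have "t \<doteq> of_nat v" using eqm_sym eqm_trans by (metis mult.assoc mult.commute mult_1)
    hence "t \<doteq> t0" using t0(2) by (rule eqm_trans)
    thus "t = t0" using tU t0 K.U_subset_T by (intro K.T_eqI) auto
  next
    assume "t = t0"
    thus "t ^ q = t" using K.power_q_T[OF t0(1)] by simp
  qed
  ultimately show ?thesis using t0D by blast
qed

text \<open>
  The only fixed point of Frobenius on the elements of relative trace 1 is \<open>1 / r\<close>, on which the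
  character is trivial; the other orbits on which the character is constant have length \<open>r\<close>.
\<close>

lemma E_cong:
  "\<exists>P. int_coeffs P \<and> (\<forall>j. coprime j k \<longrightarrow> E j - of_nat p ^ n = of_nat r * poly P (zeta k ^ j))"
proof -
  obtain t0 where t0: "t0 \<in> D" "t0 ^ a = 1" "\<And>t. t \<in> D \<Longrightarrow> t ^ q = t \<longleftrightarrow> t = t0"
    using ex_fixpoint by blast
  define S where "S i = {t \<in> D - {t0}. t ^ a = zeta k ^ i}" for i
  define c where "c i = card (S i) div r" for i
  have dvd_card: "r dvd card (S i)" for i
  proof (rule prime_dvd_card_no_fixpoints[where g = "\<lambda>t. t ^ q"])
    show "finite (S i)" "prime r" by (simp_all add: S_def prime_r)
    fix t assume t: "t \<in> S i"
    have tD: "t \<in> D" "t \<noteq> t0" "t ^ a = zeta k ^ i" using t by (auto simp: S_def)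
    show "t ^ q \<noteq> t" using t0(3)[OF tD(1)] tD by simp
    have iter: "((\<lambda>t. t ^ q) ^^ m) t = t ^ (q ^ m)" for m
      by (induction m) (simp_all only: funpow.simps comp_def id_apply power_q_compose power_0 power_one_right)
    show period: "((\<lambda>t. t ^ q) ^^ r) t = t" unfolding iter by (rule power_qr_U[OF D_U[OF tD(1)]])
    \<comment> \<open>Frobenius has finite order and fixes \<open>t0\<close>, so only
      \<open>t0\<close> is sent to \<open>t0\<close>.\<close>
    have "t ^ q \<noteq> t0"
    proof
      assume eq: "t ^ q = t0"
      obtain m where m: "r = Suc m" using r_pos by (cases r) auto
      have "t0 ^ (q ^ i) = t0" for i
      proof (induction i)
        case (Suc i)
        have "t0 ^ (q ^ Suc i) = (t0 ^ (q ^ i)) ^ q" by (rule power_q_compose[symmetric])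
        thus ?case unfolding Suc using t0 by simp
      qed simp
      moreover have "t ^ (q ^ r) = (t ^ q) ^ (q ^ m)" unfolding m by (simp only: power_mult[symmetric] power_Suc)
      ultimately have "t = t0" using period eq unfolding iter by simp
      thus False using tD by simp
    qed
    moreover have "(t ^ q) ^ a = zeta k ^ i"
    proof -
      have "(t ^ q) ^ a = (zeta k ^ i) ^ q" unfolding tD(3)[symmetric] by (simp only: power_mult[symmetric] mult.commute)
      also have "\<dots> = zeta k ^ i * ((zeta k ^ i) ^ k) ^ aK"
        unfolding q_eq by (simp only: power_add power_mult power_one_right)
      also have "\<dots> = zeta k ^ i" using zeta_power_power[OF k_pos] by simp
      finally show ?thesis .
    qed
    ultimately show "t ^ q \<in> S i" using D_frobenius[OF tD(1)] by (simp add: S_def)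
  qed
  have c: "card (S i) = r * c i" for i
    unfolding c_def by (rule dvd_mult_div_cancel[OF dvd_card, symmetric])
  \<comment> \<open>\<open>r\<close> divides \<open>k\<close>, hence \<open>q - 1\<close>, and
    \<open>p ^ n\<close> is a power of \<open>q\<close> since \<open>n\<close> is a multiple of
    \<open>f\<close>.\<close>
  have "int r dvd 1 - int p ^ n"
  proof -
    have "int r dvd int q - 1"
      using r_dvd_k unfolding q_eq by auto
    hence "[int q = 1] (mod int r)" by (simp only: cong_iff_dvd_diff)
    hence "[int q ^ ((r - 1) div 2) = 1 ^ ((r - 1) div 2)] (mod int r)" by (rule cong_pow)
    hence "[int p ^ n = 1] (mod int r)" by (simp add: n_def power_mult)
    hence "[1 = int p ^ n] (mod int r)" by (rule cong_sym)
    thus ?thesis by (simp only: cong_iff_dvd_diff)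
  qed
  then obtain d where d: "1 - int p ^ n = int r * d" by blast
  \<comment> \<open>The counts \<open>c i\<close> do not depend on \<open>j\<close>, so one
    polynomial serves all conjugates.\<close>
  define P where "P = [:of_int d:] + (\<Sum>i<k. Polynomial.monom (of_nat (c i) :: complex) i)"
  have "int_coeffs P"
    unfolding P_def by (intro int_coeffs_add int_coeffs_const int_coeffs_sum int_coeffs_monom) auto
  moreover have "E j - of_nat p ^ n = of_nat r * poly P (zeta k ^ j)" if j: "coprime j k" for j
  proof -
    have jr: "coprime j r" using j r_dvd_k by (metis coprime_divisors dvd_refl)
    define D1 where "D1 = {t \<in> D. (t ^ a) ^ k = 1}"
    have t0D1: "t0 \<in> D1" using t0 by (simp add: D1_def)
    have "E j = (\<Sum>t\<in>D1. t ^ (a * j)) + (\<Sum>t | t \<in> D \<and> (t ^ a) ^ k \<noteq> 1. t ^ (a * j))"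
      unfolding E_def D1_def by (subst sum.union_disjoint[symmetric]) (auto intro!: sum.cong)
    also have "\<dots> = (\<Sum>t\<in>D1. t ^ (a * j))" using sum_non_kth_roots[OF jr] by simp
    also have "\<dots> = 1 + (\<Sum>t\<in>D1 - {t0}. t ^ (a * j))"
      using t0D1 t0(2) by (subst sum.remove[of _ t0]) (auto simp: D1_def power_mult)
    also have "D1 - {t0} = (\<Union>i\<in>{..<k}. S i)"
    proof (intro equalityI subsetI)
      fix t assume t: "t \<in> D1 - {t0}"
      then obtain i where "i < k" "t ^ a = zeta k ^ i"
        using root_of_unity_zeta[OF k_pos, of "t ^ a"] by (auto simp: D1_def)
      thus "t \<in> (\<Union>i\<in>{..<k}. S i)" using t by (auto simp: S_def D1_def)
    next
      fix t assume "t \<in> (\<Union>i\<in>{..<k}. S i)"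
      then obtain i where "t \<in> D" "t \<noteq> t0" "t ^ a = zeta k ^ i" by (auto simp: S_def)
      thus "t \<in> D1 - {t0}" using zeta_power_power[OF k_pos, of i] by (simp add: D1_def)
    qed
    also have "(\<Sum>t\<in>(\<Union>i\<in>{..<k}. S i). t ^ (a * j)) = (\<Sum>i<k. \<Sum>t\<in>S i. t ^ (a * j))"
    proof (rule sum.UNION_disjoint)
      have "inj_on (\<lambda>i. zeta k ^ i) {..<k}"
        using bij_betw_roots_unity[OF k_pos] by (simp add: bij_betw_def zeta_power)
      thus "\<forall>i\<in>{..<k}. \<forall>i'\<in>{..<k}. i \<noteq> i' \<longrightarrow> S i \<inter> S i' = {}"
        unfolding inj_on_def S_def by auto
    qed (auto simp: S_def)
    also have "\<dots> = (\<Sum>i<k. of_nat r * (of_nat (c i) * (zeta k ^ j) ^ i))"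
    proof (rule sum.cong)
      fix i
      have "(\<Sum>t\<in>S i. t ^ (a * j)) = (\<Sum>t\<in>S i. (zeta k ^ j) ^ i)"
      proof (rule sum.cong)
        fix t assume "t \<in> S i"
        hence "t ^ a = zeta k ^ i" by (simp add: S_def)
        thus "t ^ (a * j) = (zeta k ^ j) ^ i"
          by (simp only: power_mult) (simp only: power_mult[symmetric] mult.commute)
      qed simp
      thus "(\<Sum>t\<in>S i. t ^ (a * j)) = of_nat r * (of_nat (c i) * (zeta k ^ j) ^ i)" by (simp add: c)
    qed simp
    finally have E: "E j = 1 + of_nat r * (\<Sum>i<k. of_nat (c i) * (zeta k ^ j) ^ i)"
      by (simp add: sum_distrib_left)
    have "of_int (1 - int p ^ n) = (of_int (int r * d) :: complex)" unfolding d ..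
    hence "1 - of_nat p ^ n = of_nat r * (of_int d :: complex)" by simp
    hence "E j - of_nat p ^ n = of_nat r * of_int d + of_nat r * (\<Sum>i<k. of_nat (c i) * (zeta k ^ j) ^ i)"
      unfolding E by (simp add: algebra_simps)
    thus ?thesis by (simp add: P_def poly_sum poly_monom distrib_left)
  qed
  ultimately show ?thesis by blast
qed

lemma E_eq: "E 1 = of_nat p ^ n"
proof -
  obtain P where P: "int_coeffs P" "\<And>j. coprime j k \<Longrightarrow> E j - of_nat p ^ n = of_nat r * poly P (zeta k ^ j)"
    using E_cong by blast
  have "poly P (zeta k) = 0"
  proof (rule int_poly_value_eq_0[where r = r and n = n])
    fix j assume j: "coprime j k"
    \<comment> \<open>Both terms on the right have absolute value \<open>p ^ n\<close>; this is the
      factor 2 of the bound.\<close>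
    have "norm (E j - of_nat p ^ n) \<le> norm (E j) + norm (of_nat p ^ n :: complex)" by (rule norm_triangle_ineq4)
    thus "norm (of_nat r * poly P (zeta k ^ j)) \<le> 2 * real p ^ n"
      unfolding P(2)[OF j, symmetric] by (simp add: norm_E[OF j] norm_power)
    have "ldvd (of_nat p ^ n) (of_nat p ^ n)" using ldvd_multI[OF one_R] by simp
    thus "ldvd (of_nat p ^ n) (of_nat r * poly P (zeta k ^ j))"
      unfolding P(2)[OF j, symmetric] by (intro ldvd_diff ldvd_E[OF j])
  qed (use k_pos r_ge_3 coprime_r_p P in auto)
  thus ?thesis using P(2)[of 1] by simp
qed

lemma G_tower: "L.G a = of_nat p ^ n * K.G aK"
  using L_G_eq[of 1] k_gt_1 E_eq by simp

lemma K_G_nonzero: "K.G aK \<noteq> 0"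
  using norm_K_G[of 1] pf_gt_1 by auto

end

section \<open>Orders and indices\<close>

text \<open>Lagrange's theorem for the subgroup generated by \<open>p\<close>, whose cardinality is
  the multiplicative order of \<open>p\<close>.\<close>

lemma unit_index_mult_ord:
  assumes "n \<ge> 2" "coprime p n"
  shows "unit_index n p * ord n p = totient n"
proof -
  interpret residues "int n" "residue_ring (int n)"
    using assms(1) by (simp add: residues_def)
  let ?R = "residue_ring (int n)"
  define G where "G = units_of ?R"
  define x where "x = int p mod int n"
  interpret G: group G unfolding G_def by (rule units_group)
  have x: "x \<in> carrier G"
    unfolding G_def x_def units_of_carrier using assms by (subst mod_in_res_units) auto
  have pow: "x [^]\<^bsub>G\<^esub> (m::nat) = int (p ^ m mod n)" for m
    using x units_of_pow[of x m] pow_cong[of "int p" m]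
    by (simp add: G_def units_of_carrier x_def zmod_int)
  have "G.ord x dvd m \<longleftrightarrow> ord n p dvd m" for m
  proof -
    have "G.ord x dvd m \<longleftrightarrow> x [^]\<^bsub>G\<^esub> m = \<one>\<^bsub>G\<^esub>" by (rule G.pow_eq_id[OF x, symmetric])
    also have "\<dots> \<longleftrightarrow> p ^ m mod n = 1"
      unfolding pow by (simp add: G_def units_of_one res_one_eq)
    also have "\<dots> \<longleftrightarrow> [p ^ m = 1] (mod n)" using assms(1) by (simp add: cong_def)
    also have "\<dots> \<longleftrightarrow> ord n p dvd m" by (rule ord_divides)
    finally show ?thesis .
  qed
  hence ord: "G.ord x = ord n p" by (meson dvd_antisym dvd_refl)
  have sub: "subgroup (generate G {x}) G" using x by (intro G.generate_is_subgroup) simp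
  have "card (rcosets\<^bsub>G\<^esub> generate G {x}) * card (generate G {x}) = Coset.order G"
    by (rule G.lagrange[OF sub])
  also have "Coset.order G = totient n"
    using totient_eq by (simp add: Coset.order_def G_def units_of_carrier)
  also have "card (generate G {x}) = ord n p" unfolding ord[symmetric] by (rule G.generate_pow_card[OF x, symmetric])
  finally show ?thesis by (simp add: unit_index_def G_def x_def Let_def)
qed

lemma totient_mult_dvd:
  assumes "r dvd k" "r > 0"
  shows "totient (k * r) = r * totient k"
proof -
  have "totient (k * r) * totient r = totient k * totient r * r"
    using totient_gcd[of k r] assms by (simp add: gcd_nat.absorb2)
  hence "totient (k * r) * totient r = r * totient k * totient r" by (simp only: mult_ac)
  moreover have "totient r > 0" using assms by simp
  ultimately show ?thesis by (metis mult_right_cancel less_irrefl)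
qed

section \<open>Ideals of cyclotomic rings\<close>

lemma cyclotomic_ring_ring: "ring (cyclotomic_ring n)"
proof -
  interpret ring "ring_of_type_algebra :: complex ring" by (rule ring_from_type_algebra)
  show ?thesis unfolding cyclotomic_ring_def
    by (rule generate_ring_is_ring) (simp add: ring_of_type_algebra_def)
qed

lemma a_inv_cyclotomic_ring:
  assumes "x \<in> cyc n"
  shows "\<ominus>\<^bsub>cyclotomic_ring n\<^esub> x = - x"
proof -
  interpret ring "cyclotomic_ring n" by (rule cyclotomic_ring_ring)
  interpret C: complex_subring "cyc n" by (rule cyc_subring)
  show ?thesis using assms C.uminus_closed by (intro minus_equality) auto
qed

lemma (in prime_ideal_in) ideal_Int_cyc:
  assumes "cyc n \<subseteq> A"
  shows "ideal (P \<inter> cyc n) (cyclotomic_ring n)"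
proof (rule idealI)
  interpret C: complex_subring "cyc n" by (rule cyc_subring)
  have uminus: "- x \<in> P" if "x \<in> P" for x
    using P_mult[OF uminus_closed[OF one_closed] that] by simp
  show "subgroup (P \<inter> cyc n) (add_monoid (cyclotomic_ring n))"
  proof
    fix x assume "x \<in> P \<inter> cyc n"
    thus "inv\<^bsub>add_monoid (cyclotomic_ring n)\<^esub> x \<in> P \<inter> cyc n"
      using a_inv_cyclotomic_ring[of x n] uminus C.uminus_closed by (simp add: a_inv_def)
  qed (auto intro: P_add P_zero C.add_closed C.zero_closed)
  fix u x assume ux: "u \<in> P \<inter> cyc n" "x \<in> carrier (cyclotomic_ring n)"
  thus "x \<otimes>\<^bsub>cyclotomic_ring n\<^esub> u \<in> P \<inter> cyc n"
    using assms by (auto intro: P_mult C.mult_closed)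
  thus "u \<otimes>\<^bsub>cyclotomic_ring n\<^esub> x \<in> P \<inter> cyc n" by (simp add: mult.commute)
qed (rule cyclotomic_ring_ring)

lemma ex_residue_model:
  assumes P: "prime_over n p P" and p: "prime p" and n: "n > 0" "n dvd p ^ F - 1" "F > 0"
  shows "\<exists>R M. residue_model R M p \<and> (\<forall>t. t ^ (p ^ F - 1) = 1 \<longrightarrow> t \<in> R) \<and> M \<inter> cyc n = P"
proof -
  \<comment> \<open>With this \<open>N\<close> the ring contains \<open>zeta p\<close> for the
    additive character and all roots of unity that represent the large field.\<close>
  define N where "N = p * (p ^ F - 1)"
  have "p ^ F > 1" using prime_gt_1_nat[OF p] n(3) by (metis one_less_power)
  hence N: "N > 0" "p ^ F - 1 > 0" using prime_gt_0_nat[OF p] by (auto simp: N_def)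
  have nN: "n dvd N" unfolding N_def using n(2) by simp
  interpret prime_ideal_in "cyc n" P by (rule prime_over_prime_ideal_in[OF P])
  have "\<exists>M. prime_ideal_in (cyc N) M \<and> M \<inter> cyc n = P"
  proof (rule lying_over[where g = "\<lambda>i. zeta N ^ i" and m = N])
    show "complex_subring (cyc N)" by (rule cyc_subring)
    show sub: "cyc n \<subseteq> cyc N" by (rule cyc_mono[OF N(1) nN n(1)])
    show "zeta N ^ i \<in> cyc N" for i by (intro complex_subring.power_closed[OF cyc_subring] zeta_cyc)
    fix x assume "x \<in> cyc N"
    then obtain b where b: "\<forall>i. b i \<in> \<int>" "x = (\<Sum>i<N. b i * zeta N ^ i)" using cyc_span[OF N(1)] by blast
    have "b i \<in> cyc n" for i
    proof -
      obtain z where "b i = of_int z" using b(1) by (auto elim: Ints_cases)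
      thus ?thesis by (simp only: of_int_closed)
    qed
    thus "\<exists>a. (\<forall>i. a i \<in> cyc n) \<and> x = (\<Sum>i<N. a i * zeta N ^ i)" using b(2) by blast
  qed
  then obtain M where M: "prime_ideal_in (cyc N) M" "M \<inter> cyc n = P" by blast
  interpret M: prime_ideal_in "cyc N" M by (rule M(1))
  have "residue_model (cyc N) M p"
  proof
    show "of_nat p \<in> M" using M(2) prime_over_prime_ideal_in(2)[OF P] by blast
    have "zeta p \<in> cyc p" by (rule zeta_cyc)
    also have "cyc p \<subseteq> cyc N" using N(1) prime_gt_0_nat[OF p] by (intro cyc_mono) (auto simp: N_def)
    finally show "zeta p \<in> cyc N" .
  qed (use M.one_closed M.add_closed M.uminus_closed M.mult_closed M.P_subset M.P_zero M.P_add M.P_mult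
        M.P_one M.P_prime p in auto)
  moreover have "t \<in> cyc N" if "t ^ (p ^ F - 1) = 1" for t
  proof -
    have "t \<in> cyc (p ^ F - 1)" by (rule root_of_unity_cyc[OF N(2) that])
    also have "\<dots> \<subseteq> cyc N" using N by (intro cyc_mono) (auto simp: N_def)
    finally show ?thesis .
  qed
  ultimately show ?thesis using M(2) by blast
qed

section \<open>The theorem: from the index hypothesis to the tower of fields\<close>

theorem theorem2p10:
  fixes h k k' t l p e f f' q q' :: nat
    and pr x :: "nat \<Rightarrow> nat"
    and P P' :: "complex set"
  assumes l: "l \<ge> 1"
    and pr: "\<And>i. i \<in> {1..l} \<Longrightarrow> prime (pr i) \<and> odd (pr i)"
    and distinct: "inj_on pr {1..l}"
    and h: "h = 2 ^ t * (\<Prod>i\<in>{1..l}. pr i)"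
    and p: "prime p" "\<not> p dvd h"
    and index: "\<And>s I y. \<lbrakk>s \<le> t; I \<subseteq> {1..l}; \<And>i. i \<in> I \<Longrightarrow> y i \<ge> 1\<rbrakk> \<Longrightarrow>
          unit_index (2 ^ s * (\<Prod>i\<in>I. pr i ^ y i)) p = unit_index (2 ^ s * (\<Prod>i\<in>I. pr i)) p"
    and e: "e = unit_index h p"
    and x: "\<And>i. i \<in> {1..l} \<Longrightarrow> x i \<ge> 1"
    and k: "k = 2 ^ t * (\<Prod>i\<in>{1..l}. pr i ^ x i)"
    and k': "k' = k * pr 1"
    and f: "f = totient k div e"
    and f': "f' = totient k' div e"
    and q: "q = p ^ f"
    and q': "q' = p ^ f'"
    and P': "prime_over k' p P'"
    and P: "P = P' \<inter> carrier (cyclotomic_ring k)"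
    and odd_k': "odd k'"
    and coprime_k': "gcd k' (p - 1) = 1"
  shows "vartheta p f' (cyclotomic_ring k' Quot P') (teichmueller k' q' P')
           f (cyclotomic_ring k Quot P) (teichmueller k q P) = 1
    \<and> gauss_sum p f' (cyclotomic_ring k' Quot P') (teichmueller k' q' P')
        = of_real (real p powr ((real f' - real f) / 2))
          * gauss_sum p f (cyclotomic_ring k Quot P) (teichmueller k q P)"
proof -
  define r where "r = pr 1"
  have r: "prime r" "odd r" using pr[of 1] l by (auto simp: r_def)
  have t: "t = 0" using odd_k' k unfolding k' by (cases t) auto
  have h: "h = (\<Prod>i\<in>{1..l}. pr i)" and k: "k = (\<Prod>i\<in>{1..l}. pr i ^ x i)"
    using assms(4) assms(10) t by auto
  have rk: "r dvd k"
  proof -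
    have "r dvd pr 1 ^ x 1" unfolding r_def using x[of 1] l by (intro dvd_power) auto
    also have "\<dots> dvd k" unfolding k using l by (intro dvd_prodI) auto
    finally show ?thesis .
  qed
  have k0: "k > 0" using odd_k' unfolding k' by (cases k) auto
  have kr: "k' = k * r" by (simp add: k' r_def)
  have k2: "k \<ge> 2" using dvd_imp_le[OF rk k0] prime_ge_2_nat[OF r(1)] by linarith
  have cop_pr: "coprime p (pr i)" if i: "i \<in> {1..l}" for i
  proof -
    have "pr i dvd h" unfolding h using i by (intro dvd_prodI) auto
    hence "\<not> p dvd pr i" using p(2) dvd_trans by blast
    thus ?thesis by (rule prime_imp_coprime[OF p(1)])
  qed
  have cop_k: "coprime p k" unfolding k using cop_pr by (intro prod_coprime_right) auto
  have cop_k': "coprime p k'" unfolding k' using cop_k cop_pr[of 1] l by auto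
  have eh: "e = unit_index (\<Prod>i\<in>{1..l}. pr i) p" using assms(8) h by simp
  have ek: "unit_index k p = e"
    using index[of 0 "{1..l}" x] x unfolding eh k by simp
  have ek': "unit_index k' p = e"
  proof -
    \<comment> \<open>The exponents of \<open>k'\<close>: those of \<open>k\<close> with the first
      one raised by 1.\<close>
    define y where "y i = (if i = 1 then Suc (x i) else x i)" for i
    have "(\<Prod>i\<in>{1..l}. pr i ^ y i) = (\<Prod>i\<in>{1..l}. pr i ^ x i * (if i = 1 then pr 1 else 1))"
      unfolding y_def by (intro prod.cong) auto
    also have "\<dots> = k'" unfolding k' k prod.distrib using l by (simp add: prod.delta)
    finally have "k' = (\<Prod>i\<in>{1..l}. pr i ^ y i)" ..
    moreover have "y i \<ge> 1" if "i \<in> {1..l}" for i using x[OF that] by (simp add: y_def)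
    ultimately show ?thesis using index[of 0 "{1..l}" y] unfolding eh by simp
  qed
  have "e * ord k p = totient k" using unit_index_mult_ord[OF k2 cop_k] ek by simp
  moreover from this have e0: "e > 0" using k0 by (cases e) auto
  ultimately have f_ord: "f = ord k p" unfolding f by (metis nonzero_mult_div_cancel_left neq0_conv)
  have "k * 1 \<le> k * r" using prime_ge_1_nat[OF r(1)] by (rule mult_le_mono2)
  hence k'2: "k' \<ge> 2" using k2 unfolding kr by linarith
  have tot': "e * ord k' p = totient k'" using unit_index_mult_ord[OF k'2 cop_k'] ek' by simp
  hence f'_ord: "f' = ord k' p" unfolding f' using e0 by (metis nonzero_mult_div_cancel_left less_irrefl)
  \<comment> \<open>Both moduli have index \<open>e\<close>, so the orders are in the same ratio as
    the totients, which is \<open>r\<close> because \<open>r\<close> divides \<open>k\<close>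
    already.\<close>
  have "e * ord k' p = r * (e * ord k p)"
    using tot' totient_mult_dvd[OF rk prime_gt_0_nat[OF r(1)]] \<open>e * ord k p = totient k\<close> unfolding kr by simp
  hence "e * f' = e * (r * f)" unfolding f_ord f'_ord by (simp only: mult_ac)
  hence f'_eq: "f' = r * f" using e0 by simp
  have "coprime k' p" using cop_k' by (simp add: coprime_commute)
  hence f'0: "f' > 0" unfolding f'_ord by (simp only: ord_gt_0_iff)
  have "[p ^ f' = 1] (mod k')" unfolding f'_ord using ord_divides[of p "ord k' p" k'] by simp
  moreover have "p ^ f' \<ge> 1" using prime_gt_0_nat[OF p(1)] by simp
  ultimately have dvd: "k' dvd p ^ f' - 1" by (simp add: cong_altdef_nat)
  obtain R M where RM: "residue_model R M p" "\<forall>t. t ^ (p ^ f' - 1) = 1 \<longrightarrow> t \<in> R" "M \<inter> cyc k' = P'"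
    using ex_residue_model[OF P' p(1) _ dvd f'0] k'2 by auto
  interpret residue_model R M p by (rule RM(1))
  interpret W: gauss_tower R M p f k r
  proof
    show "ord (k * r) p = r * f" using f'_ord f'_eq kr by simp
    show "coprime (k * r) p" using cop_k' kr by (simp add: coprime_commute)
    show "coprime (k * r) (p - 1)" using coprime_k' unfolding kr by (simp only: coprime_iff_gcd_eq_1)
    show "t \<in> R" if "t ^ (p ^ (r * f) - 1) = 1" for t using RM(2) that unfolding f'_eq by blast
  qed (use r rk k0 f_ord in auto)
  have k'0: "k' > 0" using k'2 by simp
  have sub: "cyc k \<subseteq> cyc k'" using k0 k'0 by (intro cyc_mono) (simp_all add: kr)
  have P'_ideal: "prime_ideal_in (cyc k') P'" by (rule prime_over_prime_ideal_in[OF P'])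
  have P_eq: "P = P' \<inter> cyc k" using P by simp
  have "ideal (P' \<inter> cyc k') (cyclotomic_ring k')"
    by (rule prime_ideal_in.ideal_Int_cyc[OF P'_ideal subset_refl])
  moreover have "P' \<inter> cyc k' = P'" using RM(3) by blast
  ultimately have ideal_P': "ideal P' (cyclotomic_ring k')" by (simp only:)
  have ord_k': "ord k' p = r * f" using f'_ord f'_eq by simp
  have GL: "gauss_sum p f' (cyclotomic_ring k' Quot P') (teichmueller k' q' P') = W.L.G W.a"
    using W.L.gauss_sum_eq_G[OF k'0 ord_k' ideal_P' RM(3)[symmetric]]
    by (simp only: f'_eq q' W.a_def kr)
  have ideal_P: "ideal P (cyclotomic_ring k)"
    unfolding P_eq by (rule prime_ideal_in.ideal_Int_cyc[OF P'_ideal sub])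
  have PM: "P = M \<inter> cyc k" unfolding P_eq using RM(3) sub by blast
  have GK: "gauss_sum p f (cyclotomic_ring k Quot P) (teichmueller k q P) = W.K.G W.aK"
    using W.K.gauss_sum_eq_G[OF k0 f_ord[symmetric] ideal_P PM] by (simp only: W.aK_def q)
  have "2 * ((r - 1) div 2) + 1 = r" using r(2) by presburger
  hence "(2 * ((r - 1) div 2) + 1) * f = r * f" by (simp only:)
  hence "f' = 2 * W.n + f" unfolding W.n_def f'_eq by (simp add: algebra_simps)
  hence "(real f' - real f) / 2 = real W.n" by simp
  hence pow: "real p powr ((real f' - real f) / 2) = real p ^ W.n"
    using p_pos by (simp add: powr_realpow)
  have "W.L.G W.a = of_real (real p powr ((real f' - real f) / 2)) * W.K.G W.aK"
    unfolding pow W.G_tower by simp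
  moreover have "of_real (real p powr ((real f' - real f) / 2)) * W.K.G W.aK \<noteq> 0"
    unfolding pow using W.K_G_nonzero p_pos by simp
  ultimately show ?thesis unfolding vartheta_def GL GK by simp
qed

end
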